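(* For integers $r\geq3$ and $\ell\geq r$, there exists $s_0=s_0(\ell,r)$ such that for all integers $s\geq s_0$ and all sufficiently large $n$ (depending on $s,\ell,r$), $$\mathrm{ex}_r\left(n,\{K_{\ell+1}^{(r)+},M^{(r)+}_{s+1}\}\right)=s\cdot t_{r-1}(n-s,\ell-1).$$
   Context: An $r$-graph is an $r$-uniform hypergraph. For a graph $F$, the $r$-expansion $F^{(r)+}$ is the $r$-graph obtained from $F$ by adding, for each edge of $F$, $r-2$ new vertices to that edge, all new vertices being distinct from each other and from $V(F)$. $K_{\ell+1}$ is the complete graph on $\ell+1$ vertices. $M^{(r)+}_{s+1}$ is the $r$-uniform matching consisting of $s+1$ pairwise disjoint hyperedges. $\mathrm{ex}_r(n,\mathcal{F})$ is the maximum number of hyperedges in an $n$-vertex $r$-graph containing no member of the family $\mathcal{F}$ as a subhypergraph. For integers $q\ge 2$, $m\ge 1$, $k\ge 2$, $t_q(m,k)$ denotes the number of hyperedges of the complete balanced $k$-partite $q$-graph on $m$ vertices, i.e. the $q$-graph whose vertex set is partitioned into $k$ parts of sizes $\lfloor m/k\rfloor$ or $\lceil m/k\rceil$ and whose hyperedges are all $q$-sets meeting each part in at most one vertex. *)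

theory Defs
  imports Main
begin

record 'a hypergraph =
  hverts :: "'a set"
  hedges :: "'a set set"

definition r_graph :: "nat \<Rightarrow> 'a hypergraph \<Rightarrow> bool" where
  "r_graph r H \<longleftrightarrow> finite (hverts H) \<and> (\<forall>e\<in>hedges H. e \<subseteq> hverts H \<and> card e = r)"

text \<open>Not necessarily induced copies: \<open>H\<close> contains \<open>F\<close> if \<open>F\<close> is isomorphic to a
  subhypergraph of \<open>H\<close>.\<close>

definition contains_copy :: "'a hypergraph \<Rightarrow> 'b hypergraph \<Rightarrow> bool" where
  "contains_copy H F \<longleftrightarrow>
     (\<exists>f. inj_on f (hverts F) \<and> f ` hverts F \<subseteq> hverts H \<and> (\<forall>e\<in>hedges F. f ` e \<in> hedges H))"

definition family_free :: "'b hypergraph set \<Rightarrow> 'a hypergraph \<Rightarrow> bool" where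
  "family_free \<F> H \<longleftrightarrow> (\<forall>F\<in>\<F>. \<not> contains_copy H F)"

text \<open>The maximum is over labelled \<open>r\<close>-graphs on the fixed vertex set \<open>{..<n}\<close>. The set of
  sizes is finite, and it is nonempty as soon as every member of \<open>\<F>\<close> has a hyperedge.\<close>

definition ex_number :: "nat \<Rightarrow> nat \<Rightarrow> 'b hypergraph set \<Rightarrow> nat" where
  "ex_number r n \<F> =
     Max {card (hedges H) | H :: nat hypergraph.
            hverts H = {..<n} \<and> r_graph r H \<and> family_free \<F> H}"

definition complete_graph :: "nat \<Rightarrow> nat hypergraph" where
  "complete_graph k = \<lparr>hverts = {..<k}, hedges = {e. e \<subseteq> {..<k} \<and> card e = 2}\<rparr>"

definition matching_graph :: "nat \<Rightarrow> nat hypergraph" where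
  "matching_graph k = \<lparr>hverts = {..<2 * k}, hedges = (\<lambda>i. {2 * i, 2 * i + 1}) ` {..<k}\<rparr>"

text \<open>The new vertices added to the edge \<open>e\<close> are \<open>Inr (e, 0), \<dots>, Inr (e, r - 3)\<close>.\<close>

definition expansion :: "nat \<Rightarrow> 'a hypergraph \<Rightarrow> ('a + 'a set \<times> nat) hypergraph" where
  "expansion r F =
     \<lparr>hverts = Inl ` hverts F \<union> Inr ` (hedges F \<times> {..<r - 2}),
      hedges = (\<lambda>e. Inl ` e \<union> Inr ` ({e} \<times> {..<r - 2})) ` hedges F\<rparr>"

text \<open>The parts are the residue classes modulo \<open>k\<close> in \<open>{..<m}\<close>; see \<open>card_turan_part\<close>.\<close>

definition turan_part :: "nat \<Rightarrow> nat \<Rightarrow> nat \<Rightarrow> nat set" where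
  "turan_part m k i = {v. v < m \<and> v mod k = i}"

definition turan_hypergraph :: "nat \<Rightarrow> nat \<Rightarrow> nat \<Rightarrow> nat hypergraph" where
  "turan_hypergraph q m k =
     \<lparr>hverts = {..<m},
      hedges = {e. e \<subseteq> {..<m} \<and> card e = q \<and> (\<forall>i<k. card (e \<inter> turan_part m k i) \<le> 1)}\<rparr>"

definition turan_count :: "nat \<Rightarrow> nat \<Rightarrow> nat \<Rightarrow> nat" where
  "turan_count q m k = card (hedges (turan_hypergraph q m k))"

lemma card_turan_part:
  assumes "i < k"
  shows "card (turan_part m k i) = (if i < m mod k then m div k + 1 else m div k)"
proof -
  define c where "c = (if i < m mod k then m div k + 1 else m div k)"
  have lt: "j * k + i < m \<longleftrightarrow> j < c" for j
  proof -
    obtain a b where a: "a = m div k" and b: "b = m mod k" by blast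
    have m: "m = a * k + b" by (simp add: a b)
    have r: "b < k" using assms by (simp add: b)
    consider "j < a" | "j = a" | "j > a" by linarith
    then show ?thesis
    proof cases
      case 1
      then have "(j + 1) * k \<le> a * k" by (intro mult_le_mono1) simp
      then have "j * k + i < m" unfolding m using assms by simp
      then show ?thesis using 1 by (simp add: c_def a)
    next
      case 2
      have "j * k + i < m \<longleftrightarrow> i < b" unfolding m 2 by simp
      then show ?thesis by (simp add: 2 c_def a b)
    next
      case 3
      then have "(a + 1) * k \<le> j * k" by (intro mult_le_mono1) simp
      then have "\<not> j * k + i < m" unfolding m using r by simp
      then show ?thesis using 3 by (simp add: c_def a)
    qed
  qed
  have "turan_part m k i = (\<lambda>j. j * k + i) ` {..<c}"
  proof (intro set_eqI iffI)
    fix v assume "v \<in> turan_part m k i"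
    then have v: "v < m" "v mod k = i" by (auto simp: turan_part_def)
    have e: "v = v div k * k + i" unfolding v(2)[symmetric] by simp
    have "v div k * k + i < m" unfolding v(2)[symmetric] using v(1) by simp
    then have "v div k \<in> {..<c}" by (simp add: lt)
    with e show "v \<in> (\<lambda>j. j * k + i) ` {..<c}" by (rule image_eqI)
  next
    fix v assume "v \<in> (\<lambda>j. j * k + i) ` {..<c}"
    then obtain j where "j < c" "v = j * k + i" by blast
    then show "v \<in> turan_part m k i" using assms by (simp add: turan_part_def lt)
  qed
  moreover have "inj_on (\<lambda>j. j * k + i) {..<c}" using assms by (auto simp: inj_on_def)
  ultimately show ?thesis by (simp add: card_image c_def)
qed

lemma turan_parts_partition:
  assumes "0 < k"
  shows "(\<Union>i<k. turan_part m k i) = {..<m}"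
    and "i \<noteq> j \<Longrightarrow> turan_part m k i \<inter> turan_part m k j = {}"
  using assms by (auto simp: turan_part_def)

text \<open>The \<open>r\<close>-expansion of a graph matching with \<open>k\<close> edges is the \<open>r\<close>-uniform matching with
  \<open>k\<close> hyperedges.\<close>

lemma card_expanded_edge:
  assumes "2 \<le> r" "card e = 2"
  shows "card (Inl ` e \<union> Inr ` ({e} \<times> {..<r - 2})) = r" (is "card (?A \<union> ?B) = r")
proof -
  have "finite e" using assms(2) by (intro card_ge_0_finite) simp
  then have "card (?A \<union> ?B) = card ?A + card ?B"
    by (subst card_Un_disjoint) auto
  then show ?thesis using assms by (simp add: card_image card_cartesian_product)
qed

lemma r_graph_expansion:
  assumes "2 \<le> r" "r_graph 2 F"
  shows "r_graph r (expansion r F)"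
proof -
  have "hedges F \<subseteq> Pow (hverts F)" using assms(2) by (auto simp: r_graph_def)
  then have fin: "finite (hedges F)"
    using assms(2) by (meson finite_Pow_iff finite_subset r_graph_def)
  have e: "card e = 2" "e \<subseteq> hverts F" if "e \<in> hedges F" for e
    using that assms(2) by (auto simp: r_graph_def)
  have "finite (hverts F)" using assms(2) by (simp add: r_graph_def)
  then have "finite (hverts (expansion r F))" using fin by (simp add: expansion_def)
  moreover have "h \<subseteq> hverts (expansion r F) \<and> card h = r"
    if h: "h \<in> hedges (expansion r F)" for h
  proof -
    obtain d where d: "d \<in> hedges F" "h = Inl ` d \<union> Inr ` ({d} \<times> {..<r - 2})"
      using h by (auto simp: expansion_def)
    have "card h = r" unfolding d(2) by (rule card_expanded_edge[OF assms(1) e(1)[OF d(1)]])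
    then show ?thesis using d e(2)[OF d(1)] by (auto simp: expansion_def)
  qed
  ultimately show ?thesis by (simp add: r_graph_def)
qed

lemma expansion_matching_graph:
  fixes r k :: nat
  assumes "2 \<le> r"
  defines "M \<equiv> expansion r (matching_graph k)"
  shows "r_graph r M" and "pairwise disjnt (hedges M)" and "card (hedges M) = k"
    and "hverts M = \<Union> (hedges M)"
proof -
  define d :: "nat \<Rightarrow> nat set" where "d i = {2 * i, 2 * i + 1}" for i
  define g :: "nat \<Rightarrow> (nat + nat set \<times> nat) set" where
    "g i = Inl ` d i \<union> Inr ` ({d i} \<times> {..<r - 2})" for i
  have M: "matching_graph k = \<lparr>hverts = {..<2 * k}, hedges = d ` {..<k}\<rparr>"
    by (simp add: matching_graph_def d_def)
  have edges: "hedges M = g ` {..<k}"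
    by (simp add: M_def expansion_def M image_image g_def)
  have "card (d i) = 2" "i < k \<Longrightarrow> d i \<subseteq> {..<2 * k}" for i
    by (auto simp: d_def)
  then have "r_graph 2 (matching_graph k)" unfolding r_graph_def M by simp
  then show "r_graph r M" unfolding M_def by (rule r_graph_expansion[OF assms(1)])
  have disj: "disjnt (g i) (g j)" if "i \<noteq> j" for i j
  proof -
    have "2 * i \<noteq> 2 * j + 1" "2 * j \<noteq> 2 * i + 1" by presburger+
    then have "d i \<inter> d j = {}" using that by (simp add: d_def)
    moreover have "d i \<noteq> {}" by (simp add: d_def)
    ultimately show ?thesis unfolding disjnt_def g_def by blast
  qed
  then show "pairwise disjnt (hedges M)" unfolding edges
    by (intro pairwiseI) (metis imageE)
  have "inj_on g {..<k}"
  proof (rule inj_onI)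
    fix i j assume "g i = g j"
    moreover have "Inl (2 * i) \<in> g i" by (simp add: g_def d_def)
    ultimately have "\<not> disjnt (g i) (g j)" by (metis disjnt_iff)
    then show "i = j" using disj[of i j] by argo
  qed
  then show "card (hedges M) = k" by (simp add: edges card_image)
  have "{..<2 * k} = (\<Union>i<k. d i)"
  proof
    show "{..<2 * k} \<subseteq> (\<Union>i<k. d i)"
    proof
      fix v assume "v \<in> {..<2 * k}"
      then have "v < 2 * k" by simp
      then have "v div 2 < k" by linarith
      moreover have "v = 2 * (v div 2) \<or> v = 2 * (v div 2) + 1" by presburger
      then have "v \<in> d (v div 2)" unfolding d_def by blast
      ultimately show "v \<in> (\<Union>i<k. d i)" by blast
    qed
    show "(\<Union>i<k. d i) \<subseteq> {..<2 * k}" by (auto simp: d_def)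
  qed
  then have "hverts M = Inl ` (\<Union>i<k. d i) \<union> Inr ` (d ` {..<k} \<times> {..<r - 2})"
    by (simp add: M_def expansion_def M)
  also have "\<dots> = (\<Union>i<k. g i)" by (auto simp: g_def)
  finally show "hverts M = \<Union> (hedges M)" by (simp add: edges)
qed

end

theory Submission
  imports Defs Complex_Main
begin

text \<open>Let \<open>S\<close> be the set of vertices whose degree exceeds a large multiple of \<open>n ^ (r - 2)\<close>. Choosing
  hyperedges greedily shows \<open>card S \<le> s\<close>, with equality only if every hyperedge meets \<open>S\<close>; if
  \<open>card S < s\<close> there are too few hyperedges. So assume that every hyperedge meets \<open>S\<close>, and call a
  pair of vertices flexible if it lies in a hyperedge avoiding any given set of bounded size. A
  non-flexible pair is blocked by a bounded set, so it lies in few hyperedges, apart from those through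
  boundedly many vertices of \<open>S\<close>; for large \<open>s\<close> this is negligible. By greedy embedding, no \<open>l + 1\<close>
  vertices are pairwise flexible, even if one of the pairs is only covered by a single hyperedge that
  contains no further vertex of the clique. Deleting vertices of small degree (progressive induction), we
  may assume a minimum degree; together with Zykov's theorem this makes the flexible graph outside \<open>S\<close>
  nearly complete \<open>(l - 1)\<close>-partite. Then a hyperedge with two vertices in one part, or with two
  vertices in \<open>S\<close>, would supply the last pair of a clique, so all links of vertices of \<open>S\<close> are
  \<open>(l - 1)\<close>-partite with the same parts.\<close>

section \<open>Elementary symmetric sums and Turan numbers\<close>

text \<open>In the code \<open>p\<close> is \<open>r - 2\<close> and \<open>k\<close> is
  \<open>l - 1\<close>, so the main term is \<open>s\<close> times a Turan count of
  \<open>(p + 1)\<close>-sets in \<open>k\<close> parts, of order \<open>s * N ^ (p + 1)\<close>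
  with \<open>N\<close> the number of vertices outside \<open>S\<close>. The obstacle is that a set
  blocking a pair may lie in \<open>S\<close>. A hyperedge through a blocked pair contains either a
  third prescribed vertex outside \<open>S\<close>, which saves a factor \<open>N\<close>, or one of
  boundedly many vertices of \<open>S\<close>, which saves no power of \<open>N\<close> but replaces
  the factor \<open>s\<close> by a constant. Errors of the second kind are the reason why
  \<open>s\<close> has to be large in terms of \<open>k\<close> and \<open>p\<close>; no growth of
  \<open>n\<close> removes them. They also mean that stability holds at first only for most vertices
  of \<open>S\<close> (the rich ones) and most vertices outside (the typical ones). The exceptions
  are treated afterwards: atypical vertices are attached to parts by a second degree count that uses
  the partition instead of cliques, and a single poor vertex of \<open>S\<close> costs more
  hyperedges than all lower-order terms could return.\<close>

definition esym :: "nat \<Rightarrow> 'i set \<Rightarrow> ('i \<Rightarrow> nat) \<Rightarrow> nat" where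
  "esym p D w = (\<Sum>c | c \<subseteq> D \<and> card c = p. \<Prod>i\<in>c. w i)"

lemma esym_0 [simp]: "finite D \<Longrightarrow> esym 0 D w = 1"
proof -
  assume "finite D"
  then have "{c. c \<subseteq> D \<and> card c = 0} = {{}}" by (auto dest: finite_subset)
  then show ?thesis unfolding esym_def by (simp only:) simp
qed

lemma esym_Suc_empty [simp]: "esym (Suc p) {} w = 0"
proof -
  have "c \<subseteq> {} \<and> card c = Suc p \<longleftrightarrow> False" for c :: "'a set" by auto
  then show ?thesis unfolding esym_def by simp
qed

lemma card_subsets_insert:
  assumes "finite D" "i \<notin> D"
  shows "{c. c \<subseteq> insert i D \<and> card c = Suc p}
    = {c. c \<subseteq> D \<and> card c = Suc p} \<union> insert i ` {c. c \<subseteq> D \<and> card c = p}" (is "?L = ?A \<union> ?B")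
proof (intro equalityI subsetI)
  fix c assume c: "c \<in> ?L"
  show "c \<in> ?A \<union> ?B"
  proof (cases "i \<in> c")
    case True
    have "finite c" using c assms(1) finite_subset by auto
    then have "c = insert i (c - {i})" "card (c - {i}) = p" "c - {i} \<subseteq> D" using c True by auto
    then show ?thesis by blast
  next
    case False
    then show ?thesis using c by blast
  qed
next
  fix c assume "c \<in> ?A \<union> ?B"
  then show "c \<in> ?L"
  proof
    assume "c \<in> ?B"
    then obtain d where d: "d \<subseteq> D" "card d = p" "c = insert i d" by blast
    then have "finite d" "i \<notin> d" using assms finite_subset by auto
    then show ?thesis using d by auto
  qed auto
qed

lemma esym_insert:
  assumes "finite D" "i \<notin> D"
  shows "esym (Suc p) (insert i D) w = esym (Suc p) D w + w i * esym p D w"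
proof -
  let ?A = "{c. c \<subseteq> D \<and> card c = Suc p}" and ?B = "{c. c \<subseteq> D \<and> card c = p}"
  have fin: "finite ?A" "finite ?B" using assms(1) by auto
  have inj: "inj_on (insert i) ?B"
  proof (rule inj_onI)
    fix x y assume a: "x \<in> ?B" "y \<in> ?B" "insert i x = insert i y"
    then have "i \<notin> x" "i \<notin> y" using assms(2) by auto
    then show "x = y" using a(3) by (metis insert_ident)
  qed
  have disj: "?A \<inter> insert i ` ?B = {}" using assms(2) by blast
  have "esym (Suc p) (insert i D) w = (\<Sum>c\<in>?A \<union> insert i ` ?B. \<Prod>i\<in>c. w i)"
    unfolding esym_def card_subsets_insert[OF assms] ..
  also have "\<dots> = esym (Suc p) D w + (\<Sum>c\<in>insert i ` ?B. \<Prod>i\<in>c. w i)"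
    unfolding esym_def by (rule sum.union_disjoint) (use fin disj in auto)
  also have "(\<Sum>c\<in>insert i ` ?B. \<Prod>i\<in>c. w i) = (\<Sum>c\<in>?B. \<Prod>i\<in>insert i c. w i)"
    using inj by (simp add: sum.reindex)
  also have "\<dots> = (\<Sum>c\<in>?B. w i * (\<Prod>i\<in>c. w i))"
  proof (rule sum.cong[OF refl])
    fix c assume "c \<in> ?B"
    then have "finite c" "i \<notin> c" using assms finite_subset by auto
    then show "(\<Prod>i\<in>insert i c. w i) = w i * (\<Prod>i\<in>c. w i)" by simp
  qed
  also have "\<dots> = w i * esym p D w" unfolding esym_def by (simp add: sum_distrib_left)
  finally show ?thesis .
qed

lemma esym_cong: "(\<And>i. i \<in> D \<Longrightarrow> w i = w' i) \<Longrightarrow> esym p D w = esym p D w'"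
  unfolding esym_def by (intro sum.cong prod.cong refl) auto

lemma esym_mono_set:
  assumes "finite D'" "D \<subseteq> D'"
  shows "esym p D w \<le> esym p D' w"
  unfolding esym_def by (rule sum_mono2) (use assms in auto)

lemma esym_reindex:
  assumes "bij_betw f D D'"
  shows "esym p D (w \<circ> f) = esym p D' w"
proof -
  have inj: "inj_on f D" and im: "f ` D = D'" using assms by (auto simp: bij_betw_def)
  have "bij_betw (image f) {c. c \<subseteq> D \<and> card c = p} {c. c \<subseteq> D' \<and> card c = p}"
  proof (rule bij_betwI')
    fix x y assume "x \<in> {c. c \<subseteq> D \<and> card c = p}" "y \<in> {c. c \<subseteq> D \<and> card c = p}"
    then show "f ` x = f ` y \<longleftrightarrow> x = y" using inj by (simp add: inj_on_image_eq_iff)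
  next
    fix x assume "x \<in> {c. c \<subseteq> D \<and> card c = p}"
    then show "f ` x \<in> {c. c \<subseteq> D' \<and> card c = p}" using inj im
      by (auto simp: card_image inj_on_subset)
  next
    fix y assume y: "y \<in> {c. c \<subseteq> D' \<and> card c = p}"
    then obtain x where x: "x \<subseteq> D" "y = f ` x" using im by (metis mem_Collect_eq subset_imageE)
    then show "\<exists>x\<in>{c. c \<subseteq> D \<and> card c = p}. y = f ` x" using y inj
      by (intro bexI[of _ x]) (auto simp: card_image inj_on_subset)
  qed
  then have "(\<Sum>c | c \<subseteq> D' \<and> card c = p. \<Prod>i\<in>c. w i)
      = (\<Sum>c | c \<subseteq> D \<and> card c = p. \<Prod>i\<in>f ` c. w i)"
    by (rule sum.reindex_bij_betw[symmetric])
  also have "\<dots> = (\<Sum>c | c \<subseteq> D \<and> card c = p. \<Prod>i\<in>c. w (f i))"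
    by (intro sum.cong refl prod.reindex_cong[OF _ refl refl]) (use inj inj_on_subset in auto)
  finally show ?thesis unfolding esym_def by simp
qed

lemma esym_le_power:
  assumes "finite D" "\<And>i. i \<in> D \<Longrightarrow> real (w i) \<le> a"
  shows "real (esym p D w) \<le> real (card D choose p) * a ^ p"
proof -
  have "real (esym p D w) = (\<Sum>c | c \<subseteq> D \<and> card c = p. \<Prod>i\<in>c. real (w i))"
    unfolding esym_def by simp
  also have "\<dots> \<le> (\<Sum>c | c \<subseteq> D \<and> card c = p. a ^ p)"
  proof (rule sum_mono)
    fix c assume "c \<in> {c. c \<subseteq> D \<and> card c = p}"
    then have c: "c \<subseteq> D" "card c = p" by auto
    have "(\<Prod>i\<in>c. real (w i)) \<le> (\<Prod>i\<in>c. a)" using c assms(2) by (intro prod_mono) auto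
    then show "(\<Prod>i\<in>c. real (w i)) \<le> a ^ p" using c by simp
  qed
  also have "\<dots> = real (card D choose p) * a ^ p" using n_subsets[OF assms(1)] by simp
  finally show ?thesis .
qed

lemma esym_ge_power:
  assumes "finite D" "\<And>i. i \<in> D \<Longrightarrow> a \<le> w i"
  shows "(card D choose p) * a ^ p \<le> esym p D w"
proof -
  have "(card D choose p) * a ^ p = (\<Sum>c | c \<subseteq> D \<and> card c = p. a ^ p)"
    using n_subsets[OF assms(1)] by simp
  also have "\<dots> \<le> (\<Sum>c | c \<subseteq> D \<and> card c = p. \<Prod>i\<in>c. w i)"
  proof (rule sum_mono)
    fix c assume "c \<in> {c. c \<subseteq> D \<and> card c = p}"
    then have c: "c \<subseteq> D" "card c = p" by auto
    have "(\<Prod>i\<in>c. a) \<le> (\<Prod>i\<in>c. w i)" using c assms(2) by (intro prod_mono) auto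
    then show "a ^ p \<le> (\<Prod>i\<in>c. w i)" using c by simp
  qed
  finally show ?thesis unfolding esym_def .
qed

section \<open>Crossing sets, and Turan counts as symmetric sums of part sizes\<close>

definition crossing :: "'i set \<Rightarrow> ('i \<Rightarrow> 'a set) \<Rightarrow> nat \<Rightarrow> 'a set set" where
  "crossing I A p = {e. e \<subseteq> (\<Union>i\<in>I. A i) \<and> card e = p \<and> (\<forall>i\<in>I. card (e \<inter> A i) \<le> 1)}"

text \<open>A crossing set amounts to a choice of \<open>p\<close> parts and of one vertex in each;
  the induction splits off one part.\<close>

lemma card_crossing:
  assumes "finite I" "\<And>i. i \<in> I \<Longrightarrow> finite (A i)"
    and "\<And>i j. i \<in> I \<Longrightarrow> j \<in> I \<Longrightarrow> i \<noteq> j \<Longrightarrow> A i \<inter> A j = {}"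
  shows "card (crossing I A p) = esym p I (\<lambda>i. card (A i))"
  using assms
proof (induction I arbitrary: p rule: finite_induct)
  case empty
  show ?case
  proof (cases p)
    case 0
    then have "crossing {} A p = {{}}" unfolding crossing_def by auto
    then show ?thesis using 0 by simp
  next
    case (Suc q)
    then have "crossing {} A p = {}" unfolding crossing_def by auto
    then show ?thesis using Suc by simp
  qed
next
  case (insert i I)
  have fin: "finite (\<Union>j\<in>I. A j)" using insert by auto
  have finc: "finite (crossing I A q)" for q
    using fin unfolding crossing_def by (auto intro: rev_finite_subset[of "Pow (\<Union>j\<in>I. A j)"])
  have dj: "A i \<inter> (\<Union>j\<in>I. A j) = {}" using insert.hyps insert.prems(2)[of i] by auto
  show ?case
  proof (cases p)
    case 0
    have "crossing (insert i I) A p = {{}}"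
    proof -
      have "finite (\<Union>j\<in>insert i I. A j)" using insert by auto
      then show ?thesis using 0 unfolding crossing_def by (auto dest: finite_subset)
    qed
    then show ?thesis using 0 insert.hyps by simp
  next
    case (Suc q)
    have split: "crossing (insert i I) A (Suc q)
        = crossing I A (Suc q) \<union> (\<lambda>(x, e). insert x e) ` (A i \<times> crossing I A q)" (is "?L = ?P \<union> ?Q")
    proof (intro equalityI subsetI)
      fix e assume e: "e \<in> ?L"
      then have e1: "e \<subseteq> A i \<union> (\<Union>j\<in>I. A j)" "card e = Suc q" "card (e \<inter> A i) \<le> 1"
        "\<And>j. j \<in> I \<Longrightarrow> card (e \<inter> A j) \<le> 1" unfolding crossing_def by auto
      have fe: "finite e" using e1(2) by (simp add: card_ge_0_finite)
      show "e \<in> ?P \<union> ?Q"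
      proof (cases "e \<inter> A i = {}")
        case True
        then have "e \<in> ?P" using e1 unfolding crossing_def by blast
        then show ?thesis by blast
      next
        case False
        then obtain x where x: "x \<in> e" "x \<in> A i" by blast
        have "\<forall>a\<in>e \<inter> A i. \<forall>b\<in>e \<inter> A i. a = b"
          using e1(3) fe card_le_Suc0_iff_eq[of "e \<inter> A i"] by simp
        then have "e \<inter> A i = {x}" using x by blast
        then have "e - {x} \<subseteq> (\<Union>j\<in>I. A j)" using e1(1) by blast
        moreover have "card (e - {x}) = q" using e1(2) x fe by simp
        moreover have "card ((e - {x}) \<inter> A j) \<le> 1" if "j \<in> I" for j
        proof -
          have "card ((e - {x}) \<inter> A j) \<le> card (e \<inter> A j)" using fe by (intro card_mono) auto
          then show ?thesis using e1(4)[OF that] by linarith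
        qed
        ultimately have "e - {x} \<in> crossing I A q" unfolding crossing_def by blast
        moreover have "e = insert x (e - {x})" using x by blast
        ultimately have "e \<in> ?Q" using x(2) by (intro image_eqI[of _ _ "(x, e - {x})"]) auto
        then show ?thesis by blast
      qed
    next
      fix e assume "e \<in> ?P \<union> ?Q"
      then show "e \<in> ?L"
      proof
        assume e: "e \<in> ?P"
        then have "e \<inter> A i = {}" using dj unfolding crossing_def by blast
        then show ?thesis using e unfolding crossing_def by auto
      next
        assume "e \<in> ?Q"
        then obtain x d where d: "x \<in> A i" "d \<in> crossing I A q" "e = insert x d" by auto
        have d1: "d \<subseteq> (\<Union>j\<in>I. A j)" "card d = q" "\<And>j. j \<in> I \<Longrightarrow> card (d \<inter> A j) \<le> 1"
          using d(2) unfolding crossing_def by auto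
        have "finite d" using d1(1) fin finite_subset by blast
        moreover have xn: "x \<notin> d" using d1(1) d(1) dj by blast
        ultimately have "card e = Suc q" using d(3) d1(2) by simp
        moreover have "e \<inter> A i = {x}" using d(1,3) d1(1) dj by blast
        moreover have "e \<inter> A j = d \<inter> A j" if "j \<in> I" for j using d(1,3) dj that by blast
        moreover have "e \<subseteq> (\<Union>j\<in>insert i I. A j)" using d(1,3) d1(1) by blast
        ultimately show ?thesis using d1(3) unfolding crossing_def by simp
      qed
    qed
    have "inj_on (\<lambda>(x, e). insert x e) (A i \<times> crossing I A q)"
    proof (rule inj_onI, clarsimp)
      fix x e y d assume a: "x \<in> A i" "e \<in> crossing I A q" "y \<in> A i" "d \<in> crossing I A q"
        "insert x e = insert y d"
      then have 0: "e \<inter> A i = {}" "d \<inter> A i = {}" using dj unfolding crossing_def by blast+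
      have "insert x e \<inter> A i = {x}" "insert y d \<inter> A i = {y}" using 0 a(1,3) by blast+
      then have xy: "x = y" using a(5) by simp
      have "x \<notin> e" "x \<notin> d" using 0 a(1) by blast+
      then show "x = y \<and> e = d" using a(5) xy by (metis insert_ident)
    qed
    then have "card ?Q = card (A i) * card (crossing I A q)"
      by (simp add: card_image card_cartesian_product)
    moreover have "?P \<inter> ?Q = {}"
    proof -
      have "e \<inter> A i = {}" if "e \<in> ?P" for e using that dj unfolding crossing_def by blast
      moreover have "e \<inter> A i \<noteq> {}" if "e \<in> ?Q" for e using that by auto
      ultimately show ?thesis by (meson disjoint_iff)
    qed
    moreover have "finite ?Q" using finc insert.prems(1)[of i] by simp
    ultimately have "card ?L = card ?P + card (A i) * card (crossing I A q)"
      unfolding split using finc by (subst card_Un_disjoint) auto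
    also have "\<dots> = esym (Suc q) (insert i I) (\<lambda>i. card (A i))"
      using insert by (simp add: esym_insert)
    finally show ?thesis using Suc by simp
  qed
qed

lemma finite_turan_part: "finite (turan_part m K i)"
  unfolding turan_part_def by auto

lemma turan_hyperedges_eq_crossing:
  assumes "0 < K"
  shows "hedges (turan_hypergraph p m K) = crossing {..<K} (turan_part m K) p"
  unfolding turan_hypergraph_def crossing_def turan_parts_partition(1)[OF assms] by auto

lemma turan_count_esym:
  assumes "0 < K"
  shows "turan_count p m K = esym p {..<K} (\<lambda>i. card (turan_part m K i))"
proof -
  have "turan_count p m K = card (crossing {..<K} (turan_part m K) p)"
    unfolding turan_count_def using turan_hyperedges_eq_crossing[OF assms] by simp
  also have "\<dots> = esym p {..<K} (\<lambda>i. card (turan_part m K i))"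
    by (rule card_crossing) (use turan_parts_partition(2)[OF assms] finite_turan_part in auto)
  finally show ?thesis .
qed

lemma turan_count_mono: "m \<le> m' \<Longrightarrow> turan_count p m K \<le> turan_count p m' K"
proof -
  assume mm: "m \<le> m'"
  have "hedges (turan_hypergraph p m K) \<subseteq> hedges (turan_hypergraph p m' K)"
  proof
    fix e assume "e \<in> hedges (turan_hypergraph p m K)"
    then have e: "e \<subseteq> {..<m}" "card e = p" "\<And>i. i < K \<Longrightarrow> card (e \<inter> turan_part m K i) \<le> 1"
      unfolding turan_hypergraph_def by auto
    have "e \<inter> turan_part m' K i = e \<inter> turan_part m K i" for i
      using e(1) mm unfolding turan_part_def by auto
    then show "e \<in> hedges (turan_hypergraph p m' K)"
      using e mm unfolding turan_hypergraph_def by auto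
  qed
  moreover have "finite (hedges (turan_hypergraph p m' K))"
    unfolding turan_hypergraph_def by (auto intro: rev_finite_subset[of "Pow {..<m'}"])
  ultimately show ?thesis unfolding turan_count_def by (intro card_mono)
qed

lemma turan_count_le:
  assumes "0 < K"
  shows "real (turan_count p m K) \<le> real (K choose p) * ((real m + real K) / real K) ^ p"
proof -
  have "real (card (turan_part m K i)) \<le> (real m + real K) / real K" if "i \<in> {..<K}" for i
  proof -
    have "card (turan_part m K i) \<le> m div K + 1" using card_turan_part[of i K m] that by auto
    then have "card (turan_part m K i) * K \<le> (m div K + 1) * K" by (rule mult_le_mono1)
    also have "\<dots> \<le> m + K" by simp
    finally have "real (card (turan_part m K i)) * real K \<le> real m + real K"
      by (metis of_nat_add of_nat_le_iff of_nat_mult)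
    then show ?thesis using assms by (simp add: field_simps)
  qed
  then show ?thesis unfolding turan_count_esym[OF assms]
    using esym_le_power[of "{..<K}" "\<lambda>i. card (turan_part m K i)" "(real m + real K) / real K" p]
    by simp
qed

lemma turan_count_ge:
  assumes "0 < K"
  shows "(K choose p) * (m div K) ^ p \<le> turan_count p m K"
  unfolding turan_count_esym[OF assms]
  using esym_ge_power[of "{..<K}" "m div K" "\<lambda>i. card (turan_part m K i)" p]
  by (simp add: card_turan_part)

text \<open>The new vertex \<open>m\<close> joins the residue class of \<open>m\<close>. The
  hyperedges it creates are completed by \<open>p\<close>-sets crossing the other
  \<open>K - 1\<close> classes, each of which has at least \<open>m div K\<close> vertices. The
  increment is the degree threshold of the vertex deletion argument, so this bounds that threshold
  from below.\<close>

lemma turan_count_Suc_ge: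
  assumes "0 < K"
  shows "turan_count (Suc p) m K + ((K - 1) choose p) * (m div K) ^ p \<le> turan_count (Suc p) (Suc m) K"
proof -
  define i where "i = m mod K"
  have i: "i < K" using assms by (simp add: i_def)
  define D where "D = {..<K} - {i}"
  have D: "{..<K} = insert i D" "finite D" "i \<notin> D" "card D = K - 1" using i by (auto simp: D_def)
  define w where "w = (\<lambda>m i. card (turan_part m K i))"
  have "turan_part (Suc m) K i = insert m (turan_part m K i)"
    unfolding turan_part_def i_def by (auto simp: less_Suc_eq)
  moreover have "m \<notin> turan_part m K i" unfolding turan_part_def by simp
  ultimately have wi: "w (Suc m) i = Suc (w m i)" unfolding w_def by (simp add: finite_turan_part)
  have wj: "w (Suc m) j = w m j" if "j \<in> D" for j
  proof -
    have "turan_part (Suc m) K j = turan_part m K j"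
      using that unfolding turan_part_def D_def i_def by (auto simp: less_Suc_eq)
    then show ?thesis by (simp add: w_def)
  qed
  have "(card D choose p) * (m div K) ^ p \<le> esym p D (w m)"
  proof (rule esym_ge_power[OF D(2)])
    fix j assume "j \<in> D"
    then have "j < K" by (simp add: D_def)
    then show "m div K \<le> w m j" by (simp add: w_def card_turan_part)
  qed
  moreover have "turan_count (Suc p) (Suc m) K = esym (Suc p) D (w m) + Suc (w m i) * esym p D (w m)"
  proof -
    have c: "esym q D (w (Suc m)) = esym q D (w m)" for q by (rule esym_cong) (rule wj)
    have t: "turan_count (Suc p) (Suc m) K = esym (Suc p) {..<K} (w (Suc m))"
      unfolding turan_count_esym[OF assms] w_def ..
    show ?thesis unfolding t D(1) esym_insert[OF D(2,3)] wi c ..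
  qed
  moreover have "turan_count (Suc p) m K = esym (Suc p) D (w m) + w m i * esym p D (w m)"
  proof -
    have t: "turan_count (Suc p) m K = esym (Suc p) {..<K} (w m)"
      unfolding turan_count_esym[OF assms] w_def ..
    show ?thesis unfolding t D(1) esym_insert[OF D(2,3)] ..
  qed
  ultimately show ?thesis using D(4) by simp
qed

text \<open>With \<open>A\<close>, \<open>B\<close>, \<open>C\<close> symmetric sums over the other
  indices, the sum equals \<open>A + (w i + w j) * B + w i * w j * C\<close>. Moving one unit from
  the larger to the smaller weight keeps \<open>w i + w j\<close> and increases the product.\<close>

lemma esym_shift:
  assumes "finite D" "i \<in> D" "j \<in> D" "i \<noteq> j" "w j + 2 \<le> w i"
  shows "esym p D w \<le> esym p D (w(i := w i - 1, j := w j + 1))"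
proof -
  define D' where "D' = D - {i, j}"
  have D: "D = insert i (insert j D')" "finite D'" "i \<notin> insert j D'" "j \<notin> D'" "finite (insert j D')"
    using assms by (auto simp: D'_def)
  define w' where "w' = w(i := w i - 1, j := w j + 1)"
  have c: "esym q D' w' = esym q D' w" for q
    by (rule esym_cong) (use D in \<open>auto simp: w'_def\<close>)
  have w': "w' i = w i - 1" "w' j = w j + 1" using assms(4) by (auto simp: w'_def)
  have "\<exists>d. w i = w j + 2 + d" using assms(5) by (rule le_Suc_ex)
  then obtain d where d: "w i = w j + 2 + d" ..
  consider "p = 0" | "p = Suc 0" | q where "p = Suc (Suc q)" by (metis not0_implies_Suc)
  then have "esym p D w \<le> esym p D w'"
  proof cases
    case 1
    then show ?thesis using assms(1) by simp
  next
    case 2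
    then show ?thesis unfolding D(1) using D d
      by (simp add: esym_insert c w')
  next
    case 3
    show ?thesis unfolding D(1) 3 esym_insert[OF D(5,3)] esym_insert[OF D(2,4)] c w' d
      by (simp add: algebra_simps)
  qed
  then show ?thesis by (simp add: w'_def)
qed

text \<open>Induction on the sum of squares, which drops whenever a unit is moved between weights
  that differ by at least two. If no such move is left, the weights take at most two consecutive
  values and their total determines how many of each there are, so up to a permutation they are the
  sizes of the residue classes.\<close>

lemma esym_le_turan_count_aux:
  assumes "0 < K" "(\<Sum>i<K. w i) = m"
  shows "esym p {..<K} w \<le> turan_count p m K"
  using assms(2)
proof (induction "\<Sum>i<K. w i * w i" arbitrary: w rule: less_induct)
  case less
  show ?case
  proof (cases "\<exists>i<K. \<exists>j<K. w j + 2 \<le> w i")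
    case True
    then obtain i j where ij: "i < K" "j < K" "w j + 2 \<le> w i" by blast
    then have ne: "i \<noteq> j" by auto
    define w' where "w' = w(i := w i - 1, j := w j + 1)"
    define D' where "D' = {..<K} - {i, j}"
    have D: "{..<K} = insert i (insert j D')" "finite D'" "i \<notin> insert j D'" "j \<notin> D'" "finite (insert j D')"
      using ij ne by (auto simp: D'_def)
    have w': "w' i = w i - 1" "w' j = w j + 1" using ne by (auto simp: w'_def)
    have same: "w' x = w x" if "x \<in> D'" for x using that D(3,4) by (auto simp: w'_def)
    have sD: "(\<Sum>x\<in>D'. w' x) = (\<Sum>x\<in>D'. w x)" "(\<Sum>x\<in>D'. w' x * w' x) = (\<Sum>x\<in>D'. w x * w x)"
      using same by (auto intro!: sum.cong)
    have ex: "\<exists>d. w i = w j + 2 + d" using ij(3) by (rule le_Suc_ex)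
    then obtain d where d: "w i = w j + 2 + d" ..
    have s: "(\<Sum>x<K. w' x) = m"
      using less.prems unfolding D(1) using D(2-5) by (simp add: sD w' d)
    have "(\<Sum>x<K. w' x * w' x) < (\<Sum>x<K. w x * w x)"
      unfolding D(1) using D(2-5) by (simp add: sD w' d)
    then have "esym p {..<K} w' \<le> turan_count p m K" using less.hyps s by blast
    moreover have "esym p {..<K} w \<le> esym p {..<K} w'"
      unfolding w'_def by (rule esym_shift) (use ij ne in auto)
    ultimately show ?thesis by linarith
  next
    case False
    define a where "a = Min (w ` {..<K})"
    have am: "a \<in> w ` {..<K}" unfolding a_def using assms(1) by (intro Min_in) auto
    then obtain i0 where i0: "i0 < K" "w i0 = a" by auto
    have ge: "a \<le> w i" if "i < K" for i using that unfolding a_def by simp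
    have le: "w i \<le> a + 1" if "i < K" for i using False i0 that by (metis Suc_eq_plus1 add_2_eq_Suc' not_less_eq_eq)
    define U where "U = {i. i < K \<and> w i = a + 1}"
    have wU: "w i = (if i \<in> U then a + 1 else a)" if "i < K" for i
      using ge[OF that] le[OF that] that unfolding U_def by auto
    have U: "U \<subseteq> {..<K}" "finite U" "i0 \<notin> U" using i0 by (auto simp: U_def)
    have "(\<Sum>i<K. w i) = (\<Sum>i<K. a + (if i \<in> U then 1 else 0))"
      by (rule sum.cong) (auto simp: wU)
    also have "\<dots> = K * a + card U"
      using U by (simp add: sum.distrib sum.If_cases Int_absorb1)
    finally have m: "m = K * a + card U" using less.prems by simp
    have "card U < card {..<K}" using U i0 by (intro psubset_card_mono) auto
    then have cU: "card U < K" by simp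
    \<comment> \<open>Quotient and remainder can be read off because \<open>U\<close> misses
      \<open>i0\<close>, so that \<open>card U < K\<close>.\<close>
    have am: "m div K = a" "m mod K = card U" using m cU by auto
    have cc: "card ({..<K} - U) = card ({..<K} - {..<card U})"
      using U cU by (simp add: card_Diff_subset)
    obtain f where f: "bij_betw f U {..<card U}"
      using finite_same_card_bij[of U "{..<card U}"] U by auto
    obtain g where g: "bij_betw g ({..<K} - U) ({..<K} - {..<card U})"
      using finite_same_card_bij[OF _ _ cc] by auto
    define h where "h = (\<lambda>x. if x \<in> U then f x else g x)"
    have hU: "bij_betw h U {..<card U}"
      using f by (rule bij_betw_cong[THEN iffD1, rotated]) (auto simp: h_def)
    have hV: "bij_betw h ({..<K} - U) ({..<K} - {..<card U})"
      using g by (rule bij_betw_cong[THEN iffD1, rotated]) (auto simp: h_def)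
    have "bij_betw h (U \<union> ({..<K} - U)) ({..<card U} \<union> ({..<K} - {..<card U}))"
      by (rule bij_betw_combine[OF hU hV]) auto
    moreover have "U \<union> ({..<K} - U) = {..<K}" "{..<card U} \<union> ({..<K} - {..<card U}) = {..<K}"
      using U cU by auto
    ultimately have h: "bij_betw h {..<K} {..<K}" by simp
    have "w i = ((\<lambda>i. card (turan_part m K i)) \<circ> h) i" if "i \<in> {..<K}" for i
    proof -
      have hi: "h i < K" using h that by (auto simp: bij_betw_def)
      have "h i < card U \<longleftrightarrow> i \<in> U"
        using hU hV that unfolding bij_betw_def by (metis Diff_iff imageI lessThan_iff)
      then show ?thesis using that wU hi by (simp add: card_turan_part am)
    qed
    then have "esym p {..<K} w = esym p {..<K} ((\<lambda>i. card (turan_part m K i)) \<circ> h)" by (rule esym_cong)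
    also have "\<dots> = turan_count p m K" unfolding turan_count_esym[OF assms(1)] by (rule esym_reindex[OF h])
    finally show ?thesis by simp
  qed
qed

text \<open>Missing parts are padded with weight 0, and a total below \<open>m\<close> is covered by
  monotonicity.\<close>

lemma esym_le_turan_count:
  assumes "finite I" "card I \<le> K" "0 < K" "(\<Sum>i\<in>I. w i) \<le> m"
  shows "esym p I w \<le> turan_count p m K"
proof -
  obtain g where g: "bij_betw g {..<card I} I" using ex_bij_betw_nat_finite[OF assms(1)] atLeast0LessThan by metis
  define v where "v = (\<lambda>i. if i < card I then w (g i) else 0)"
  have sub: "{..<card I} \<subseteq> {..<K}" using assms(2) by auto
  have "(\<Sum>i<K. v i) = (\<Sum>i<card I. v i)"
    by (rule sum.mono_neutral_right) (use sub in \<open>auto simp: v_def\<close>)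
  also have "\<dots> = (\<Sum>i<card I. w (g i))" by (simp add: v_def)
  also have "\<dots> = (\<Sum>i\<in>I. w i)" by (rule sum.reindex_bij_betw[OF g])
  finally have s: "(\<Sum>i<K. v i) = (\<Sum>i\<in>I. w i)" .
  have "esym p I w = esym p {..<card I} (w \<circ> g)" using esym_reindex[OF g] by metis
  also have "\<dots> = esym p {..<card I} v" by (rule esym_cong) (simp add: v_def)
  also have "\<dots> \<le> esym p {..<K} v" using sub by (intro esym_mono_set) auto
  also have "\<dots> \<le> turan_count p (\<Sum>i<K. v i) K" using esym_le_turan_count_aux[OF assms(3)] by simp
  also have "\<dots> \<le> turan_count p m K" using s assms(4) by (intro turan_count_mono) simp
  finally show ?thesis .
qed

section \<open>Counting cliques\<close>

definition clique :: "('a \<Rightarrow> 'a \<Rightarrow> bool) \<Rightarrow> 'a set \<Rightarrow> bool" where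
  "clique adj c \<longleftrightarrow> (\<forall>x\<in>c. \<forall>y\<in>c. x \<noteq> y \<longrightarrow> adj x y)"

lemma clique_subset: "clique adj c \<Longrightarrow> d \<subseteq> c \<Longrightarrow> clique adj d"
  unfolding clique_def by blast

definition clique_weight :: "('a \<Rightarrow> 'a \<Rightarrow> bool) \<Rightarrow> nat \<Rightarrow> 'a set \<Rightarrow> ('a \<Rightarrow> nat) \<Rightarrow> nat" where
  "clique_weight adj p X w = (\<Sum>c | c \<subseteq> X \<and> card c = p \<and> clique adj c. \<Prod>x\<in>c. w x)"

text \<open>The coefficient of \<open>w u\<close> in the clique weight of \<open>insert u X\<close>;
  it does not depend on \<open>w u\<close> itself.\<close>

definition clique_link :: "('a \<Rightarrow> 'a \<Rightarrow> bool) \<Rightarrow> nat \<Rightarrow> 'a set \<Rightarrow> ('a \<Rightarrow> nat) \<Rightarrow> 'a \<Rightarrow> nat" where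
  "clique_link adj p X w u = (\<Sum>c | c \<subseteq> insert u X \<and> card c = p \<and> clique adj c \<and> u \<in> c. \<Prod>x\<in>c - {u}. w x)"

lemma clique_weight_insert:
  assumes "finite X" "u \<notin> X"
  shows "clique_weight adj p (insert u X) w = clique_weight adj p X w + w u * clique_link adj p X w u"
proof -
  let ?A = "{c. c \<subseteq> X \<and> card c = p \<and> clique adj c}"
  let ?B = "{c. c \<subseteq> insert u X \<and> card c = p \<and> clique adj c \<and> u \<in> c}"
  have "{c. c \<subseteq> insert u X \<and> card c = p \<and> clique adj c} = ?A \<union> ?B" by auto
  moreover have "finite ?A" "finite ?B" using assms(1) by auto
  moreover have "?A \<inter> ?B = {}" using assms(2) by auto
  ultimately have "clique_weight adj p (insert u X) w
    = clique_weight adj p X w + (\<Sum>c\<in>?B. \<Prod>x\<in>c. w x)"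
    unfolding clique_weight_def by (simp add: sum.union_disjoint)
  also have "(\<Sum>c\<in>?B. \<Prod>x\<in>c. w x) = (\<Sum>c\<in>?B. w u * (\<Prod>x\<in>c - {u}. w x))"
  proof (rule sum.cong[OF refl])
    fix c assume c: "c \<in> ?B"
    then have "finite c" using assms(1) finite_subset by auto
    then show "(\<Prod>x\<in>c. w x) = w u * (\<Prod>x\<in>c - {u}. w x)" using c by (intro prod.remove) auto
  qed
  also have "\<dots> = w u * clique_link adj p X w u" unfolding clique_link_def by (simp add: sum_distrib_left)
  finally show ?thesis .
qed

lemma clique_link_cong:
  assumes "\<And>x. x \<in> X \<Longrightarrow> x \<noteq> u \<Longrightarrow> w x = w' x"
  shows "clique_link adj p X w u = clique_link adj p X w' u"
  unfolding clique_link_def by (intro sum.cong prod.cong refl) (use assms in auto)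

lemma clique_link_nonadj:
  assumes "\<not> adj u v" "u \<noteq> v"
  shows "clique_link adj p (insert u X) w v = clique_link adj p X w v"
proof -
  have "c \<subseteq> insert v (insert u X) \<and> card c = p \<and> clique adj c \<and> v \<in> c
      \<longleftrightarrow> c \<subseteq> insert v X \<and> card c = p \<and> clique adj c \<and> v \<in> c" for c
    using assms unfolding clique_def by blast
  then show ?thesis unfolding clique_link_def by simp
qed

text \<open>Zykov's symmetrization with integer weights: of two non-adjacent vertices, the one with the heavier
  link takes over the weight of the other.\<close>

lemma clique_weight_shift:
  assumes "finite X" "u \<notin> X" "v \<notin> X" "u \<noteq> v" "\<not> adj u v"
    and "clique_link adj p X w v \<le> clique_link adj p X w u"
  shows "clique_weight adj p (insert v (insert u X)) w
    \<le> clique_weight adj p (insert u X) (w(u := w u + w v))"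
proof -
  let ?w = "w(u := w u + w v)"
  have w: "clique_weight adj p X ?w = clique_weight adj p X w"
    unfolding clique_weight_def by (intro sum.cong prod.cong refl) (use assms in auto)
  have l: "clique_link adj p X ?w u = clique_link adj p X w u" by (rule clique_link_cong) auto
  have "clique_weight adj p (insert v (insert u X)) w
    = clique_weight adj p X w + w u * clique_link adj p X w u + w v * clique_link adj p X w v"
    using assms by (simp add: clique_weight_insert clique_link_nonadj)
  also have "\<dots> \<le> clique_weight adj p X w + w u * clique_link adj p X w u + w v * clique_link adj p X w u"
    using assms(6) by simp
  also have "\<dots> = clique_weight adj p (insert u X) ?w"
    using assms by (simp add: clique_weight_insert w l algebra_simps)
  finally show ?thesis .
qed

text \<open>Merging two non-adjacent vertices keeps the total weight and creates no new clique, so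
  induction on the number of vertices ends at a clique, where the clique weight is a symmetric sum
  of at most \<open>K\<close> weights. Unequal weights have to be allowed because merging produces
  them.\<close>

lemma clique_weight_le_turan_count:
  assumes "finite X" "0 < K" and sym: "\<And>x y. adj x y \<Longrightarrow> adj y x"
    and "\<And>c. c \<subseteq> X \<Longrightarrow> clique adj c \<Longrightarrow> card c \<le> K"
  shows "clique_weight adj p X w \<le> turan_count p (\<Sum>x\<in>X. w x) K"
  using assms(1,4)
proof (induction "card X" arbitrary: X w)
  case 0
  have "clique_weight adj p X w \<le> esym p X w"
    unfolding clique_weight_def esym_def by (rule sum_mono2) (use 0 in auto)
  also have "\<dots> \<le> turan_count p (\<Sum>x\<in>X. w x) K"
    using 0 assms(2) by (intro esym_le_turan_count) auto
  finally show ?case .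
next
  case (Suc n)
  show ?case
  proof (cases "clique adj X")
    case True
    have "clique_weight adj p X w \<le> esym p X w"
      unfolding clique_weight_def esym_def by (rule sum_mono2) (use Suc.prems in auto)
    also have "\<dots> \<le> turan_count p (\<Sum>x\<in>X. w x) K"
      using Suc.prems assms(2) True by (intro esym_le_turan_count) auto
    finally show ?thesis .
  next
    case False
    then obtain a b where ab: "a \<in> X" "b \<in> X" "a \<noteq> b" "\<not> adj a b" unfolding clique_def by blast
    then have nba: "\<not> adj b a" using sym by blast
    define Y where "Y = X - {a, b}"
    obtain u v where uv: "u \<in> X" "v \<in> X" "u \<noteq> v" "\<not> adj u v" "Y = X - {u, v}"
      "clique_link adj p Y w v \<le> clique_link adj p Y w u"
    proof (cases "clique_link adj p Y w b \<le> clique_link adj p Y w a")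
      case True
      then show ?thesis using that[of a b] ab Y_def by blast
    next
      case False
      then show ?thesis using that[of b a] ab nba Y_def by (simp add: insert_commute)
    qed
    have X: "X = insert v (insert u Y)" "u \<notin> Y" "v \<notin> Y" "finite Y" using uv Suc.prems(1) by auto
    let ?w = "w(u := w u + w v)"
    have c: "n = card (insert u Y)" using Suc.hyps(2) X uv(3) by simp
    have "clique_weight adj p X w \<le> clique_weight adj p (insert u Y) ?w"
      unfolding X(1) by (rule clique_weight_shift) (use uv(3,4,6) X(2-4) in auto)
    also have "\<dots> \<le> turan_count p (\<Sum>x\<in>insert u Y. ?w x) K"
      by (rule Suc.hyps(1)[OF c]) (use X Suc.prems in auto)
    also have "(\<Sum>x\<in>insert u Y. ?w x) = (\<Sum>x\<in>X. w x)"
    proof -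
      have "(\<Sum>x\<in>Y. ?w x) = (\<Sum>x\<in>Y. w x)" by (rule sum.cong) (use X in auto)
      then show ?thesis unfolding X(1) using X(2-4) uv(3) by simp
    qed
    finally show ?thesis .
  qed
qed

lemma card_cliques_le_turan_count:
  assumes "finite X" "0 < K" "\<And>x y. adj x y \<Longrightarrow> adj y x"
    and "\<And>c. c \<subseteq> X \<Longrightarrow> clique adj c \<Longrightarrow> card c \<noteq> Suc K"
  shows "card {c. c \<subseteq> X \<and> card c = p \<and> clique adj c} \<le> turan_count p (card X) K"
proof -
  have "card c \<le> K" if c: "c \<subseteq> X" "clique adj c" for c
  proof (rule ccontr)
    assume "\<not> card c \<le> K"
    then have "Suc K \<le> card c" by simp
    then obtain d where "d \<subseteq> c" "card d = Suc K" by (meson obtain_subset_with_card_n)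
    then show False using assms(4)[of d] c clique_subset by blast
  qed
  then have "clique_weight adj p X (\<lambda>_. 1) \<le> turan_count p (\<Sum>x\<in>X. 1) K"
    by (intro clique_weight_le_turan_count) (use assms in auto)
  then show ?thesis unfolding clique_weight_def by simp
qed

section \<open>Counting sets of fixed size that contain a given set\<close>

lemma choose_le_power: "n choose k \<le> n ^ k"
  by (cases "k \<le> n") (auto simp: binomial_le_pow binomial_eq_0)

lemma card_supersets_le:
  assumes "finite V" "finite A" "card A \<le> j"
  shows "card {e. e \<subseteq> V \<and> card e = j \<and> A \<subseteq> e} \<le> card V ^ (j - card A)"
proof -
  have "card {e. e \<subseteq> V \<and> card e = j \<and> A \<subseteq> e} \<le> card {f. f \<subseteq> V \<and> card f = j - card A}"
  proof (rule card_inj_on_le[of "\<lambda>e. e - A"])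
    show "inj_on (\<lambda>e. e - A) {e. e \<subseteq> V \<and> card e = j \<and> A \<subseteq> e}"
      by (rule inj_onI) blast
    show "(\<lambda>e. e - A) ` {e. e \<subseteq> V \<and> card e = j \<and> A \<subseteq> e} \<subseteq> {f. f \<subseteq> V \<and> card f = j - card A}"
      using assms by (auto simp: card_Diff_subset)
  qed (use assms in auto)
  also have "\<dots> = card V choose (j - card A)" by (rule n_subsets[OF assms(1)])
  also have "\<dots> \<le> card V ^ (j - card A)" by (rule choose_le_power)
  finally show ?thesis .
qed

text \<open>Multiplying by \<open>card V\<close> makes the bound valid also for \<open>card A = j + 1\<close>, where
  there are no supersets at all.\<close>

lemma card_supersets_mult_le:
  assumes "finite V" "finite A" "card A \<le> j + 1"
  shows "card {e. e \<subseteq> V \<and> card e = j \<and> A \<subseteq> e} * card V \<le> card V ^ (j + 1 - card A)"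
proof (cases "card A \<le> j")
  case True
  have "card {e. e \<subseteq> V \<and> card e = j \<and> A \<subseteq> e} * card V \<le> card V ^ (j - card A) * card V"
    by (rule mult_le_mono1[OF card_supersets_le[OF assms(1,2) True]])
  also have "\<dots> = card V ^ (j + 1 - card A)" using True by (simp add: Suc_diff_le)
  finally show ?thesis .
next
  case False
  have "\<not> A \<subseteq> e" if "e \<subseteq> V" "card e = j" for e
    using that False assms(1) by (metis card_mono finite_subset)
  then have "{e. e \<subseteq> V \<and> card e = j \<and> A \<subseteq> e} = {}" by blast
  then show ?thesis by (simp only:) simp
qed

section \<open>Flexible pairs\<close>

text \<open>An expanded clique is given by its core \<open>C\<close> and one hyperedge
  \<open>g P\<close> for each pair \<open>P\<close> of core vertices. That \<open>g P\<close> meets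
  \<open>C\<close> only in \<open>P\<close> and that the sets \<open>g P - P\<close> are disjoint
  expresses the distinctness of all new vertices without naming them through an embedding.\<close>

definition expanded_clique_free :: "nat \<Rightarrow> 'a set set \<Rightarrow> bool" where
  "expanded_clique_free c H \<longleftrightarrow> \<not> (\<exists>C g. card C = c \<and>
     (\<forall>P. P \<subseteq> C \<and> card P = 2 \<longrightarrow> g P \<in> H \<and> g P \<inter> C = P) \<and>
     (\<forall>P Q. P \<subseteq> C \<and> card P = 2 \<and> Q \<subseteq> C \<and> card Q = 2 \<and> P \<noteq> Q \<longrightarrow> (g P - P) \<inter> (g Q - Q) = {}))"

lemma expanded_clique_free_subset:
  assumes "expanded_clique_free c H" "H' \<subseteq> H"
  shows "expanded_clique_free c H'"
  unfolding expanded_clique_free_def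
proof (intro notI, elim exE conjE)
  fix C g assume a: "card C = c" "\<forall>P. P \<subseteq> C \<and> card P = 2 \<longrightarrow> g P \<in> H' \<and> g P \<inter> C = P"
    "\<forall>P Q. P \<subseteq> C \<and> card P = 2 \<and> Q \<subseteq> C \<and> card Q = 2 \<and> P \<noteq> Q \<longrightarrow> (g P - P) \<inter> (g Q - Q) = {}"
  have "g P \<in> H \<and> g P \<inter> C = P" if "P \<subseteq> C \<and> card P = 2" for P
    using a(2) that assms(2) by (meson subsetD)
  then have "\<forall>P. P \<subseteq> C \<and> card P = 2 \<longrightarrow> g P \<in> H \<and> g P \<inter> C = P" by simp
  with a(1,3) have "\<exists>C g. card C = c \<and>
     (\<forall>P. P \<subseteq> C \<and> card P = 2 \<longrightarrow> g P \<in> H \<and> g P \<inter> C = P) \<and>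
     (\<forall>P Q. P \<subseteq> C \<and> card P = 2 \<and> Q \<subseteq> C \<and> card Q = 2 \<and> P \<noteq> Q \<longrightarrow> (g P - P) \<inter> (g Q - Q) = {})"
    by (intro exI[of _ C] exI[of _ g] conjI)
  then show False using assms(1) unfolding expanded_clique_free_def by simp
qed

text \<open>\<open>V\<close> excludes \<open>S\<close>. The order \<open>k + 2\<close> of the
  forbidden clique leaves room for a transversal of \<open>k\<close> parts and two more vertices:
  either two vertices of \<open>S\<close>, or one vertex of \<open>S\<close> and a second vertex of
  some part. These are the two configurations excluded later.\<close>

locale star_system =
  fixes H :: "'a set set" and S V :: "'a set" and p k :: nat
  assumes fin_S: "finite S" and fin_V: "finite V" and S_V: "S \<inter> V = {}"
    and edge: "\<And>e. e \<in> H \<Longrightarrow> e \<subseteq> S \<union> V" "\<And>e. e \<in> H \<Longrightarrow> card e = p + 2"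
      "\<And>e. e \<in> H \<Longrightarrow> e \<inter> S \<noteq> {}"
    and free: "expanded_clique_free (k + 2) H"
    and p_pos: "1 \<le> p" and p_k: "p + 1 \<le> k"
begin

text \<open>A partial embedding of an expanded \<open>(k + 2)\<close>-clique occupies at most \<open>T0\<close> vertices.\<close>

definition T0 :: nat where "T0 = (k + 2) + (k + 2) ^ 2 * (p + 2)"

text \<open>Disjointness of \<open>T\<close> from \<open>P\<close> rules out sets that would block
  the pair trivially, by containing one of its vertices.\<close>

definition blocks :: "'a set \<Rightarrow> 'a set \<Rightarrow> bool" where
  "blocks T P \<longleftrightarrow> finite T \<and> card T \<le> T0 \<and> P \<inter> T = {} \<and> (\<forall>e\<in>H. P \<subseteq> e \<longrightarrow> e \<inter> T \<noteq> {})"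

definition flex :: "'a \<Rightarrow> 'a \<Rightarrow> bool" where
  "flex x y \<longleftrightarrow> x \<noteq> y \<and> \<not> (\<exists>T. blocks T {x, y})"

definition blk :: "'a set \<Rightarrow> 'a set" where "blk P = (SOME T. blocks T P)"

lemma flex_sym: "flex x y \<Longrightarrow> flex y x"
  unfolding flex_def by (auto simp: insert_commute)

lemma blocks_blk: "x \<noteq> y \<Longrightarrow> \<not> flex x y \<Longrightarrow> blocks (blk {x, y}) {x, y}"
  unfolding flex_def blk_def by (metis someI_ex)

lemma finite_edge: "e \<in> H \<Longrightarrow> finite e"
  using edge(2) by (metis add_2_eq_Suc' card.infinite nat.distinct(1))

lemma flexD:
  assumes "flex x y" "finite T" "card T \<le> T0" "x \<notin> T" "y \<notin> T"
  obtains e where "e \<in> H" "x \<in> e" "y \<in> e" "e \<inter> T = {}"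
proof -
  have "\<not> blocks T {x, y}" using assms(1) unfolding flex_def by blast
  then have "\<exists>e\<in>H. {x, y} \<subseteq> e \<and> e \<inter> T = {}"
    using assms(2-5) unfolding blocks_def by simp
  then show ?thesis using that by auto
qed

text \<open>Hyperedges are chosen greedily, pair by pair: a flexible pair has a hyperedge that
  avoids everything occupied so far. One pair may be inflexible, because its hyperedge
  \<open>e0\<close> is fixed before all others and only has to avoid the rest of the core.\<close>

lemma embedding:
  assumes C: "card C = k + 2" and xy: "x \<in> C" "y \<in> C" "x \<noteq> y"
    and e0: "e0 \<in> H" "e0 \<inter> C = {x, y}"
    and fl: "\<And>a b. a \<in> C \<Longrightarrow> b \<in> C \<Longrightarrow> a \<noteq> b \<Longrightarrow> {a, b} \<noteq> {x, y} \<Longrightarrow> flex a b"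
  shows False
proof -
  define PP where "PP = {P. P \<subseteq> C \<and> card P = 2}"
  have fC: "finite C" using C by (simp add: card_ge_0_finite)
  then have fPP: "finite PP" unfolding PP_def by simp
  have cPP: "card PP \<le> (k + 2) ^ 2" unfolding PP_def n_subsets[OF fC] C by (rule choose_le_power)
  \<comment> \<open>\<open>F\<close> collects the pairs treated so far; \<open>{x, y}\<close> is
    inserted throughout, so that \<open>e0\<close> takes part in the disjointness condition from the
    start.\<close>
  have "\<exists>g. g {x, y} = e0 \<and> (\<forall>P\<in>insert {x, y} F. g P \<in> H \<and> g P \<inter> C = P) \<and>
     (\<forall>P\<in>insert {x, y} F. \<forall>Q\<in>insert {x, y} F. P \<noteq> Q \<longrightarrow> (g P - P) \<inter> (g Q - Q) = {})"
    if "F \<subseteq> PP - {{x, y}}" for F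
    using finite_subset[OF that finite_Diff[OF fPP]] that
  proof (induction F rule: finite_induct)
    case empty
    show ?case using e0 by (intro exI[of _ "\<lambda>_. e0"]) auto
  next
    case (insert P F)
    have "F \<subseteq> PP - {{x, y}}" using insert.prems by simp
    from insert.IH[OF this] obtain g where G: "g {x, y} = e0 \<and> (\<forall>P\<in>insert {x, y} F. g P \<in> H \<and> g P \<inter> C = P) \<and>
      (\<forall>P\<in>insert {x, y} F. \<forall>Q\<in>insert {x, y} F. P \<noteq> Q \<longrightarrow> (g P - P) \<inter> (g Q - Q) = {})" ..
    have g: "g {x, y} = e0" "\<And>P. P \<in> insert {x, y} F \<Longrightarrow> g P \<in> H \<and> g P \<inter> C = P"
      "\<And>P Q. P \<in> insert {x, y} F \<Longrightarrow> Q \<in> insert {x, y} F \<Longrightarrow> P \<noteq> Q \<Longrightarrow> (g P - P) \<inter> (g Q - Q) = {}"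
      subgoal using G by simp
      subgoal by (rule bspec[OF conjunct1[OF conjunct2[OF G]]])
      subgoal by (rule mp[OF bspec[OF bspec[OF conjunct2[OF conjunct2[OF G]]]]])
      done
    have P: "P \<subseteq> C" "card P = 2" "P \<noteq> {x, y}" using insert.prems by (auto simp: PP_def)
    then obtain a b where ab: "P = {a, b}" "a \<noteq> b" by (meson card_2_iff)
    \<comment> \<open>Everything occupied so far except \<open>P\<close> itself. The value of
      \<open>T0\<close> comes from this set: the core and at most \<open>(k + 2) ^ 2\<close>
      hyperedges.\<close>
    define T where "T = (C \<union> (\<Union>Q\<in>insert {x, y} F. g Q)) - P"
    have fQ: "finite (g Q)" if "Q \<in> insert {x, y} F" for Q using g(2)[OF that] finite_edge by blast
    have fU: "finite (C \<union> (\<Union>Q\<in>insert {x, y} F. g Q))"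
      using fC insert.hyps(1) fQ by (intro finite_UnI finite_UN_I) auto
    then have fT: "finite T" unfolding T_def by (rule finite_Diff)
    have "{x, y} \<in> PP" using xy by (simp add: PP_def)
    then have "insert {x, y} F \<subseteq> PP" using insert.prems by blast
    then have cF: "card (insert {x, y} F) \<le> (k + 2) ^ 2"
      using card_mono[OF fPP] cPP by (meson order_trans)
    have "card T \<le> card (C \<union> (\<Union>Q\<in>insert {x, y} F. g Q))"
      unfolding T_def by (rule card_mono[OF fU Diff_subset])
    also have "\<dots> \<le> card C + card (\<Union>Q\<in>insert {x, y} F. g Q)" by (rule card_Un_le)
    also have "card (\<Union>Q\<in>insert {x, y} F. g Q) \<le> (\<Sum>Q\<in>insert {x, y} F. card (g Q))"
      using insert.hyps by (intro card_UN_le) auto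
    also have "(\<Sum>Q\<in>insert {x, y} F. card (g Q)) = card (insert {x, y} F) * (p + 2)"
      using g(2) edge(2) by simp
    also have "\<dots> \<le> (k + 2) ^ 2 * (p + 2)" using cF by (rule mult_le_mono1)
    finally have cT: "card T \<le> T0" unfolding T0_def C by simp
    have "flex a b" using fl[of a b] P ab by auto
    moreover have "a \<notin> T" "b \<notin> T" using ab unfolding T_def by auto
    ultimately obtain e where e: "e \<in> H" "a \<in> e" "b \<in> e" "e \<inter> T = {}" using flexD fT cT by metis
    define g' where "g' = g(P := e)"
    have g': "g' Q = g Q" if "Q \<in> insert {x, y} F" for Q
      using that P(3) insert.hyps(2) unfolding g'_def by auto
    have eC: "e \<inter> C = P" using e P ab unfolding T_def by blast
    have eQ: "(e - P) \<inter> (g Q - Q) = {}" if "Q \<in> insert {x, y} F" for Q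
      using e that unfolding T_def by blast
    show ?case
    proof (intro exI[of _ g'] conjI ballI impI)
      show "g' {x, y} = e0" using g' g(1) by simp
    next
      fix Q assume "Q \<in> insert {x, y} (insert P F)"
      then have "Q = P \<or> Q \<in> insert {x, y} F" by blast
      moreover have "g' P \<in> H \<and> g' P \<inter> C = P" using e(1) eC by (simp add: g'_def)
      moreover have "g' Q \<in> H \<and> g' Q \<inter> C = Q" if "Q \<in> insert {x, y} F"
        using g'[OF that] g(2)[OF that] by simp
      ultimately have "g' Q \<in> H \<and> g' Q \<inter> C = Q" by metis
      then show "g' Q \<in> H" "g' Q \<inter> C = Q" by simp_all
    next
      fix Q R assume "Q \<in> insert {x, y} (insert P F)" "R \<in> insert {x, y} (insert P F)" "Q \<noteq> R"
      then consider "Q = P" "R \<in> insert {x, y} F" | "R = P" "Q \<in> insert {x, y} F"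
        | "Q \<in> insert {x, y} F" "R \<in> insert {x, y} F" by blast
      then show "(g' Q - Q) \<inter> (g' R - R) = {}"
      proof cases
        case 1
        then show ?thesis using eQ[of R] g' by (simp add: g'_def)
      next
        case 2
        have "g' P = e" by (simp add: g'_def)
        then show ?thesis using 2 eQ[of Q] g'[of Q] by blast
      next
        case 3
        show ?thesis using g(3)[OF 3 \<open>Q \<noteq> R\<close>] unfolding g'[OF 3(1)] g'[OF 3(2)] .
      qed
    qed
  qed
  note ex = this[OF order_refl]
  have PPi: "insert {x, y} (PP - {{x, y}}) = PP" using xy by (auto simp: PP_def)
  from ex obtain g where G: "g {x, y} = e0 \<and> (\<forall>P\<in>PP. g P \<in> H \<and> g P \<inter> C = P) \<and>
     (\<forall>P\<in>PP. \<forall>Q\<in>PP. P \<noteq> Q \<longrightarrow> (g P - P) \<inter> (g Q - Q) = {})" unfolding PPi ..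
  have g: "\<And>P. P \<in> PP \<Longrightarrow> g P \<in> H \<and> g P \<inter> C = P"
      "\<And>P Q. P \<in> PP \<Longrightarrow> Q \<in> PP \<Longrightarrow> P \<noteq> Q \<Longrightarrow> (g P - P) \<inter> (g Q - Q) = {}"
    using G by (simp, metis)
  then have "\<exists>C g. card C = k + 2 \<and>
     (\<forall>P. P \<subseteq> C \<and> card P = 2 \<longrightarrow> g P \<in> H \<and> g P \<inter> C = P) \<and>
     (\<forall>P Q. P \<subseteq> C \<and> card P = 2 \<and> Q \<subseteq> C \<and> card Q = 2 \<and> P \<noteq> Q \<longrightarrow> (g P - P) \<inter> (g Q - Q) = {})"
    using g C unfolding PP_def by (intro exI[of _ C] exI[of _ g]) auto
  then show False using free unfolding expanded_clique_free_def by blast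
qed

lemma no_flex_clique:
  assumes "card C = k + 2"
  shows "\<not> clique flex C"
proof
  assume cl: "clique flex C"
  have fC: "finite C" using assms by (simp add: card_ge_0_finite)
  have "2 \<le> card C" using assms by simp
  then obtain D where D: "D \<subseteq> C" "card D = 2" by (meson obtain_subset_with_card_n)
  then obtain x y where xy: "D = {x, y}" "x \<noteq> y" by (meson card_2_iff)
  have "card (C - D) \<le> T0" using assms D fC by (simp add: card_Diff_subset finite_subset T0_def)
  moreover have "flex x y" using cl D xy unfolding clique_def by blast
  ultimately obtain e where e: "e \<in> H" "x \<in> e" "y \<in> e" "e \<inter> (C - D) = {}"
    using flexD[of x y "C - D"] fC xy by auto
  show False
  proof (rule embedding[OF assms])
    show "e \<inter> C = {x, y}" using e D xy by blast
  qed (use e D xy cl in \<open>auto simp: clique_def\<close>)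
qed

end

section \<open>Hyperedges containing non-flexible pairs\<close>

lemma card_UN_le_mult:
  assumes "finite I" "\<And>i. i \<in> I \<Longrightarrow> card (X i) \<le> b" "card I \<le> m"
  shows "card (\<Union>i\<in>I. X i) \<le> m * b"
proof -
  have "card (\<Union>i\<in>I. X i) \<le> (\<Sum>i\<in>I. card (X i))" by (rule card_UN_le[OF assms(1)])
  also have "\<dots> \<le> card I * b" using sum_bounded_above[of I "\<lambda>i. card (X i)" b] assms(2) by simp
  also have "\<dots> \<le> m * b" using assms(3) by (rule mult_le_mono1)
  finally show ?thesis .
qed

context star_system
begin

text \<open>A hyperedge meeting \<open>S\<close> in exactly one vertex \<open>v\<close> is split into a pair \<open>(v, e)\<close>.\<close>

definition Z :: "('a \<times> 'a set) set" where
  "Z = {(v, e). v \<in> S \<and> e \<subseteq> V \<and> insert v e \<in> H}"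

definition H2 :: "'a set set" where "H2 = {e \<in> H. \<exists>v\<in>S. \<exists>v'\<in>S. v \<noteq> v' \<and> {v, v'} \<subseteq> e}"

definition R :: "'a \<Rightarrow> 'a set" where "R v = {u \<in> V. flex v u}"

text \<open>Candidates for the part of a hyperedge outside \<open>S\<close>. Membership in
  \<open>H\<close> is dropped, since the upper bounds below only need the number of supersets of
  \<open>A\<close>.\<close>

definition sup_sets :: "'a set \<Rightarrow> 'a set set" where
  "sup_sets A = {e. e \<subseteq> V \<and> card e = p + 1 \<and> A \<subseteq> e}"

lemma ZD:
  assumes "(v, e) \<in> Z"
  shows "v \<in> S" "e \<subseteq> V" "insert v e \<in> H" "card e = p + 1" "finite e" "v \<notin> e"
proof -
  show v: "v \<in> S" and e: "e \<subseteq> V" and h: "insert v e \<in> H" using assms by (auto simp: Z_def)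
  show f: "finite e" using e fin_V finite_subset by blast
  show "v \<notin> e" using v e S_V by blast
  then show "card e = p + 1" using edge(2)[OF h] f by simp
qed

lemma finite_Z: "finite Z"
proof -
  have "Z \<subseteq> S \<times> Pow V" by (auto simp: Z_def)
  then show ?thesis using fin_S fin_V finite_subset by blast
qed

lemma finite_R: "finite (R v)" and R_subset: "R v \<subseteq> V"
  using fin_V by (auto simp: R_def)

lemma flex_neq: "flex x y \<Longrightarrow> x \<noteq> y"
  by (simp add: flex_def)

lemma finite_sup_sets: "finite (sup_sets A)"
  unfolding sup_sets_def using fin_V by simp

lemma card_sup_sets_2: "x \<noteq> y \<Longrightarrow> card (sup_sets {x, y}) \<le> card V ^ (p - 1)"
  using card_supersets_le[of V "{x, y}" "p + 1"] fin_V p_pos unfolding sup_sets_def by simp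

lemma card_sup_sets_3:
  "x \<noteq> y \<Longrightarrow> x \<noteq> z \<Longrightarrow> y \<noteq> z \<Longrightarrow> card (sup_sets {x, y, z}) * card V \<le> card V ^ (p - 1)"
  using card_supersets_mult_le[of V "{x, y, z}" "p + 1"] fin_V p_pos unfolding sup_sets_def by simp

text \<open>\<open>card V ^ (p - 1) div card V\<close> stands for \<open>card V ^ (p - 2)\<close>,
  which subtraction on natural numbers would distort for \<open>p = 1\<close>. In that case a set of
  size \<open>p + 1\<close> contains no three distinct vertices, so every bound is correct.\<close>

lemma card_sup_sets_3':
  assumes "x \<noteq> y" "x \<noteq> z" "y \<noteq> z"
  shows "card (sup_sets {x, y, z}) \<le> card V ^ (p - 1) div card V"
proof (cases "card V = 0")
  case True
  then have "V = {}" using fin_V by simp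
  then have "sup_sets {x, y, z} = {}" unfolding sup_sets_def by auto
  then show ?thesis by simp
next
  case False
  then show ?thesis using card_sup_sets_3[OF assms]
    by (metis div_le_mono nonzero_mult_div_cancel_right)
qed

lemma N_mult_N_pow: "card V * card V ^ (p - 1) = card V ^ p"
  using p_pos by (metis Suc_diff_1 less_le_trans power_Suc zero_less_one)

lemma N_mult_3: "card V * (card V ^ (p - 1) div card V) \<le> card V ^ (p - 1)"
  by simp

text \<open>The source of all savings: a hyperedge through an inflexible pair contains a third
  vertex from a set of at most \<open>T0\<close> candidates. If this vertex lies in
  \<open>e\<close>, a factor \<open>card V\<close> is saved; if it is \<open>v\<close>, the factor
  \<open>card S\<close> is replaced by \<open>T0\<close>.\<close>

lemma blk_hit:
  assumes "(v, e) \<in> Z" "x \<in> insert v e" "y \<in> insert v e" "x \<noteq> y" "\<not> flex x y"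
  obtains t where "t \<in> blk {x, y}" "t \<in> insert v e" "t \<noteq> x" "t \<noteq> y"
proof -
  have "blocks (blk {x, y}) {x, y}" using blocks_blk assms by blast
  then have b: "{x, y} \<inter> blk {x, y} = {}" "\<And>e. e \<in> H \<Longrightarrow> {x, y} \<subseteq> e \<Longrightarrow> e \<inter> blk {x, y} \<noteq> {}"
    unfolding blocks_def by blast+
  have "insert v e \<inter> blk {x, y} \<noteq> {}" by (rule b(2)[OF ZD(3)[OF assms(1)]]) (use assms(2,3) in simp)
  then obtain t where "t \<in> insert v e" "t \<in> blk {x, y}" by blast
  moreover have "x \<notin> blk {x, y}" "y \<notin> blk {x, y}" using b(1) by simp_all
  ultimately show ?thesis using that[of t] by metis
qed

lemma blk_fin:
  assumes "x \<noteq> y" "\<not> flex x y"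
  shows "finite (blk {x, y})" "card (blk {x, y}) \<le> T0" "x \<notin> blk {x, y}" "y \<notin> blk {x, y}"
  using blocks_blk[OF assms] unfolding blocks_def by auto

lemma card_blk_Int:
  assumes "x \<noteq> y" "\<not> flex x y"
  shows "finite (blk {x, y} \<inter> B)" "card (blk {x, y} \<inter> B) \<le> T0"
  using blk_fin[OF assms] card_mono[of "blk {x, y}" "blk {x, y} \<inter> B"] by auto

lemma card_singleton_times: "card ({v} \<times> B) = card B"
  by (simp add: card_cartesian_product)

section \<open>Exceptional link sets through a fixed vertex\<close>

definition G_bad :: "'a \<Rightarrow> ('a \<times> 'a set) set" where
  "G_bad u = {(v, e) \<in> Z. u \<in> e \<and> \<not> flex v u}"

text \<open>Since \<open>v\<close> belongs to the pair, the blocking vertex must lie in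
  \<open>e\<close>. So \<open>e\<close> contains two prescribed vertices, the second of which has at
  most \<open>T0\<close> choices for each \<open>v\<close>.\<close>

lemma card_G_bad: 
  assumes "u \<in> V"
  shows "card (G_bad u) \<le> card S * (T0 * card V ^ (p - 1))"
proof -
  define I where "I = {v \<in> S. \<not> flex v u}"
  define X where "X = (\<lambda>v. \<Union>t\<in>blk {v, u} \<inter> V. {v} \<times> sup_sets {u, t})"
  have ne: "v \<noteq> u" if "v \<in> I" for v using that assms S_V unfolding I_def by blast
  have "G_bad u \<subseteq> (\<Union>v\<in>I. X v)"
  proof
    fix z assume z: "z \<in> G_bad u"
    obtain v e where ve: "z = (v, e)" by (cases z)
    have z1: "(v, e) \<in> Z" "u \<in> e" "\<not> flex v u" using z ve by (auto simp: G_bad_def)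
    have v: "v \<in> I" using ZD(1)[OF z1(1)] z1 by (simp add: I_def)
    obtain t where t: "t \<in> blk {v, u}" "t \<in> insert v e" "t \<noteq> v"
      using blk_hit[OF z1(1), of v u] z1 ne[OF v] by blast
    then have "t \<in> e" by blast
    then have "(v, e) \<in> X v" unfolding X_def sup_sets_def using ZD[OF z1(1)] t z1(2) by blast
    then show "z \<in> (\<Union>v\<in>I. X v)" using v ve by blast
  qed
  moreover have fX: "finite (X v)" if "v \<in> I" for v
    unfolding X_def using card_blk_Int(1) ne[OF that] that finite_sup_sets by (auto simp: I_def)
  moreover have "card (X v) \<le> T0 * card V ^ (p - 1)" if v: "v \<in> I" for v
    unfolding X_def
  proof (rule card_UN_le_mult)
    have nf: "\<not> flex v u" using v by (simp add: I_def)
    show "finite (blk {v, u} \<inter> V)" "card (blk {v, u} \<inter> V) \<le> T0"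
      using card_blk_Int[OF ne[OF v] nf] by auto
    fix t assume "t \<in> blk {v, u} \<inter> V"
    then have "u \<noteq> t" using blk_fin[OF ne[OF v] nf] by blast
    then show "card ({v} \<times> sup_sets {u, t}) \<le> card V ^ (p - 1)"
      unfolding card_singleton_times by (rule card_sup_sets_2)
  qed
  moreover have "finite I" "card I \<le> card S" using fin_S by (auto simp: I_def card_mono)
  ultimately show ?thesis
    using card_mono[of "\<Union>v\<in>I. X v" "G_bad u"] card_UN_le_mult[of I X "T0 * card V ^ (p - 1)" "card S"]
    by (meson finite_UN_I order_trans)
qed

definition N_bad :: "'a \<Rightarrow> ('a \<times> 'a set) set" where
  "N_bad u = {(v, e) \<in> Z. u \<in> e \<and> (\<exists>y\<in>e. y \<noteq> u \<and> \<not> flex u y)}"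

text \<open>The case in which the vertex of \<open>S\<close> on the hyperedge is the blocking one.
  There are up to \<open>card V\<close> choices of \<open>y\<close> but at most \<open>T0\<close> of
  \<open>v\<close>, so the count has the same order in \<open>card V\<close> as a vertex degree,
  with no factor \<open>card S\<close>.\<close>

definition S_bad :: "'a \<Rightarrow> ('a \<times> 'a set) set" where
  "S_bad u = (\<Union>y\<in>{y\<in>V. y \<noteq> u \<and> \<not> flex u y}. \<Union>v\<in>blk {u, y} \<inter> S. {v} \<times> sup_sets {u, y})"

lemma S_bad_bound: "finite (S_bad u)" "card (S_bad u) \<le> T0 * card V ^ p"
proof -
  define I where "I = {y\<in>V. y \<noteq> u \<and> \<not> flex u y}"
  have b: "finite (blk {u, y} \<inter> S)" "card (blk {u, y} \<inter> S) \<le> T0" if "y \<in> I" for y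
    using card_blk_Int[of u y S] that by (auto simp: I_def)
  show "finite (S_bad u)" unfolding S_bad_def I_def[symmetric]
    using fin_V b(1) finite_sup_sets by (auto simp: I_def)
  have "card (S_bad u) \<le> card V * (T0 * card V ^ (p - 1))"
    unfolding S_bad_def I_def[symmetric]
  proof (rule card_UN_le_mult)
    show "finite I" "card I \<le> card V" using fin_V by (auto simp: I_def card_mono)
    fix y assume y: "y \<in> I"
    show "card (\<Union>v\<in>blk {u, y} \<inter> S. {v} \<times> sup_sets {u, y}) \<le> T0 * card V ^ (p - 1)"
    proof (rule card_UN_le_mult[OF b(1)[OF y] _ b(2)[OF y]])
      fix v
      show "card ({v} \<times> sup_sets {u, y}) \<le> card V ^ (p - 1)" unfolding card_singleton_times
        using y by (intro card_sup_sets_2) (auto simp: I_def)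
    qed
  qed
  also have "\<dots> = T0 * card V ^ p" using N_mult_N_pow by (metis mult.left_commute)
  finally show "card (S_bad u) \<le> T0 * card V ^ p" .
qed

text \<open>The two terms are the two positions of the blocking vertex: in \<open>S\<close>, where
  only the missing factor \<open>card S\<close> helps, or in \<open>e\<close>, where
  \<open>u\<close>, \<open>y\<close> and \<open>t\<close> are three vertices of the link
  set.\<close>

lemma card_N_bad: "card (N_bad u) \<le> T0 * card V ^ p + card S * T0 * card V ^ (p - 1)"
proof -
  define I where "I = {y\<in>V. y \<noteq> u \<and> \<not> flex u y}"
  define X where "X = (\<lambda>y. \<Union>t\<in>blk {u, y} \<inter> V. S \<times> sup_sets {u, y, t})"
  have fI: "finite I" "card I \<le> card V" using fin_V by (auto simp: I_def card_mono)
  have b: "finite (blk {u, y} \<inter> V)" "card (blk {u, y} \<inter> V) \<le> T0" if "y \<in> I" for y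
    using card_blk_Int[of u y V] that by (auto simp: I_def)
  have sub: "N_bad u \<subseteq> S_bad u \<union> (\<Union>y\<in>I. X y)"
  proof
    fix z assume z: "z \<in> N_bad u"
    obtain v e where ve: "z = (v, e)" by (cases z)
    obtain y where z1: "(v, e) \<in> Z" "u \<in> e" "y \<in> e" "y \<noteq> u" "\<not> flex u y"
      using z ve by (auto simp: N_bad_def)
    have y: "y \<in> I" using ZD(2)[OF z1(1)] z1 by (auto simp: I_def)
    obtain t where t: "t \<in> blk {u, y}" "t \<in> insert v e"
      using blk_hit[OF z1(1), of u y] z1 by blast
    show "z \<in> S_bad u \<union> (\<Union>y\<in>I. X y)"
    proof (cases "t = v")
      case True
      then have "z \<in> S_bad u" unfolding ve S_bad_def I_def[symmetric] sup_sets_def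
        using y t ZD[OF z1(1)] z1 by blast
      then show ?thesis by blast
    next
      case False
      then have "(v, e) \<in> X y" unfolding X_def sup_sets_def using t ZD[OF z1(1)] z1 by blast
      then show ?thesis using ve y by blast
    qed
  qed
  have fX: "finite (\<Union>y\<in>I. X y)" unfolding X_def using fI(1) b(1) finite_sup_sets fin_S by auto
  have "card (\<Union>y\<in>I. X y) \<le> card V * (T0 * (card S * (card V ^ (p - 1) div card V)))"
  proof (rule card_UN_le_mult[OF fI(1) _ fI(2)])
    fix y assume y: "y \<in> I"
    show "card (X y) \<le> T0 * (card S * (card V ^ (p - 1) div card V))" unfolding X_def
    proof (rule card_UN_le_mult[OF b(1)[OF y] _ b(2)[OF y]])
      fix t assume "t \<in> blk {u, y} \<inter> V"
      then have "u \<noteq> t" "y \<noteq> t" "u \<noteq> y" using blk_fin[of u y] y by (auto simp: I_def)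
      then have "card (sup_sets {u, y, t}) \<le> card V ^ (p - 1) div card V" by (intro card_sup_sets_3')
      then show "card (S \<times> sup_sets {u, y, t}) \<le> card S * (card V ^ (p - 1) div card V)"
        by (simp add: card_cartesian_product)
    qed
  qed
  also have "\<dots> = card S * T0 * (card V * (card V ^ (p - 1) div card V))" by (simp only: ac_simps)
  also have "\<dots> \<le> card S * T0 * card V ^ (p - 1)" by (rule mult_le_mono2[OF N_mult_3])
  finally have "card (\<Union>y\<in>I. X y) \<le> card S * T0 * card V ^ (p - 1)" .
  moreover have "card (N_bad u) \<le> card (S_bad u) + card (\<Union>y\<in>I. X y)"
    using card_mono[OF _ sub] card_Un_le[of "S_bad u" "\<Union>y\<in>I. X y"] S_bad_bound(1) fX
    by (meson finite_UnI order_trans)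
  ultimately show ?thesis using S_bad_bound(2)[of u] by linarith
qed

text \<open>Link sets with an inflexible pair whose blocking set also meets the link set, so that a
  power of \<open>card V\<close> is saved. For link sets outside \<open>B_tri\<close>, every
  inflexible pair is blocked by the vertex of \<open>S\<close>; see \<open>B_triI\<close>.\<close>

definition B_tri :: "('a \<times> 'a set) set" where
  "B_tri = {(v, e) \<in> Z. \<exists>y\<in>e. \<exists>z\<in>e. y \<noteq> z \<and> \<not> flex y z \<and> e \<inter> blk {y, z} \<noteq> {}}"

definition bad_pairs :: "('a \<times> 'a) set" where
  "bad_pairs = {(y, z). y \<in> V \<and> z \<in> V \<and> y \<noteq> z \<and> \<not> flex y z}"

lemma bad_pairs_bound: "finite bad_pairs" "card bad_pairs \<le> card V * card V"
proof -
  have "bad_pairs \<subseteq> V \<times> V" by (auto simp: bad_pairs_def)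
  then show "finite bad_pairs" "card bad_pairs \<le> card V * card V"
    using fin_V finite_subset card_mono[of "V \<times> V" bad_pairs] by (auto simp: card_cartesian_product)
qed

text \<open>There are at most \<open>card V ^ 2\<close> pairs, and the quotient in the hypothesis
  stands for \<open>card V ^ (p - 2)\<close>.\<close>

lemma card_bad_pairs_UN:
  assumes "\<And>y z. (y, z) \<in> bad_pairs \<Longrightarrow> card (X y z) \<le> b * (card V ^ (p - 1) div card V)"
  shows "card (\<Union>(y, z)\<in>bad_pairs. X y z) \<le> b * card V ^ p"
proof -
  have "card (\<Union>(y, z)\<in>bad_pairs. X y z)
    \<le> (card V * card V) * (b * (card V ^ (p - 1) div card V))"
    by (rule card_UN_le_mult) (use bad_pairs_bound assms in auto)
  also have "\<dots> = b * (card V * (card V * (card V ^ (p - 1) div card V)))" by (simp only: ac_simps)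
  also have "\<dots> \<le> b * (card V * card V ^ (p - 1))" by (intro mult_le_mono2 N_mult_3)
  finally show ?thesis unfolding N_mult_N_pow .
qed

lemma card_B_tri: "card B_tri \<le> card S * T0 * card V ^ p"
proof -
  define X where "X = (\<lambda>y z. \<Union>t\<in>blk {y, z} \<inter> V. S \<times> sup_sets {y, z, t})"
  have b: "finite (blk {y, z} \<inter> V)" "card (blk {y, z} \<inter> V) \<le> T0" if "(y, z) \<in> bad_pairs" for y z
    using card_blk_Int[of y z V] that by (auto simp: bad_pairs_def)
  have "B_tri \<subseteq> (\<Union>(y, z)\<in>bad_pairs. X y z)"
  proof
    fix q assume q: "q \<in> B_tri"
    obtain v e where ve: "q = (v, e)" by (cases q)
    obtain y z t where z1: "(v, e) \<in> Z" "y \<in> e" "z \<in> e" "y \<noteq> z" "\<not> flex y z" "t \<in> e" "t \<in> blk {y, z}"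
      using q ve by (auto simp: B_tri_def)
    have "(v, e) \<in> X y z" unfolding X_def sup_sets_def using z1 ZD[OF z1(1)] by blast
    moreover have "(y, z) \<in> bad_pairs" using z1 ZD[OF z1(1)] by (auto simp: bad_pairs_def)
    ultimately show "q \<in> (\<Union>(y, z)\<in>bad_pairs. X y z)" using ve by blast
  qed
  moreover have "finite (\<Union>(y, z)\<in>bad_pairs. X y z)"
    unfolding X_def using bad_pairs_bound(1) b(1) finite_sup_sets fin_S by (intro finite_UN_I) auto
  ultimately have "card B_tri \<le> card (\<Union>(y, z)\<in>bad_pairs. X y z)" by (intro card_mono)
  also have "\<dots> \<le> (card S * T0) * card V ^ p"
  proof (rule card_bad_pairs_UN)
    fix y z assume yz: "(y, z) \<in> bad_pairs"
    have "card (X y z) \<le> T0 * (card S * (card V ^ (p - 1) div card V))" unfolding X_def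
    proof (rule card_UN_le_mult[OF b(1)[OF yz] _ b(2)[OF yz]])
      fix t assume "t \<in> blk {y, z} \<inter> V"
      then have "y \<noteq> t" "z \<noteq> t" "y \<noteq> z" using blk_fin[of y z] yz by (auto simp: bad_pairs_def)
      then have "card (sup_sets {y, z, t}) \<le> card V ^ (p - 1) div card V" by (intro card_sup_sets_3')
      then show "card (S \<times> sup_sets {y, z, t}) \<le> card S * (card V ^ (p - 1) div card V)"
        by (simp add: card_cartesian_product)
    qed
    then show "card (X y z) \<le> card S * T0 * (card V ^ (p - 1) div card V)" by (simp only: ac_simps)
  qed
  finally show ?thesis .
qed

lemma B_triI:
  assumes "(v, e) \<in> Z" "y \<in> e" "z \<in> e" "y \<noteq> z" "\<not> flex y z" "(v, e) \<notin> B_tri"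
  shows "v \<in> blk {y, z}"
proof -
  obtain t where t: "t \<in> blk {y, z}" "t \<in> insert v e" using blk_hit[OF assms(1), of y z] assms by blast
  then show ?thesis using assms unfolding B_tri_def by blast
qed

text \<open>The first term comes from pairs blocked by the vertex of \<open>S\<close>. It has the
  same power of \<open>card V\<close> as the main term and is negligible only because the main term
  carries a factor \<open>card S\<close>.\<close>

lemma card_nonclique:
  "card {(v, e) \<in> Z. \<not> clique flex e} \<le> T0 * card V ^ (p + 1) + card S * T0 * card V ^ p"
proof -
  define X where "X = (\<lambda>y z. \<Union>v\<in>blk {y, z} \<inter> S. {v} \<times> sup_sets {y, z})"
  have b: "finite (blk {y, z} \<inter> S)" "card (blk {y, z} \<inter> S) \<le> T0" if "(y, z) \<in> bad_pairs" for y z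
    using card_blk_Int[of y z S] that by (auto simp: bad_pairs_def)
  have sub: "{(v, e) \<in> Z. \<not> clique flex e} \<subseteq> B_tri \<union> (\<Union>(y, z)\<in>bad_pairs. X y z)"
  proof
    fix q assume q: "q \<in> {(v, e) \<in> Z. \<not> clique flex e}"
    obtain v e where ve: "q = (v, e)" by (cases q)
    obtain y z where z1: "(v, e) \<in> Z" "y \<in> e" "z \<in> e" "y \<noteq> z" "\<not> flex y z"
      using q ve by (auto simp: clique_def)
    show "q \<in> B_tri \<union> (\<Union>(y, z)\<in>bad_pairs. X y z)"
    proof (cases "q \<in> B_tri")
      case False
      then have "v \<in> blk {y, z}" using B_triI z1 ve by blast
      then have "(v, e) \<in> X y z" unfolding X_def sup_sets_def using z1 ZD[OF z1(1)] by blast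
      moreover have "(y, z) \<in> bad_pairs" using z1 ZD[OF z1(1)] by (auto simp: bad_pairs_def)
      ultimately show ?thesis using ve by blast
    qed blast
  qed
  have f1: "finite B_tri" using finite_Z by (rule rev_finite_subset) (auto simp: B_tri_def)
  have f2: "finite (\<Union>(y, z)\<in>bad_pairs. X y z)"
    unfolding X_def using bad_pairs_bound(1) b(1) finite_sup_sets by (intro finite_UN_I) auto
  have "card (\<Union>(y, z)\<in>bad_pairs. X y z) \<le> (card V * card V) * (T0 * card V ^ (p - 1))"
  proof (rule card_UN_le_mult)
    fix i assume i: "i \<in> bad_pairs"
    obtain y z where yz: "i = (y, z)" by (cases i)
    have "card (X y z) \<le> T0 * card V ^ (p - 1)" unfolding X_def
    proof (rule card_UN_le_mult)
      show "finite (blk {y, z} \<inter> S)" "card (blk {y, z} \<inter> S) \<le> T0" using b i yz by auto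
      show "card ({v} \<times> sup_sets {y, z}) \<le> card V ^ (p - 1)" for v
        unfolding card_singleton_times using i yz by (intro card_sup_sets_2) (auto simp: bad_pairs_def)
    qed
    then show "card (case i of (y, z) \<Rightarrow> X y z) \<le> T0 * card V ^ (p - 1)" using yz by simp
  qed (use bad_pairs_bound in auto)
  also have "\<dots> = T0 * (card V * (card V * card V ^ (p - 1)))" by (simp only: ac_simps)
  also have "\<dots> = T0 * card V ^ (p + 1)" unfolding N_mult_N_pow by simp
  finally have "card (\<Union>(y, z)\<in>bad_pairs. X y z) \<le> T0 * card V ^ (p + 1)" .
  moreover have "card {(v, e) \<in> Z. \<not> clique flex e} \<le> card B_tri + card (\<Union>(y, z)\<in>bad_pairs. X y z)"
    using card_mono[OF _ sub] card_Un_le[of B_tri "\<Union>(y, z)\<in>bad_pairs. X y z"] f1 f2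
    by (meson finite_UnI order_trans)
  ultimately show ?thesis using card_B_tri by linarith
qed

text \<open>The counterpart of \<open>S_bad\<close> for inflexible pairs that avoid
  \<open>u\<close>. The sum runs over one more vertex, but three vertices of the link set are now
  prescribed, so the order is the same.\<close>

definition S_tri :: "'a \<Rightarrow> ('a \<times> 'a set) set" where
  "S_tri u = (\<Union>(y, z)\<in>{(y, z)\<in>bad_pairs. y \<noteq> u \<and> z \<noteq> u}. \<Union>v\<in>blk {y, z} \<inter> S. {v} \<times> sup_sets {u, y, z})"

lemma S_tri_bound: "finite (S_tri u)" "card (S_tri u) \<le> T0 * card V ^ p"
proof -
  define X where "X = (\<lambda>y z. if y \<noteq> u \<and> z \<noteq> u then \<Union>v\<in>blk {y, z} \<inter> S. {v} \<times> sup_sets {u, y, z} else {})"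
  have b: "finite (blk {y, z} \<inter> S)" "card (blk {y, z} \<inter> S) \<le> T0" if "(y, z) \<in> bad_pairs" for y z
    using card_blk_Int[of y z S] that by (auto simp: bad_pairs_def)
  have eq: "S_tri u = (\<Union>(y, z)\<in>bad_pairs. X y z)"
    unfolding S_tri_def X_def by (auto split: if_splits)
  show "finite (S_tri u)" unfolding eq
    unfolding X_def using bad_pairs_bound(1) b(1) finite_sup_sets by (intro finite_UN_I) auto
  show "card (S_tri u) \<le> T0 * card V ^ p" unfolding eq
  proof (rule card_bad_pairs_UN)
    fix y z assume yz: "(y, z) \<in> bad_pairs"
    show "card (X y z) \<le> T0 * (card V ^ (p - 1) div card V)"
    proof (cases "y \<noteq> u \<and> z \<noteq> u")
      case True
      have "card (\<Union>v\<in>blk {y, z} \<inter> S. {v} \<times> sup_sets {u, y, z}) \<le> T0 * (card V ^ (p - 1) div card V)"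
      proof (rule card_UN_le_mult[OF b(1)[OF yz] _ b(2)[OF yz]])
        fix v
        show "card ({v} \<times> sup_sets {u, y, z}) \<le> card V ^ (p - 1) div card V"
          unfolding card_singleton_times using True yz
          by (intro card_sup_sets_3') (auto simp: bad_pairs_def)
      qed
      then show ?thesis using True by (simp add: X_def)
    qed (auto simp: X_def)
  qed
qed

text \<open>The exceptional hyperedges in \<open>B_tri\<close> are few in total, but could all pass through a bounded number of
  vertices.\<close>

definition typical :: "'a \<Rightarrow> bool" where
  "typical u \<longleftrightarrow> card {(v, e) \<in> B_tri. u \<in> e} \<le> card V ^ p"

text \<open>Double counting: each member of \<open>B_tri\<close> has \<open>p + 1\<close> vertices
  in its link set, and an atypical vertex lies in more than \<open>card V ^ p\<close> of these link
  sets.\<close>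

lemma card_not_typical:
  assumes "V \<noteq> {}"
  shows "card {u \<in> V. \<not> typical u} \<le> (p + 1) * (card S * T0)"
proof -
  let ?U = "{u \<in> V. \<not> typical u}"
  have f1: "finite B_tri" using finite_Z by (rule rev_finite_subset) (auto simp: B_tri_def)
  have "card ?U * card V ^ p = (\<Sum>u\<in>?U. card V ^ p)" by simp
  also have "\<dots> \<le> (\<Sum>u\<in>?U. card {(v, e) \<in> B_tri. u \<in> e})"
    by (rule sum_mono) (simp add: typical_def)
  also have "\<dots> \<le> (\<Sum>u\<in>V. card {q \<in> B_tri. u \<in> snd q})"
  proof -
    have "{(v, e) \<in> B_tri. u \<in> e} = {q \<in> B_tri. u \<in> snd q}" for u by auto
    then show ?thesis using fin_V by (auto intro!: sum_mono2)
  qed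
  also have "\<dots> = (\<Sum>q\<in>B_tri. card {u \<in> V. u \<in> snd q})"
    by (rule sum_multicount_gen) (use fin_V f1 in auto)
  also have "\<dots> = (\<Sum>q\<in>B_tri. p + 1)"
  proof (rule sum.cong[OF refl])
    fix q assume q: "q \<in> B_tri"
    then have "(fst q, snd q) \<in> Z" by (auto simp: B_tri_def)
    from ZD(2,4)[OF this] have "{u \<in> V. u \<in> snd q} = snd q" "card (snd q) = p + 1" by auto
    then show "card {u \<in> V. u \<in> snd q} = p + 1" by simp
  qed
  also have "\<dots> = card B_tri * (p + 1)" by simp
  also have "\<dots> \<le> card S * T0 * card V ^ p * (p + 1)" using card_B_tri by (rule mult_le_mono1)
  also have "\<dots> = ((p + 1) * (card S * T0)) * card V ^ p" by (simp only: ac_simps)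
  finally have "card ?U * card V ^ p \<le> ((p + 1) * (card S * T0)) * card V ^ p" .
  moreover have "0 < card V ^ p" using assms fin_V by (simp add: card_gt_0_iff)
  ultimately show ?thesis using mult_le_cancel2 by blast
qed

end

section \<open>Degree estimates\<close>

lemma card_crossing_le_turan_count:
  assumes "0 < k" "\<And>j. j < k \<Longrightarrow> A j \<subseteq> W" "\<And>i j. i < k \<Longrightarrow> j < k \<Longrightarrow> i \<noteq> j \<Longrightarrow> A i \<inter> A j = {}"
    and W: "finite W"
  shows "finite (crossing {..<k} A q)" "card (crossing {..<k} A q) \<le> turan_count q (card W) k"
proof -
  have f: "finite (A j)" if "j < k" for j using assms(2)[OF that] W finite_subset by blast
  have "(\<Sum>j<k. card (A j)) = card (\<Union>j<k. A j)"
    using assms(3) f by (intro card_UN_disjoint[symmetric]) auto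
  also have "\<dots> \<le> card W" using assms(2) W by (intro card_mono) auto
  finally have "esym q {..<k} (\<lambda>j. card (A j)) \<le> turan_count q (card W) k"
    using assms(1) by (intro esym_le_turan_count) auto
  moreover have "card (crossing {..<k} A q) = esym q {..<k} (\<lambda>j. card (A j))"
    by (rule card_crossing) (use f assms(3) in auto)
  ultimately show "card (crossing {..<k} A q) \<le> turan_count q (card W) k" by simp
  have "crossing {..<k} A q \<subseteq> Pow W" unfolding crossing_def using assms(2) by blast
  then show "finite (crossing {..<k} A q)" using W finite_subset by blast
qed

context star_system
begin

lemma k_pos: "0 < k" using p_k by simp

definition Zdeg :: "'a \<Rightarrow> nat" where "Zdeg u = card {(v, e) \<in> Z. u \<in> e}"

lemma edge_cases:
  assumes "e \<in> H"
  shows "e \<in> H2 \<or> (\<exists>v d. (v, d) \<in> Z \<and> e = insert v d)"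
proof (cases "e \<in> H2")
  case False
  obtain v where v: "v \<in> e" "v \<in> S" using edge(3)[OF assms] by blast
  have "e - {v} \<subseteq> V" using False v edge(1)[OF assms] assms unfolding H2_def by blast
  then have "(v, e - {v}) \<in> Z" using v assms by (simp add: Z_def insert_absorb)
  then show ?thesis using v by (metis insert_Diff)
qed blast

lemma finite_H: "finite H"
  using edge(1) fin_S fin_V by (meson Sup_le_iff finite_UnI finite_UnionD finite_subset)

lemma finite_H2: "finite H2"
  using finite_H by (rule rev_finite_subset) (auto simp: H2_def)

lemma card_H_le: "card H \<le> card Z + card H2"
proof -
  have "H \<subseteq> (\<lambda>(v, e). insert v e) ` Z \<union> H2"
  proof
    fix e assume "e \<in> H"
    then show "e \<in> (\<lambda>(v, e). insert v e) ` Z \<union> H2" using edge_cases[of e] by force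
  qed
  then have "card H \<le> card ((\<lambda>(v, e). insert v e) ` Z \<union> H2)"
    using finite_Z finite_H2 by (intro card_mono) auto
  also have "\<dots> \<le> card ((\<lambda>(v, e). insert v e) ` Z) + card H2" by (rule card_Un_le)
  finally show ?thesis using card_image_le[OF finite_Z, of "\<lambda>(v, e). insert v e"] by linarith
qed

lemma degree_le:
  assumes "u \<in> V"
  shows "card {e \<in> H. u \<in> e} \<le> Zdeg u + card {e \<in> H2. u \<in> e}"
proof -
  let ?Z = "{(v, e) \<in> Z. u \<in> e}"
  have f: "finite ?Z" using finite_Z by (rule rev_finite_subset) auto
  have "{e \<in> H. u \<in> e} \<subseteq> (\<lambda>(v, e). insert v e) ` ?Z \<union> {e \<in> H2. u \<in> e}"
  proof
    fix e assume e: "e \<in> {e \<in> H. u \<in> e}"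
    show "e \<in> (\<lambda>(v, e). insert v e) ` ?Z \<union> {e \<in> H2. u \<in> e}"
    proof (cases "e \<in> H2")
      case False
      then obtain v d where d: "(v, d) \<in> Z" "e = insert v d" using edge_cases e by blast
      have "u \<noteq> v" using ZD(1)[OF d(1)] assms S_V by blast
      then have "(v, d) \<in> ?Z" using d e by auto
      then show ?thesis using d(2) by force
    qed (use e in auto)
  qed
  then have "card {e \<in> H. u \<in> e} \<le> card ((\<lambda>(v, e). insert v e) ` ?Z \<union> {e \<in> H2. u \<in> e})"
    using f finite_H2 by (intro card_mono) auto
  also have "\<dots> \<le> card ((\<lambda>(v, e). insert v e) ` ?Z) + card {e \<in> H2. u \<in> e}" by (rule card_Un_le)
  finally show ?thesis unfolding Zdeg_def
    using card_image_le[OF f, of "\<lambda>(v, e). insert v e"] by linarith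
qed

lemma card_edge_supersets:
  assumes "finite A" "card A \<le> p + 2"
  shows "card {e \<in> H. A \<subseteq> e} \<le> (card S + card V) ^ (p + 2 - card A)"
proof -
  have "{e \<in> H. A \<subseteq> e} \<subseteq> {e. e \<subseteq> S \<union> V \<and> card e = p + 2 \<and> A \<subseteq> e}" using edge by blast
  then have "card {e \<in> H. A \<subseteq> e} \<le> card {e. e \<subseteq> S \<union> V \<and> card e = p + 2 \<and> A \<subseteq> e}"
    using fin_S fin_V by (intro card_mono) auto
  also have "\<dots> \<le> card (S \<union> V) ^ (p + 2 - card A)"
    by (rule card_supersets_le) (use assms fin_S fin_V in auto)
  also have "card (S \<union> V) = card S + card V" by (rule card_Un_disjoint[OF fin_S fin_V S_V])
  finally show ?thesis .
qed

lemma H2_split: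
  assumes "\<And>v v'. v \<in> S \<Longrightarrow> v' \<in> S \<Longrightarrow> v \<noteq> v' \<Longrightarrow> card {e \<in> H. {v, v'} \<union> B \<subseteq> e} \<le> b"
  shows "card {e \<in> H2. B \<subseteq> e} \<le> card S * card S * b"
proof -
  define P where "P = {(v, v'). v \<in> S \<and> v' \<in> S \<and> v \<noteq> v'}"
  have P: "P \<subseteq> S \<times> S" by (auto simp: P_def)
  then have fP: "finite P" using fin_S by (meson finite_SigmaI finite_subset)
  have "{e \<in> H2. B \<subseteq> e} \<subseteq> (\<Union>q\<in>P. {e \<in> H. {fst q, snd q} \<union> B \<subseteq> e})"
    unfolding H2_def P_def by force
  then have "card {e \<in> H2. B \<subseteq> e} \<le> card (\<Union>q\<in>P. {e \<in> H. {fst q, snd q} \<union> B \<subseteq> e})"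
    using fP finite_H by (intro card_mono) auto
  also have "\<dots> \<le> (card S * card S) * b"
  proof (rule card_UN_le_mult[OF fP])
    show "card P \<le> card S * card S"
      using card_mono[OF _ P] fin_S by (simp add: card_cartesian_product)
  qed (use assms in \<open>auto simp: P_def\<close>)
  finally show ?thesis .
qed

lemma card_H2: "card H2 \<le> card S * card S * (card S + card V) ^ p"
proof -
  have "card {e \<in> H2. {} \<subseteq> e} \<le> card S * card S * (card S + card V) ^ p"
  proof (rule H2_split)
    fix v v' :: 'a assume "v \<noteq> v'"
    then show "card {e \<in> H. {v, v'} \<union> {} \<subseteq> e} \<le> (card S + card V) ^ p"
      using card_edge_supersets[of "{v, v'}"] by simp
  qed
  then show ?thesis by simp
qed

lemma card_H2_degree:
  assumes "u \<in> V"
  shows "card {e \<in> H2. u \<in> e} \<le> card S * card S * (card S + card V) ^ (p - 1)"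
proof -
  have "card {e \<in> H2. {u} \<subseteq> e} \<le> card S * card S * (card S + card V) ^ (p - 1)"
  proof (rule H2_split)
    fix v v' assume v: "v \<noteq> v'" "v \<in> S" "v' \<in> S"
    have e: "{v, v'} \<union> {u} = {v, v', u}" by auto
    have "v \<noteq> u" "v' \<noteq> u" using v assms S_V by blast+
    then have "card {v, v', u} = 3" using v(1) by simp
    then show "card {e \<in> H. {v, v'} \<union> {u} \<subseteq> e} \<le> (card S + card V) ^ (p - 1)"
      unfolding e using card_edge_supersets[of "{v, v', u}"] p_pos by simp
  qed
  then show ?thesis by simp
qed

text \<open>Adding \<open>v\<close> to such a clique would give a flexible clique on
  \<open>k + 2\<close> vertices.\<close>

lemma R_clique_free:
  assumes "v \<in> S" "c \<subseteq> R v" "clique flex c"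
  shows "card c \<noteq> Suc k"
proof
  assume c: "card c = Suc k"
  have fc: "finite c" using c by (simp add: card_ge_0_finite)
  have "v \<notin> c" using assms R_subset S_V by blast
  then have "card (insert v c) = k + 2" using c fc by simp
  moreover have "clique flex (insert v c)"
    using assms flex_sym unfolding clique_def R_def by blast
  ultimately show False using no_flex_clique by blast
qed

text \<open>Link sets of \<open>v\<close> that are flexible cliques inside \<open>R v\<close> are
  counted by Zykov's theorem, since \<open>R v\<close> has no flexible
  \<open>(k + 1)\<close>-clique. The other terms count link sets with an inflexible pair inside, or
  with a vertex inflexible with \<open>v\<close>. The dependence on \<open>card (R v)\<close> is
  what makes a small \<open>R v\<close> costly.\<close>

lemma card_Z_le_sum:
  "card Z \<le> (\<Sum>v\<in>S. turan_count (p + 1) (card (R v)) k)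
    + T0 * card V ^ (p + 1) + 2 * (card S * T0 * card V ^ p)"
proof -
  define C where "C = (\<lambda>v. {c. c \<subseteq> R v \<and> card c = p + 1 \<and> clique flex c})"
  let ?N = "{(v, e) \<in> Z. \<not> clique flex e}"
  have fC: "finite (C v)" for v unfolding C_def using finite_R by auto
  have sub: "Z \<subseteq> (?N \<union> (\<Union>u\<in>V. G_bad u)) \<union> Sigma S C"
  proof
    fix q assume q: "q \<in> Z"
    obtain v e where ve: "q = (v, e)" by (cases q)
    note z = ZD[OF q[unfolded ve]]
    show "q \<in> (?N \<union> (\<Union>u\<in>V. G_bad u)) \<union> Sigma S C"
    proof (cases "e \<subseteq> R v")
      case True
      then show ?thesis using q ve z by (auto simp: C_def)
    next
      case False
      then obtain u where "u \<in> e" "u \<notin> R v" by blast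
      then have "u \<in> V" "q \<in> G_bad u" using q ve z by (auto simp: G_bad_def R_def)
      then show ?thesis by blast
    qed
  qed
  have f1: "finite ?N" "finite (G_bad u)" for u
    using finite_Z by (auto simp: G_bad_def intro: rev_finite_subset[of Z])
  have f2: "finite (\<Union>u\<in>V. G_bad u)" using f1 fin_V by blast
  have "card (\<Union>u\<in>V. G_bad u) \<le> card V * (card S * (T0 * card V ^ (p - 1)))"
    by (rule card_UN_le_mult) (use fin_V card_G_bad in auto)
  also have "\<dots> = card S * T0 * (card V * card V ^ (p - 1))" by (simp only: ac_simps)
  also have "\<dots> = card S * T0 * card V ^ p" unfolding N_mult_N_pow ..
  finally have g: "card (\<Union>u\<in>V. G_bad u) \<le> card S * T0 * card V ^ p" .
  have "card (Sigma S C) = (\<Sum>v\<in>S. card (C v))" using fin_S fC by (simp add: card_SigmaI)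
  also have "\<dots> \<le> (\<Sum>v\<in>S. turan_count (p + 1) (card (R v)) k)"
  proof (rule sum_mono)
    fix v assume v: "v \<in> S"
    show "card (C v) \<le> turan_count (p + 1) (card (R v)) k" unfolding C_def
      by (rule card_cliques_le_turan_count[OF finite_R]) (use p_k flex_sym R_clique_free v in auto)
  qed
  finally have s: "card (Sigma S C) \<le> (\<Sum>v\<in>S. turan_count (p + 1) (card (R v)) k)" .
  have "card Z \<le> card ((?N \<union> (\<Union>u\<in>V. G_bad u)) \<union> Sigma S C)"
    by (rule card_mono[OF _ sub]) (use f1 f2 fin_S fC in auto)
  also have "\<dots> \<le> card (?N \<union> (\<Union>u\<in>V. G_bad u)) + card (Sigma S C)" by (rule card_Un_le)
  also have "card (?N \<union> (\<Union>u\<in>V. G_bad u)) \<le> card ?N + card (\<Union>u\<in>V. G_bad u)" by (rule card_Un_le)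
  finally show ?thesis using g s card_nonclique by linarith
qed

definition nbr :: "'a \<Rightarrow> 'a set" where "nbr u = {y \<in> V. flex u y}"

lemma finite_nbr: "finite (nbr u)"
  using fin_V by (auto simp: nbr_def)

lemma card_outside:
  assumes "B \<subseteq> V" "u \<notin> B"
  shows "card {(v, e) \<in> Z. u \<in> e \<and> e \<inter> B \<noteq> {}} \<le> card S * card B * card V ^ (p - 1)"
proof -
  have fB: "finite B" using assms fin_V finite_subset by blast
  have "{(v, e) \<in> Z. u \<in> e \<and> e \<inter> B \<noteq> {}} \<subseteq> (\<Union>x\<in>B. S \<times> sup_sets {u, x})"
    unfolding sup_sets_def using ZD by fastforce
  then have "card {(v, e) \<in> Z. u \<in> e \<and> e \<inter> B \<noteq> {}} \<le> card (\<Union>x\<in>B. S \<times> sup_sets {u, x})"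
    using fB fin_S finite_sup_sets by (intro card_mono) auto
  also have "\<dots> \<le> card B * (card S * card V ^ (p - 1))"
  proof (rule card_UN_le_mult[OF fB])
    fix x assume "x \<in> B"
    then have "card (sup_sets {u, x}) \<le> card V ^ (p - 1)" using assms by (intro card_sup_sets_2) auto
    then show "card (S \<times> sup_sets {u, x}) \<le> card S * card V ^ (p - 1)"
      by (simp add: card_cartesian_product)
  qed simp
  finally show ?thesis by (simp only: ac_simps)
qed

lemma inj_remove: "inj_on (\<lambda>(v, e). (v, e - {u})) {(v, e). u \<in> e}"
  by (auto simp: inj_on_def)

text \<open>A link set through \<open>u\<close> that is a flexible clique inside \<open>R w\<close>
  leaves, after removal of \<open>u\<close>, a \<open>p\<close>-clique in
  \<open>nbr u \<inter> R w\<close>. That set has no flexible \<open>k\<close>-clique, as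
  \<open>u\<close> and \<open>w\<close> would extend it to \<open>k + 2\<close> vertices; hence the
  \<open>k - 1\<close> parts. In \<open>2 * T0 + 1\<close>, blocking vertices in \<open>S\<close>
  account for \<open>2 * T0\<close> and the typicality bound on \<open>B_tri\<close> for the
  rest.\<close>

lemma Zdeg_le_typical:
  assumes "typical u" "u \<in> R w" "w \<in> S"
  shows "Zdeg u \<le> card S * turan_count p (card (nbr u \<inter> R w)) (k - 1)
    + card S * card (V - R w) * card V ^ (p - 1) + (2 * T0 + 1) * card V ^ p"
proof -
  define X where "X = nbr u \<inter> R w"
  define C where "C = {c. c \<subseteq> X \<and> card c = p \<and> clique flex c}"
  define D where "D = {(v, e) \<in> Z. u \<in> e \<and> clique flex e \<and> e - {u} \<subseteq> R w}"
  have uV: "u \<in> V" using assms R_subset by blast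
  have uw: "flex w u" using assms(2) by (simp add: R_def)
  have fX: "finite X" using finite_R by (simp add: X_def)
  have fC: "finite C" using fX by (simp add: C_def)
  have kk: "Suc (k - 1) = k" "0 < k - 1" using p_k p_pos by auto
  have nocl: "card c \<noteq> Suc (k - 1)" if c: "c \<subseteq> X" "clique flex c" for c
  proof
    assume cc: "card c = Suc (k - 1)"
    have fc: "finite c" using cc by (simp add: card_ge_0_finite)
    have "u \<notin> c" using c unfolding X_def nbr_def using flex_neq by blast
    moreover have "clique flex (insert u c)"
      using c flex_sym unfolding clique_def X_def nbr_def by blast
    moreover have "insert u c \<subseteq> R w" using c assms(2) unfolding X_def by blast
    ultimately show False using R_clique_free[OF assms(3), of "insert u c"] cc fc kk by simp
  qed
  have cC: "card C \<le> turan_count p (card X) (k - 1)" unfolding C_def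
    by (rule card_cliques_le_turan_count[OF fX]) (use kk flex_sym nocl in auto)
  have "(\<lambda>(v, e). (v, e - {u})) ` D \<subseteq> S \<times> C"
  proof
    fix q assume "q \<in> (\<lambda>(v, e). (v, e - {u})) ` D"
    then obtain v e where q: "q = (v, e - {u})" and d: "(v, e) \<in> Z" "u \<in> e" "clique flex e" "e - {u} \<subseteq> R w"
      by (auto simp: D_def)
    note z = ZD[OF d(1)]
    have "flex u y" if "y \<in> e - {u}" for y
      using bspec[OF bspec[OF d(3)[unfolded clique_def] d(2)], of y] that by auto
    then have "e - {u} \<subseteq> X" unfolding X_def nbr_def using d(4) z(2) by (intro subsetI) auto
    moreover have "card (e - {u}) = p" using z d by simp
    moreover have "clique flex (e - {u})" using d(3) by (rule clique_subset) blast
    ultimately show "q \<in> S \<times> C" using q z(1) by (simp add: C_def)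
  qed
  moreover have "inj_on (\<lambda>(v, e). (v, e - {u})) D"
    by (rule inj_on_subset[OF inj_remove]) (auto simp: D_def)
  moreover have "finite (S \<times> C)" using fin_S fC by simp
  ultimately have "card D \<le> card (S \<times> C)" by (intro card_inj_on_le)
  then have cD: "card D \<le> card S * turan_count p (card X) (k - 1)"
    using cC by (metis card_cartesian_product mult_le_mono2 order_trans)
  define E where "E = {(v, e) \<in> Z. u \<in> e \<and> e \<inter> (V - R w) \<noteq> {}}"
  have cE: "card E \<le> card S * card (V - R w) * card V ^ (p - 1)"
    unfolding E_def by (rule card_outside) (use assms in auto)
  define B where "B = {(v, e) \<in> B_tri. u \<in> e}"
  have cB: "card B \<le> card V ^ p" using assms(1) by (simp add: B_def typical_def)
  have sub: "{(v, e) \<in> Z. u \<in> e} \<subseteq> ((D \<union> E) \<union> B) \<union> (S_bad u \<union> S_tri u)"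
  proof
    fix q assume q: "q \<in> {(v, e) \<in> Z. u \<in> e}"
    obtain v e where ve: "q = (v, e)" by (cases q)
    have z0: "(v, e) \<in> Z" "u \<in> e" using q ve by auto
    note z = ZD[OF z0(1)]
    show "q \<in> ((D \<union> E) \<union> B) \<union> (S_bad u \<union> S_tri u)"
    proof (cases "clique flex e")
      case True
      then show ?thesis using z0 ve z unfolding D_def E_def by blast
    next
      case False
      then obtain x y where xy: "x \<in> e" "y \<in> e" "x \<noteq> y" "\<not> flex x y" unfolding clique_def by blast
      show ?thesis
      proof (cases "q \<in> B_tri")
        case True
        then show ?thesis using z0 ve by (auto simp: B_def)
      next
        case False
        then have v: "v \<in> blk {x, y}" using B_triI z0 xy ve by blast
        consider "x = u" | "y = u" | "x \<noteq> u" "y \<noteq> u" by blast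
        then show ?thesis
        proof cases
          case 1
          then have "q \<in> S_bad u" unfolding S_bad_def sup_sets_def ve using z z0 xy v by blast
          then show ?thesis by blast
        next
          case 2
          have "\<not> flex y x" "v \<in> blk {y, x}" using xy(4) flex_sym v by (auto simp: insert_commute)
          then have "q \<in> S_bad u" unfolding S_bad_def sup_sets_def ve using z z0 xy 2 by blast
          then show ?thesis by blast
        next
          case 3
          have "(x, y) \<in> bad_pairs" using xy z by (auto simp: bad_pairs_def)
          then have "q \<in> S_tri u" unfolding S_tri_def sup_sets_def ve using z z0 xy v 3 by blast
          then show ?thesis by blast
        qed
      qed
    qed
  qed
  have fin: "finite D" "finite E" "finite B"
    using finite_Z by (auto simp: D_def E_def B_def B_tri_def intro: rev_finite_subset[of Z])
  have "Zdeg u \<le> card (((D \<union> E) \<union> B) \<union> (S_bad u \<union> S_tri u))" unfolding Zdeg_def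
    by (rule card_mono[OF _ sub]) (use fin S_bad_bound S_tri_bound in auto)
  also have "\<dots> \<le> card ((D \<union> E) \<union> B) + card (S_bad u \<union> S_tri u)" by (rule card_Un_le)
  also have "card ((D \<union> E) \<union> B) \<le> card (D \<union> E) + card B" by (rule card_Un_le)
  also have "card (D \<union> E) \<le> card D + card E" by (rule card_Un_le)
  also have "card (S_bad u \<union> S_tri u) \<le> card (S_bad u) + card (S_tri u)" by (rule card_Un_le)
  finally show ?thesis
    using cD cE cB S_bad_bound(2)[of u] S_tri_bound(2)[of u] unfolding X_def
    by (simp add: algebra_simps)
qed

text \<open>Vertices \<open>v\<close> inflexible with \<open>u\<close> contribute only to
  \<open>G_bad\<close>, which is of lower order. So a large degree of \<open>u\<close> needs many
  \<open>v\<close> flexible with \<open>u\<close>.\<close>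

lemma Zdeg_le_few:
  assumes "u \<in> V"
  shows "Zdeg u \<le> card {v \<in> S. flex v u} * card V ^ p + card S * T0 * card V ^ (p - 1)"
proof -
  let ?Y = "{v \<in> S. flex v u}"
  have "{(v, e) \<in> Z. u \<in> e} \<subseteq> ?Y \<times> sup_sets {u} \<union> G_bad u"
    unfolding sup_sets_def G_bad_def using ZD by fastforce
  moreover have fG: "finite (G_bad u)" using finite_Z by (auto simp: G_bad_def intro: rev_finite_subset[of Z])
  ultimately have "Zdeg u \<le> card (?Y \<times> sup_sets {u} \<union> G_bad u)" unfolding Zdeg_def
    using fin_S finite_sup_sets by (intro card_mono) auto
  also have "\<dots> \<le> card (?Y \<times> sup_sets {u}) + card (G_bad u)" by (rule card_Un_le)
  also have "card (?Y \<times> sup_sets {u}) \<le> card ?Y * card V ^ p"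
    using card_supersets_le[of V "{u}" "p + 1"] fin_V
    by (simp add: card_cartesian_product sup_sets_def)
  finally show ?thesis using card_G_bad[OF assms] by (simp add: mult.assoc)
qed

text \<open>The parts replace cliques: since link sets cross the parts, the rest of a link set of
  \<open>u\<close> is a crossing set inside the flexible neighbourhood of \<open>u\<close>, whether
  or not its own pairs are flexible. Therefore \<open>B_tri\<close> does not enter, and atypical
  \<open>u\<close> are covered.\<close>

lemma Zdeg_le_crossing:
  fixes A :: "nat \<Rightarrow> 'a set"
  assumes "u \<in> V" and A: "\<And>j. j < k \<Longrightarrow> A j \<subseteq> V" "\<And>i j. i < k \<Longrightarrow> j < k \<Longrightarrow> i \<noteq> j \<Longrightarrow> A i \<inter> A j = {}"
    and cross: "\<And>v e j. (v, e) \<in> Z \<Longrightarrow> j < k \<Longrightarrow> card (e \<inter> A j) \<le> 1"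
  shows "Zdeg u \<le> card {v \<in> S. flex v u} * esym p {..<k} (\<lambda>j. card (nbr u \<inter> A j))
    + card S * card (V - (\<Union>j<k. A j)) * card V ^ (p - 1) + T0 * card V ^ p
    + 2 * (card S * T0 * card V ^ (p - 1))"
proof -
  let ?Y = "{v \<in> S. flex v u}"
  define C where "C = crossing {..<k} (\<lambda>j. nbr u \<inter> A j) p"
  have cC: "card C = esym p {..<k} (\<lambda>j. card (nbr u \<inter> A j))" unfolding C_def
  proof (rule card_crossing)
    show "finite (nbr u \<inter> A i)" for i using finite_nbr by simp
    fix i j assume "i \<in> {..<k}" "j \<in> {..<k}" "i \<noteq> j"
    then have "A i \<inter> A j = {}" using A(2) by simp
    then show "nbr u \<inter> A i \<inter> (nbr u \<inter> A j) = {}" by blast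
  qed simp
  have fC: "finite C"
  proof -
    have "C \<subseteq> Pow V" unfolding C_def crossing_def using A(1) by blast
    then show ?thesis using fin_V finite_subset by blast
  qed
  define D where "D = {(v, e) \<in> Z. u \<in> e \<and> flex v u \<and> e - {u} \<subseteq> nbr u \<and> e - {u} \<subseteq> (\<Union>j<k. A j)}"
  have "(\<lambda>(v, e). (v, e - {u})) ` D \<subseteq> ?Y \<times> C"
  proof
    fix q assume "q \<in> (\<lambda>(v, e). (v, e - {u})) ` D"
    then obtain v e where q: "q = (v, e - {u})" and d: "(v, e) \<in> Z" "u \<in> e" "flex v u"
      "e - {u} \<subseteq> nbr u" "e - {u} \<subseteq> (\<Union>j<k. A j)" by (auto simp: D_def)
    note z = ZD[OF d(1)]
    have "card (e - {u}) = p" using z d by simp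
    moreover have "card ((e - {u}) \<inter> (nbr u \<inter> A j)) \<le> 1" if "j < k" for j
    proof -
      have "card ((e - {u}) \<inter> (nbr u \<inter> A j)) \<le> card (e \<inter> A j)"
        using z(5) by (intro card_mono) auto
      then show ?thesis using cross[OF d(1) that] by linarith
    qed
    moreover have "e - {u} \<subseteq> (\<Union>j<k. nbr u \<inter> A j)" using d by blast
    ultimately have "e - {u} \<in> C" unfolding C_def crossing_def by simp
    then show "q \<in> ?Y \<times> C" using q z(1) d(3) by simp
  qed
  moreover have "inj_on (\<lambda>(v, e). (v, e - {u})) D"
    by (rule inj_on_subset[OF inj_remove]) (auto simp: D_def)
  moreover have "finite (?Y \<times> C)" using fin_S fC by simp
  ultimately have "card D \<le> card (?Y \<times> C)" by (intro card_inj_on_le)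
  then have cD: "card D \<le> card ?Y * esym p {..<k} (\<lambda>j. card (nbr u \<inter> A j))"
    unfolding cC[symmetric] by (simp add: card_cartesian_product)
  define B where "B = V - (\<Union>j<k. A j) - {u}"
  define E where "E = {(v, e) \<in> Z. u \<in> e \<and> e \<inter> B \<noteq> {}}"
  have "card E \<le> card S * card B * card V ^ (p - 1)" unfolding E_def
    by (rule card_outside) (auto simp: B_def)
  moreover have "card B \<le> card (V - (\<Union>j<k. A j))" unfolding B_def using fin_V by (intro card_mono) auto
  ultimately have cE: "card E \<le> card S * card (V - (\<Union>j<k. A j)) * card V ^ (p - 1)"
    by (meson mult_le_mono1 mult_le_mono2 order_trans)
  have sub: "{(v, e) \<in> Z. u \<in> e} \<subseteq> ((D \<union> E) \<union> N_bad u) \<union> G_bad u"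
  proof
    fix q assume q: "q \<in> {(v, e) \<in> Z. u \<in> e}"
    obtain v e where ve: "q = (v, e)" by (cases q)
    have z0: "(v, e) \<in> Z" "u \<in> e" using q ve by auto
    note z = ZD[OF z0(1)]
    consider "\<not> flex v u" | "\<not> e - {u} \<subseteq> nbr u" | "\<not> e - {u} \<subseteq> (\<Union>j<k. A j)"
      | "flex v u" "e - {u} \<subseteq> nbr u" "e - {u} \<subseteq> (\<Union>j<k. A j)" by blast
    then show "q \<in> ((D \<union> E) \<union> N_bad u) \<union> G_bad u"
    proof cases
      case 1
      then show ?thesis using z0 ve by (auto simp: G_bad_def)
    next
      case 2
      then show ?thesis using z0 ve z by (auto simp: N_bad_def nbr_def)
    next
      case 3
      then have "e \<inter> B \<noteq> {}" using z(2) unfolding B_def by blast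
      then show ?thesis using z0 ve by (auto simp: E_def)
    next
      case 4
      then show ?thesis using z0 ve by (auto simp: D_def)
    qed
  qed
  have fin: "finite D" "finite E" "finite (N_bad u)" "finite (G_bad u)"
    using finite_Z by (auto simp: D_def E_def N_bad_def G_bad_def intro: rev_finite_subset[of Z])
  have "Zdeg u \<le> card (((D \<union> E) \<union> N_bad u) \<union> G_bad u)" unfolding Zdeg_def
    by (rule card_mono[OF _ sub]) (use fin in auto)
  also have "\<dots> \<le> card ((D \<union> E) \<union> N_bad u) + card (G_bad u)" by (rule card_Un_le)
  also have "card ((D \<union> E) \<union> N_bad u) \<le> card (D \<union> E) + card (N_bad u)" by (rule card_Un_le)
  also have "card (D \<union> E) \<le> card D + card E" by (rule card_Un_le)
  finally show ?thesis using cD cE card_N_bad[of u] card_G_bad[OF assms(1)]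
    by (simp add: algebra_simps)
qed

text \<open>Both bounds use the crossing property. For the second, the parts are restricted to
  \<open>R v\<close>: a link set with a vertex \<open>u\<close> outside \<open>R v\<close> also
  contains a vertex blocking \<open>{v, u}\<close>, which leaves at most
  \<open>T0 * card V ^ p\<close> of them. It yields the loss at a poor vertex of
  \<open>S\<close>.\<close>

lemma card_link_le:
  assumes "v \<in> S" "\<And>e. (v, e) \<in> Z \<Longrightarrow> e \<in> crossing {..<k} A (p + 1)"
    and A: "\<And>j. j < k \<Longrightarrow> A j \<subseteq> V" "\<And>i j. i < k \<Longrightarrow> j < k \<Longrightarrow> i \<noteq> j \<Longrightarrow> A i \<inter> A j = {}"
  shows "card {e. (v, e) \<in> Z} \<le> turan_count (p + 1) (card V) k"
    and "card {e. (v, e) \<in> Z} \<le> turan_count (p + 1) (card (R v)) k + T0 * card V ^ p"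
proof -
  have "card {e. (v, e) \<in> Z} \<le> card (crossing {..<k} A (p + 1))"
    using assms(2) card_crossing_le_turan_count(1)[where A=A and W=V, OF k_pos A fin_V, where q = "p + 1"] by (intro card_mono) auto
  then show "card {e. (v, e) \<in> Z} \<le> turan_count (p + 1) (card V) k"
    using card_crossing_le_turan_count(2)[where A=A and W=V, OF k_pos A fin_V, where q = "p + 1"] by linarith
  define A' where "A' = (\<lambda>j. A j \<inter> R v)"
  have A': "\<And>j. j < k \<Longrightarrow> A' j \<subseteq> R v" "\<And>i j. i < k \<Longrightarrow> j < k \<Longrightarrow> i \<noteq> j \<Longrightarrow> A' i \<inter> A' j = {}"
    using A(2) unfolding A'_def by blast+
  define Q where "Q = (\<Union>u\<in>V - R v. \<Union>t\<in>blk {v, u} \<inter> V. sup_sets {u, t})"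
  have nf: "v \<noteq> u" "\<not> flex v u" if "u \<in> V - R v" for u using that assms(1) S_V by (auto simp: R_def)
  have fQ: "finite Q" unfolding Q_def using fin_V card_blk_Int(1)[OF nf] finite_sup_sets by auto
  have "card Q \<le> card V * (T0 * card V ^ (p - 1))" unfolding Q_def
  proof (rule card_UN_le_mult)
    show "finite (V - R v)" "card (V - R v) \<le> card V" using fin_V by (auto simp: card_mono)
    fix u assume u: "u \<in> V - R v"
    show "card (\<Union>t\<in>blk {v, u} \<inter> V. sup_sets {u, t}) \<le> T0 * card V ^ (p - 1)"
    proof (rule card_UN_le_mult)
      show "finite (blk {v, u} \<inter> V)" "card (blk {v, u} \<inter> V) \<le> T0" using card_blk_Int[OF nf[OF u]] by auto
      fix t assume "t \<in> blk {v, u} \<inter> V"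
      then have "u \<noteq> t" using blk_fin(4)[OF nf[OF u]] by blast
      then show "card (sup_sets {u, t}) \<le> card V ^ (p - 1)" by (rule card_sup_sets_2)
    qed
  qed
  also have "\<dots> = T0 * (card V * card V ^ (p - 1))" by (simp only: ac_simps)
  also have "\<dots> = T0 * card V ^ p" unfolding N_mult_N_pow ..
  finally have cQ: "card Q \<le> T0 * card V ^ p" .
  have "{e. (v, e) \<in> Z} \<subseteq> crossing {..<k} A' (p + 1) \<union> Q"
  proof
    fix e assume "e \<in> {e. (v, e) \<in> Z}"
    then have e: "(v, e) \<in> Z" by simp
    note z = ZD[OF e]
    show "e \<in> crossing {..<k} A' (p + 1) \<union> Q"
    proof (cases "e \<subseteq> R v")
      case True
      have c: "e \<subseteq> (\<Union>j<k. A j)" "card e = p + 1" "\<And>j. j < k \<Longrightarrow> card (e \<inter> A j) \<le> 1"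
        using assms(2)[OF e] unfolding crossing_def by auto
      have "e \<inter> A' j = e \<inter> A j" for j using True unfolding A'_def by blast
      moreover have "e \<subseteq> (\<Union>j<k. A' j)" using c(1) True unfolding A'_def by blast
      ultimately show ?thesis using c unfolding crossing_def by simp
    next
      case False
      then obtain u where u: "u \<in> e" "u \<in> V - R v" using z(2) by blast
      obtain t where "t \<in> blk {v, u}" "t \<in> insert v e" "t \<noteq> v"
        using blk_hit[OF e, of v u] u nf[OF u(2)] by blast
      then have "e \<in> Q" unfolding Q_def sup_sets_def using u z by blast
      then show ?thesis by blast
    qed
  qed
  then have "card {e. (v, e) \<in> Z} \<le> card (crossing {..<k} A' (p + 1) \<union> Q)"
    using card_crossing_le_turan_count(1)[where A=A' and W="R v", OF k_pos A' finite_R, where q = "p + 1"] fQ by (intro card_mono) auto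
  also have "\<dots> \<le> card (crossing {..<k} A' (p + 1)) + card Q" by (rule card_Un_le)
  finally show "card {e. (v, e) \<in> Z} \<le> turan_count (p + 1) (card (R v)) k + T0 * card V ^ p"
    using card_crossing_le_turan_count(2)[where A=A' and W="R v", OF k_pos A' finite_R, where q = "p + 1"] cQ by linarith
qed

end

section \<open>Dense graphs without a large clique\<close>

text \<open>Each chosen vertex removes at most \<open>b\<close> candidates from every other part, so
  more than \<open>card J * b\<close> candidates per part suffice.\<close>

lemma transversal_clique:
  fixes b :: real
  assumes "finite J" and b: "0 \<le> b" and fin: "\<And>j. j \<in> J \<Longrightarrow> finite (A j)"
    and miss: "\<And>i j x. i \<in> J \<Longrightarrow> j \<in> J \<Longrightarrow> i \<noteq> j \<Longrightarrow> x \<in> A i \<Longrightarrow> card (A j - {y. adj x y}) \<le> b"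
    and sym: "\<And>x y. adj x y \<Longrightarrow> adj y x"
    and "\<And>j. j \<in> J \<Longrightarrow> D j \<subseteq> A j" "\<And>j. j \<in> J \<Longrightarrow> real (card J) * b < card (D j)"
  shows "\<exists>w. (\<forall>j\<in>J. w j \<in> D j) \<and> (\<forall>i\<in>J. \<forall>j\<in>J. i \<noteq> j \<longrightarrow> adj (w i) (w j))"
  using assms(1,3,4,6,7)
proof (induction J arbitrary: D rule: finite_induct)
  case empty
  then show ?case by simp
next
  case (insert i J)
  have fD: "finite (D j)" if "j \<in> insert i J" for j
    using insert.prems(1,3)[OF that] finite_subset by blast
  have "0 \<le> real (card (insert i J)) * b" using b by simp
  also have "\<dots> < card (D i)" using insert.prems(4)[of i] by simp
  finally have "0 < card (D i)" by simp
  then have "D i \<noteq> {}" by auto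
  then obtain x where x: "x \<in> D i" by blast
  define D' where "D' = (\<lambda>j. D j \<inter> {y. adj x y})"
  have "\<exists>w. (\<forall>j\<in>J. w j \<in> D' j) \<and> (\<forall>i\<in>J. \<forall>j\<in>J. i \<noteq> j \<longrightarrow> adj (w i) (w j))"
  proof (rule insert.IH)
    fix j assume j: "j \<in> J"
    then have ji: "j \<in> insert i J" "i \<noteq> j" using insert.hyps by auto
    show "finite (A j)" using insert.prems(1) ji by blast
    show "D' j \<subseteq> A j" using insert.prems(3)[OF ji(1)] by (auto simp: D'_def)
    have "card (D j) = card (D' j) + card (D j - {y. adj x y})"
      unfolding D'_def using card_Int_Diff[OF fD[OF ji(1)]] .
    moreover have "card (D j - {y. adj x y}) \<le> card (A j - {y. adj x y})"
      using insert.prems(1)[OF ji(1)] insert.prems(3)[OF ji(1)] by (intro card_mono) auto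
    moreover have "card (A j - {y. adj x y}) \<le> b"
      using insert.prems(2)[of i j x] insert.prems(3)[of i] ji x by blast
    moreover have "real (card (insert i J)) * b < card (D j)" using insert.prems(4)[OF ji(1)] .
    moreover have "real (card (insert i J)) * b = real (card J) * b + b"
      using insert.hyps by (simp add: algebra_simps)
    ultimately show "real (card J) * b < card (D' j)" by linarith
  next
    fix i' j x' assume "i' \<in> J" "j \<in> J" "i' \<noteq> j" "x' \<in> A i'"
    then show "card (A j - {y. adj x' y}) \<le> b" using insert.prems(2)[of i' j x'] by blast
  qed
  then obtain w where w: "\<And>j. j \<in> J \<Longrightarrow> w j \<in> D' j" "\<And>i j. i \<in> J \<Longrightarrow> j \<in> J \<Longrightarrow> i \<noteq> j \<Longrightarrow> adj (w i) (w j)"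
    by blast
  show ?case
  proof (intro exI[of _ "w(i := x)"] conjI ballI impI)
    fix j assume "j \<in> insert i J"
    then show "(w(i := x)) j \<in> D j" using w(1)[of j] x by (auto simp: D'_def)
  next
    fix a c assume ac: "a \<in> insert i J" "c \<in> insert i J" "a \<noteq> c"
    have xi: "adj x (w j)" if "j \<in> J" for j using w(1)[OF that] by (simp add: D'_def)
    consider "a = i" "c \<in> J" "c \<noteq> i" | "c = i" "a \<in> J" "a \<noteq> i" | "a \<in> J" "c \<in> J" "a \<noteq> i" "c \<noteq> i"
      using ac by blast
    then show "adj ((w(i := x)) a) ((w(i := x)) c)"
    proof cases
      case 1
      then show ?thesis using xi[of c] by simp
    next
      case 2
      then show ?thesis using xi[of a] sym by simp
    next
      case 3
      then show ?thesis using w(2)[of a c] ac(3) by simp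
    qed
  qed
qed

text \<open>A \<open>k\<close>-clique \<open>D\<close> inside \<open>Y\<close> serves as a skeleton:
  a vertex goes to part \<open>i\<close> if it is adjacent to all clique vertices except possibly
  the \<open>i\<close>-th. By freeness each vertex of \<open>Y\<close> misses at least one clique
  vertex, and by the degree condition the \<open>k\<close> non-neighbourhoods have total size close
  to \<open>card V\<close>, so few vertices miss two.\<close>

lemma dense_clique_free_partition:
  fixes e :: real and k :: nat
  assumes fin: "finite V" and Y: "Y \<subseteq> V" and k: "0 < k" and e: "0 \<le> e" "e * k < 1 / k" and ne: "V \<noteq> {}"
    and sym: "\<And>x y. adj x y \<Longrightarrow> adj y x" and irr: "\<And>x. \<not> adj x x"
    and VY: "card (V - Y) \<le> e * card V"
    and deg: "\<And>u. u \<in> Y \<Longrightarrow> (1 - 1 / k - e) * card V \<le> card {y \<in> V. adj u y}"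
    and free: "\<And>c. c \<subseteq> Y \<Longrightarrow> clique adj c \<Longrightarrow> card c \<noteq> Suc k"
  shows "\<exists>A. (\<forall>i<k. A i \<subseteq> Y) \<and> (\<forall>i<k. \<forall>j<k. i \<noteq> j \<longrightarrow> A i \<inter> A j = {}) \<and>
     card (V - (\<Union>i<k. A i)) \<le> 4 * real k * e * card V \<and>
     (\<forall>i<k. (1 / k - 4 * real k * e) * card V \<le> card (A i) \<and> card (A i) \<le> (1 / k + 4 * real k * e) * card V) \<and>
     (\<forall>i<k. \<forall>j<k. i \<noteq> j \<longrightarrow> (\<forall>x\<in>A i. card (A j - {y. adj x y}) \<le> 4 * real k * e * card V))"
proof -
  define N where "N = real (card V)"
  have N: "0 < N" using fin ne by (simp add: N_def card_gt_0_iff)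
  define n where "n = (\<lambda>u. {y \<in> V. \<not> adj u y})"
  have fn: "finite (n u)" for u using fin by (simp add: n_def)
  have cn: "card (n u) \<le> (1 / k + e) * N" if "u \<in> Y" for u
  proof -
    have "V = {y \<in> V. adj u y} \<union> n u" by (auto simp: n_def)
    then have "card V = card {y \<in> V. adj u y} + card (n u)"
      using fin by (metis (no_types, lifting) card_Un_disjoint disjoint_iff finite_Un mem_Collect_eq n_def)
    then show ?thesis using deg[OF that] unfolding N_def by (simp add: algebra_simps)
  qed
  have fY: "finite Y" using Y fin finite_subset by blast
  have cY: "card Y \<ge> (1 - e) * N"
  proof -
    have "card V = card Y + card (V - Y)" using fin Y by (simp add: card_Diff_subset card_mono fY)
    then show ?thesis using VY unfolding N_def by (simp add: algebra_simps)
  qed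
  have "j \<le> k \<Longrightarrow> \<exists>D. D \<subseteq> Y \<and> clique adj D \<and> card D = j" for j
  proof (induction j)
    case 0
    then show ?case by (intro exI[of _ "{}"]) (simp add: clique_def)
  next
    case (Suc j)
    then obtain D where D: "D \<subseteq> Y" "clique adj D" "card D = j" by auto
    have fD: "finite D" using D(1) fY finite_subset by blast
    have "card (\<Union>u\<in>D. n u) \<le> (\<Sum>u\<in>D. card (n u))" by (rule card_UN_le[OF fD])
    then have "real (card (\<Union>u\<in>D. n u)) \<le> (\<Sum>u\<in>D. real (card (n u)))"
      by (metis of_nat_le_iff of_nat_sum)
    also have "\<dots> \<le> of_nat (card D) * ((1 / k + e) * N)"
      by (rule sum_bounded_above) (use cn D(1) in blast)
    also have "\<dots> \<le> real (k - 1) * ((1 / k + e) * N)"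
      using D(3) Suc.prems e N by (intro mult_right_mono) auto
    also have "\<dots> = (k - 1) * (1 / k) * N + (k - 1) * e * N" by (simp add: algebra_simps)
    \<comment> \<open>The hypothesis \<open>e * k < 1 / k\<close> is exactly what keeps
      \<open>k - 1\<close> non-neighbourhoods from covering \<open>Y\<close>.\<close>
    also have "\<dots> < (1 - e) * N"
    proof -
      have "(real k - 1) * (1 / k) = 1 - 1 / k" using k by (simp add: field_simps)
      then have "(real k - 1) * (1 / k) + (real k - 1) * e < 1 - e" using e(2) by (simp add: algebra_simps)
      then have "((real k - 1) * (1 / k) + (real k - 1) * e) * N < (1 - e) * N" using N by simp
      then show ?thesis using k by (simp add: algebra_simps of_nat_diff)
    qed
    finally have "card (\<Union>u\<in>D. n u) < card Y" using cY by linarith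
    then have "\<not> Y \<subseteq> (\<Union>u\<in>D. n u)" using fD fn by (meson card_mono finite_UN_I leD)
    then obtain y where y: "y \<in> Y" "\<And>u. u \<in> D \<Longrightarrow> y \<notin> n u" by blast
    have ay: "adj u y" if "u \<in> D" for u using y(2)[OF that] y(1) Y by (auto simp: n_def)
    then have "y \<notin> D" using irr by blast
    then have "card (insert y D) = Suc j" using D fD by simp
    moreover have "clique adj (insert y D)" using D(2) ay sym unfolding clique_def by blast
    ultimately show ?case using D(1) y(1) by (intro exI[of _ "insert y D"]) simp
  qed
  then obtain D where D: "D \<subseteq> Y" "clique adj D" "card D = k" by blast
  have fD: "finite D" using D(1) fY finite_subset by blast
  obtain f where f: "bij_betw f {..<k} D"
    using ex_bij_betw_nat_finite[OF fD] D(3) by (metis atLeast0LessThan)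
  have fD': "f j \<in> D" if "j < k" for j using f that by (auto simp: bij_betw_def)
  have fY': "f j \<in> Y" if "j < k" for j using fD'[OF that] D by blast
  have finj: "f i \<noteq> f j" if "i < k" "j < k" "i \<noteq> j" for i j using f that by (auto simp: bij_betw_def inj_on_def)
  have fadj: "adj (f i) (f j)" if "i < k" "j < k" "i \<noteq> j" for i j
    using D(2) fD'[of i] fD'[of j] finj[of i j] that unfolding clique_def by blast
  define A where "A = (\<lambda>i. {x \<in> Y. \<forall>j<k. j \<noteq> i \<longrightarrow> adj (f j) x})"
  have missed: "\<exists>j<k. \<not> adj (f j) x" if "x \<in> Y" for x
  proof (rule ccontr)
    assume "\<not> ?thesis"
    then have a: "\<And>j. j < k \<Longrightarrow> adj (f j) x" by blast
    then have a': "adj u x" if "u \<in> D" for u using f that by (auto simp: bij_betw_def)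
    then have "x \<notin> D" using irr by blast
    moreover have "clique adj (insert x D)" using D(2) a' sym unfolding clique_def by blast
    ultimately show False using free[of "insert x D"] D fD that by simp
  qed
  have AY: "A i \<subseteq> Y" for i by (auto simp: A_def)
  have Adisj: "A i \<inter> A j = {}" if "i < k" "j < k" "i \<noteq> j" for i j
    using missed that unfolding A_def by blast
  have fA: "finite (A i)" for i using AY fY finite_subset by blast
  \<comment> \<open>Two adjacent vertices of \<open>A i\<close> would form a
    \<open>(k + 1)\<close>-clique with the \<open>k - 1\<close> clique vertices other than the
    \<open>i\<close>-th.\<close>
  have indep: "\<not> adj x y" if "i < k" "x \<in> A i" "y \<in> A i" for i x y
  proof
    assume xy: "adj x y"
    have c: "x \<in> Y" "y \<in> Y" "\<And>j. j < k \<Longrightarrow> j \<noteq> i \<Longrightarrow> adj (f j) x" "\<And>j. j < k \<Longrightarrow> j \<noteq> i \<Longrightarrow> adj (f j) y"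
      using that by (auto simp: A_def)
    define E where "E = f ` ({..<k} - {i})"
    have E: "card E = k - 1" "finite E" "E \<subseteq> D"
      unfolding E_def using f that(1) by (auto simp: bij_betw_def card_image inj_on_diff)
    have cx: "adj u x" "adj u y" if "u \<in> E" for u using that c by (auto simp: E_def)
    have "x \<noteq> y" "x \<notin> E" "y \<notin> E" using xy irr cx by blast+
    then have "card (insert x (insert y E)) = Suc k" using E k by simp
    moreover have "clique adj (insert x (insert y E))"
      using clique_subset[OF D(2) E(3)] cx sym xy unfolding clique_def by blast
    moreover have "insert x (insert y E) \<subseteq> Y" using c E D by blast
    ultimately show False using free by blast
  qed
  have An: "A i \<subseteq> n x" if "i < k" "x \<in> A i" for i x
    using indep[OF that(1) that(2)] AY Y unfolding n_def by blast
  have upper: "card (A i) \<le> (1 / k + e) * N" if i: "i < k" for i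
  proof (cases "A i = {}")
    case True
    then show ?thesis using e N by simp
  next
    case False
    then obtain x where x: "x \<in> A i" by blast
    have "card (A i) \<le> card (n x)" by (rule card_mono[OF fn An[OF i x]])
    then show ?thesis using cn[of x] AY x by fastforce
  qed
  define B where "B = Y - (\<Union>i<k. A i)"
  have B2: "2 \<le> card {j. j < k \<and> x \<in> n (f j)}" if x: "x \<in> B" for x
  proof -
    have xY: "x \<in> Y" using x by (simp add: B_def)
    then obtain i where i: "i < k" "\<not> adj (f i) x" using missed by blast
    have "x \<notin> A i" using x i by (auto simp: B_def)
    then obtain j where j: "j < k" "j \<noteq> i" "\<not> adj (f j) x" using xY by (auto simp: A_def)
    have "{i, j} \<subseteq> {j. j < k \<and> x \<in> n (f j)}" using i j xY Y by (auto simp: n_def)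
    then have "card {i, j} \<le> card {j. j < k \<and> x \<in> n (f j)}" by (intro card_mono) auto
    then show ?thesis using j by simp
  qed
  have B1: "1 \<le> card {j. j < k \<and> x \<in> n (f j)}" if x: "x \<in> Y" for x
  proof -
    obtain i where i: "i < k" "\<not> adj (f i) x" using missed x by blast
    then have "{i} \<subseteq> {j. j < k \<and> x \<in> n (f j)}" using x Y by (auto simp: n_def)
    then have "card {i} \<le> card {j. j < k \<and> x \<in> n (f j)}" by (intro card_mono) auto
    then show ?thesis by simp
  qed
  have BY: "B \<subseteq> Y" by (auto simp: B_def)
  \<comment> \<open>Incidences between a vertex of \<open>Y\<close> and the clique vertices it
    misses: every vertex has at least one, those of \<open>B\<close> at least two.\<close>
  have "card Y + card B \<le> (\<Sum>x\<in>Y. card {j. j < k \<and> x \<in> n (f j)})"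
  proof -
    have "(\<Sum>x\<in>Y. if x \<in> B then 1 else 0) = card B"
      using fY BY by (simp add: sum.If_cases Int_absorb1)
    then have "card Y + card B = (\<Sum>x\<in>Y. 1 + (if x \<in> B then 1 else 0))"
      unfolding sum.distrib by simp
    also have "\<dots> \<le> (\<Sum>x\<in>Y. card {j. j < k \<and> x \<in> n (f j)})"
    proof (rule sum_mono)
      fix x assume "x \<in> Y"
      then show "1 + (if x \<in> B then 1 else 0) \<le> card {j. j < k \<and> x \<in> n (f j)}"
        using B1[of x] B2[of x] by (cases "x \<in> B") simp_all
    qed
    finally show ?thesis .
  qed
  also have "\<dots> = (\<Sum>j<k. card {x \<in> Y. x \<in> n (f j)})"
    using sum_multicount_gen[of "{..<k}" Y "\<lambda>j x. x \<in> n (f j)" "\<lambda>x. card {j. j < k \<and> x \<in> n (f j)}"] fY by simp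
  also have "\<dots> \<le> (\<Sum>j<k. card (n (f j)))"
    by (rule sum_mono, rule card_mono) (use fn in auto)
  finally have "real (card Y + card B) \<le> (\<Sum>j<k. real (card (n (f j))))"
    by (metis of_nat_le_iff of_nat_sum)
  also have "\<dots> \<le> of_nat (card {..<k}) * ((1 / k + e) * N)"
    by (rule sum_bounded_above) (use cn fY' in auto)
  also have "\<dots> = N + k * e * N" using k by (simp add: algebra_simps)
  finally have cB: "card B \<le> (k + 1) * e * N" using cY by (simp add: algebra_simps)
  have "V - (\<Union>i<k. A i) \<subseteq> (V - Y) \<union> B" by (auto simp: B_def)
  then have "card (V - (\<Union>i<k. A i)) \<le> card ((V - Y) \<union> B)"
    using fin fY by (intro card_mono) (auto simp: B_def)
  also have "\<dots> \<le> card (V - Y) + card B" by (rule card_Un_le)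
  finally have rest: "card (V - (\<Union>i<k. A i)) \<le> (k + 2) * e * N"
    using cB VY unfolding N_def by (simp add: algebra_simps)
  \<comment> \<open>The other parts and the leftover vertices are bounded from above, which leaves
    enough for \<open>A i\<close>.\<close>
  have lower: "(1 / k - (2 * k + 1) * e) * N \<le> card (A i)" if i: "i < k" for i
  proof -
    have AV: "(\<Union>i<k. A i) \<subseteq> V" using AY Y by blast
    have "card V = card (\<Union>i<k. A i) + card (V - (\<Union>i<k. A i))"
      using fin AV by (simp add: card_Diff_subset card_mono finite_subset)
    moreover have "card (\<Union>i<k. A i) \<le> (\<Sum>i<k. card (A i))" by (rule card_UN_le) simp
    moreover have "(\<Sum>i<k. card (A i)) = card (A i) + (\<Sum>j\<in>{..<k} - {i}. card (A j))"
      by (rule sum.remove) (use i in auto)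
    ultimately have "card V \<le> card (A i) + (\<Sum>j\<in>{..<k} - {i}. card (A j)) + card (V - (\<Union>i<k. A i))"
      by linarith
    then have "N \<le> card (A i) + (\<Sum>j\<in>{..<k} - {i}. real (card (A j))) + card (V - (\<Union>i<k. A i))"
      unfolding N_def by (metis of_nat_add of_nat_le_iff of_nat_sum)
    also have "(\<Sum>j\<in>{..<k} - {i}. real (card (A j))) \<le> of_nat (card ({..<k} - {i})) * ((1 / k + e) * N)"
      by (rule sum_bounded_above) (use upper in auto)
    also have "\<dots> = (real k - 1) * ((1 / k + e) * N)" using i by (simp add: of_nat_diff)
    finally have "N \<le> card (A i) + (real k - 1) * ((1 / k + e) * N) + (k + 2) * e * N"
      using rest by linarith
    moreover have "(real k - 1) * ((1 / k + e) * N) = N - 1 / k * N + (real k - 1) * e * N"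
      using k by (simp add: field_simps)
    ultimately show ?thesis by (simp add: algebra_simps)
  qed
  have k1: "real k \<ge> 1" using k by simp
  have ke: "(2 * k + 2) * e \<le> 4 * real k * e" using e(1) k1 by (intro mult_right_mono) auto
  then have keN: "(2 * k + 2) * e * N \<le> 4 * real k * e * N" by (rule mult_right_mono) (use N in simp)
  show ?thesis unfolding N_def[symmetric]
  proof (intro exI[of _ A] conjI allI impI ballI)
    have "(real k + 2) * e \<le> (2 * k + 2) * e" using e(1) by (intro mult_right_mono) auto
    then have "(real k + 2) * e * N \<le> (2 * k + 2) * e * N" by (rule mult_right_mono) (use N in simp)
    then have "(k + 2) * e * N \<le> (2 * k + 2) * e * N" by (simp add: algebra_simps)
    then show "card (V - (\<Union>i<k. A i)) \<le> 4 * real k * e * N" using rest keN by linarith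
  next
    fix i assume i: "i < k"
    have "(2 * k + 1) * e \<le> 4 * real k * e" using ke e(1) by (simp add: algebra_simps)
    then have "1 / k - 4 * real k * e \<le> 1 / k - (2 * k + 1) * e" by linarith
    then have "(1 / k - 4 * real k * e) * N \<le> (1 / k - (2 * k + 1) * e) * N" by (rule mult_right_mono) (use N in simp)
    then show "(1 / k - 4 * real k * e) * N \<le> card (A i)" using lower[OF i] by linarith
    have "e \<le> 4 * real k * e" using e(1) k1 by (simp add: mult_le_cancel_right1)
    then have "1 / k + e \<le> 1 / k + 4 * real k * e" by linarith
    then have "(1 / k + e) * N \<le> (1 / k + 4 * real k * e) * N" by (rule mult_right_mono) (use N in simp)
    then show "card (A i) \<le> (1 / k + 4 * real k * e) * N" using upper[OF i] by linarith
  next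
    fix i j x assume ij: "i < k" "j < k" "i \<noteq> j" and x: "x \<in> A i"
    \<comment> \<open>\<open>A i\<close> already fills nearly all of the non-neighbourhood of
      \<open>x\<close>, so little of it is left for \<open>A j\<close>.\<close>
    have "A j - {y. adj x y} \<subseteq> n x - A i" using AY Y Adisj[OF ij] by (auto simp: n_def)
    then have "card (A j - {y. adj x y}) \<le> card (n x - A i)" using fn by (intro card_mono) auto
    also have "\<dots> = card (n x) - card (A i)" using An[OF ij(1) x] fA by (intro card_Diff_subset) auto
    finally have "card (A j - {y. adj x y}) + card (A i) \<le> card (n x)"
      using card_mono[OF fn An[OF ij(1) x]] by linarith
    then have "real (card (A j - {y. adj x y})) \<le> real (card (n x)) - card (A i)" by linarith
    also have "\<dots> \<le> (1 / k + e) * N - (1 / k - (2 * k + 1) * e) * N"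
      using cn[of x] AY x lower[OF ij(1)] by fastforce
    also have "\<dots> = (2 * k + 2) * e * N" by (simp add: algebra_simps)
    finally show "card (A j - {y. adj x y}) \<le> 4 * real k * e * N" using keN by linarith
  qed (use AY Adisj in auto)
qed

section \<open>Analytic estimates for Turan counts\<close>

lemma power_add_le:
  fixes x h :: real
  assumes "0 \<le> x" "0 \<le> h" "x + h \<le> 1"
  shows "(x + h) ^ p \<le> x ^ p + p * h"
proof (induction p)
  case (Suc p)
  have "(x + h) ^ Suc p \<le> (x + h) * (x ^ p + p * h)"
    using Suc assms by (simp add: mult_left_mono)
  also have "\<dots> = x ^ Suc p + h * x ^ p + (p * h) * (x + h)" by (simp add: algebra_simps)
  also have "h * x ^ p \<le> h * 1" using assms by (intro mult_left_mono power_le_one) auto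
  also have "(p * h) * (x + h) \<le> (p * h) * 1" using assms by (intro mult_left_mono) auto
  finally show ?case by (simp add: algebra_simps)
qed simp

lemma turan_count_gap:
  fixes ep :: real
  assumes k: "0 < k" and q: "0 < q" "q \<le> k" and ep: "0 < ep" "ep \<le> 1"
  shows "\<exists>\<theta>>0. \<exists>N0. \<forall>N\<ge>N0. \<forall>x. x \<le> (1 - ep) * real N \<longrightarrow>
    turan_count q x k + \<theta> * real N ^ q \<le> turan_count q N k"
proof -
  define C where "C = real (k choose q)"
  have C: "1 \<le> C" using q binomial_eq_0_iff[of k q] unfolding C_def by (simp add: Suc_leI)
  \<comment> \<open>\<open>b\<close> and \<open>a\<close> lie strictly between
    \<open>(1 - ep) / k\<close> and \<open>1 / k\<close>; the margins \<open>ep / 4\<close> absorb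
    the rounding errors of the crude upper and lower bounds for Turan counts.\<close>
  define a where "a = (1 - ep / 4) / k"
  define b where "b = (1 - 3 * ep / 4) / k"
  define \<theta> where "\<theta> = C * (a ^ q - b ^ q)"
  have ab: "0 \<le> b" "b < a" using ep k by (auto simp: a_def b_def divide_strict_right_mono)
  then have "b ^ q < a ^ q" using q by (intro power_strict_mono) auto
  then have th: "0 < \<theta>" using C by (simp add: \<theta>_def)
  define N0 where "N0 = nat \<lceil>4 * k / ep\<rceil>"
  show ?thesis
  proof (intro exI[of _ \<theta>] exI[of _ N0] conjI allI impI th)
    fix N x :: nat assume N: "N0 \<le> N" and x: "x \<le> (1 - ep) * real N"
    have "4 * k / ep \<le> N" using N unfolding N0_def by linarith
    then have kN: "real k \<le> ep / 4 * N" using ep by (simp add: field_simps)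
    have "real (turan_count q x k) \<le> C * ((real x + k) / k) ^ q" unfolding C_def by (rule turan_count_le[OF k])
    also have "\<dots> \<le> C * (b * N) ^ q"
    proof -
      have "real x + k \<le> (1 - 3 * ep / 4) * N" using x kN by (simp add: algebra_simps)
      then have "(real x + k) / k \<le> b * N" using k unfolding b_def by (simp add: divide_right_mono)
      then show ?thesis using C by (intro mult_left_mono power_mono) auto
    qed
    finally have 1: "real (turan_count q x k) \<le> C * b ^ q * N ^ q" by (simp add: power_mult_distrib)
    have "real ((k choose q) * (N div k) ^ q) \<le> real (turan_count q N k)"
      using turan_count_ge[OF k, of q N] of_nat_mono by blast
    then have "C * real (N div k) ^ q \<le> real (turan_count q N k)" by (simp add: C_def)
    moreover have "C * (a * N) ^ q \<le> C * real (N div k) ^ q"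
    proof -
      have "N = N div k * k + N mod k" by simp
      then have "real N \<le> real (N div k) * k + k"
        using mod_less_divisor[OF k, of N] by (metis add_le_cancel_left le_eq_less_or_eq of_nat_add of_nat_le_iff of_nat_mult)
      then have "(1 - ep / 4) * N \<le> real (N div k) * k" using kN by (simp add: algebra_simps)
      then have "a * N \<le> real (N div k)" using k unfolding a_def by (simp add: field_simps)
      moreover have "0 \<le> a * N" using ab by simp
      ultimately show ?thesis using C by (intro mult_left_mono power_mono) auto
    qed
    ultimately have "C * a ^ q * N ^ q \<le> real (turan_count q N k)" by (simp add: power_mult_distrib mult.assoc)
    then show "turan_count q x k + \<theta> * real N ^ q \<le> turan_count q N k"
      using 1 unfolding \<theta>_def by (simp add: algebra_simps)
  qed
qed

text \<open>\<open>N - 1\<close> appears because the step of the Turan count from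
  \<open>N - 1\<close> to \<open>N\<close> vertices is bounded through
  \<open>(N - 1) div k\<close>.\<close>

lemma eventually_floor_power:
  fixes ep :: real
  assumes k: "0 < k" and ep: "0 < ep"
  shows "\<exists>N0. \<forall>N\<ge>N0. ((1 / real k) ^ p - ep) * real N ^ p \<le> real ((N - 1) div k) ^ p"
proof -
  have "(\<lambda>N. (1 / real k - 1 / real N) ^ p) \<longlonglongrightarrow> (1 / real k - 0) ^ p"
    by (intro tendsto_intros lim_1_over_n)
  then have "\<forall>\<^sub>F N in sequentially. (1 / real k) ^ p - ep < (1 / real k - 1 / real N) ^ p"
    using ep by (intro order_tendstoD(1)[of _ "(1 / real k - 0) ^ p"]) auto
  then obtain N1 where N1: "\<And>N. N \<ge> N1 \<Longrightarrow> (1 / real k) ^ p - ep < (1 / real k - 1 / real N) ^ p"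
    unfolding eventually_sequentially by blast
  show ?thesis
  proof (intro exI[of _ "N1 + k"] allI impI)
    fix N assume N: "N1 + k \<le> N"
    then have N0: "0 < N" "k \<le> N" using k by auto
    have "((1 / real k) ^ p - ep) * real N ^ p \<le> (1 / real k - 1 / real N) ^ p * real N ^ p"
      using N1[of N] N by (intro mult_right_mono) auto
    also have "\<dots> = ((1 / real k - 1 / real N) * N) ^ p" by (simp add: power_mult_distrib)
    also have "(1 / real k - 1 / real N) * N = (real N - k) / k" using N0 k by (simp add: field_simps)
    also have "((real N - k) / k) ^ p \<le> real ((N - 1) div k) ^ p"
    proof (rule power_mono)
      have "N - 1 = (N - 1) div k * k + (N - 1) mod k" by simp
      moreover have "(N - 1) mod k < k" using k by simp
      ultimately have "N \<le> (N - 1) div k * k + k" using N0 by linarith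
      then have "real N \<le> real ((N - 1) div k) * k + k" by (metis of_nat_add of_nat_le_iff of_nat_mult)
      then show "(real N - k) / k \<le> real ((N - 1) div k)" using k by (simp add: field_simps)
      show "0 \<le> (real N - k) / k" using N0 by simp
    qed
    finally show "((1 / real k) ^ p - ep) * real N ^ p \<le> real ((N - 1) div k) ^ p" .
  qed
qed

text \<open>At \<open>x = (1 - 1 / k) * N\<close> the \<open>k - 1\<close> parts have size
  \<open>N / k\<close> and give the leading term \<open>((k - 1) choose p) / k ^ p * N ^ p\<close>.
  A count that falls short of this only slightly forces \<open>x\<close> to fall short only
  slightly.\<close>

lemma turan_count_inverse:
  fixes c ep :: real
  assumes p: "0 < p" "p < k" and ep: "0 \<le> ep" "3 * ep * real k ^ p \<le> 1" and N: "real k \<le> ep * N" "0 < N"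
    and t: "(((k - 1) choose p) / real k ^ p - 3 * ep) * N ^ p \<le> turan_count p x (k - 1)"
  shows "(1 - 1 / k - 4 * real k ^ p * ep) * N \<le> x"
proof -
  have k: "0 < k - 1" "1 < real k" using p by auto
  define C where "C = real ((k - 1) choose p)"
  have C: "1 \<le> C" using p binomial_eq_0_iff[of "k - 1" p] unfolding C_def by (simp add: Suc_leI)
  \<comment> \<open>The part size relative to \<open>N / k\<close>, including the rounding term of
    the upper bound.\<close>
  define y where "y = (real x + real (k - 1)) / real (k - 1) * (k / N)"
  have y0: "0 \<le> y" using N by (simp add: y_def)
  have yk: "(real x + real (k - 1)) / real (k - 1) = y * (N / k)" using N k by (simp add: y_def)
  have "(C / real k ^ p - 3 * ep) * N ^ p \<le> C * (y * (N / k)) ^ p"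
    using t turan_count_le[OF k(1), of p x] unfolding C_def[symmetric] yk by linarith
  also have "\<dots> = C * y ^ p / k ^ p * N ^ p" by (simp add: power_mult_distrib power_divide)
  finally have "(C / real k ^ p - 3 * ep) * N ^ p \<le> C * y ^ p / k ^ p * N ^ p" .
  then have "C / real k ^ p - 3 * ep \<le> C * y ^ p / k ^ p"
    by (rule mult_right_le_imp_le) (use N in simp)
  then have "(C / real k ^ p - 3 * ep) * k ^ p \<le> C * y ^ p / k ^ p * k ^ p"
    by (rule mult_right_mono) simp
  then have "C - 3 * ep * real k ^ p \<le> C * y ^ p" using k by (simp add: algebra_simps)
  moreover have "C * (1 - 3 * ep * real k ^ p) \<le> C - 3 * ep * real k ^ p"
  proof -
    have "1 * (3 * ep * real k ^ p) \<le> C * (3 * ep * real k ^ p)" using C ep by (intro mult_right_mono) auto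
    then show ?thesis by (simp add: algebra_simps)
  qed
  ultimately have "C * (1 - 3 * ep * real k ^ p) \<le> C * y ^ p" by linarith
  then have yp: "1 - 3 * ep * real k ^ p \<le> y ^ p" using C by simp
  \<comment> \<open>For \<open>y \<le> 1\<close> the power is at most \<open>y\<close>, so no root
    has to be taken.\<close>
  have y: "1 - 3 * ep * real k ^ p \<le> y"
  proof (cases "y \<le> 1")
    case True
    then have "y ^ p \<le> y ^ 1" using y0 p by (intro power_decreasing) auto
    then show ?thesis using yp by simp
  next
    case False
    have "0 \<le> 3 * ep * real k ^ p" using ep by simp
    then show ?thesis using False by linarith
  qed
  have xy: "real x + real (k - 1) = y * (N / k) * (k - 1)" using yk k by (simp add: field_simps)
  have "(1 - 3 * ep * real k ^ p) * (N / k) * (k - 1) \<le> real x + real (k - 1)"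
    unfolding xy using y N by (intro mult_right_mono) auto
  moreover have "(1 - 3 * ep * real k ^ p) * (N / k) * (k - 1) = (1 - 3 * ep * real k ^ p) * ((1 - 1 / k) * N)"
    using k by (simp add: field_simps of_nat_diff)
  ultimately have 1: "(1 - 3 * ep * real k ^ p) * ((1 - 1 / k) * N) \<le> real x + real (k - 1)" by linarith
  have "3 * ep * real k ^ p * ((1 - 1 / k) * N) \<le> 3 * ep * real k ^ p * N"
    using N ep k by (intro mult_left_mono) (auto simp: mult_le_cancel_right2)
  moreover have "real (k - 1) \<le> ep * real k ^ p * N"
  proof -
    have "1 \<le> real k ^ p" using k by simp
    then have "ep * 1 * N \<le> ep * real k ^ p * N" using ep N by (intro mult_right_mono mult_left_mono) auto
    then show ?thesis using N k by simp
  qed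
  moreover have "(1 - 3 * ep * real k ^ p) * ((1 - 1 / k) * N) = (1 - 1 / k) * N - 3 * ep * real k ^ p * ((1 - 1 / k) * N)"
    by (simp add: algebra_simps)
  ultimately have "(1 - 1 / k) * N - 4 * (ep * real k ^ p * N) \<le> x" using 1 by linarith
  then show ?thesis by (simp add: algebra_simps)
qed

section \<open>Partition of the vertices\<close>

text \<open>The constants \<open>ep\<close>, \<dots>, \<open>e6\<close> bound the relative errors at the successive steps: sizes of
  neighbourhoods of vertices of \<open>S\<close>, degrees in the flexible graph, the near-partition, clique counts, and the
  final assignment of vertices to parts.\<close>

locale dense_star_system = star_system H S V p k
  for H :: "'a set set" and S V :: "'a set" and p k :: nat +
  fixes ep e3 e4 e5 e6 :: real
  assumes ep_pos: "0 < ep" and e3: "e3 = 4 * real k ^ p * ep" and e4: "e4 = 4 * real k * e3"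
    and e5: "e5 = 2 ^ k * (2 * real k + 1) * e4" and e6: "e6 = 2 * real k ^ p * e5" and e6_le: "e6 \<le> 1 / (16 * real k ^ 2)"
    and large_V: "T0 \<le> ep * card V" "(p + 1) * (card S * T0) \<le> ep * card V" "k + p + 2 \<le> ep * card V"
    and large_S: "2 * T0 + 1 \<le> ep * card S" "4 \<le> card S"
    and min_degree: "\<And>u. u \<in> V \<Longrightarrow>
      (((k - 1) choose p) / real k ^ p - ep) * card S * real (card V) ^ p \<le> Zdeg u"
    and few_poor: "card {v \<in> S. card (R v) < (1 - ep) * card V} \<le> ep * card S"
begin

abbreviation N :: real where "N \<equiv> real (card V)"
abbreviation s :: real where "s \<equiv> real (card S)"
text \<open>A vertex of the balanced complete \<open>k\<close>-partite \<open>(p + 1)\<close>-graph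
  on \<open>N\<close> vertices has degree about \<open>c * N ^ p\<close>, so
  \<open>c * s * N ^ p\<close> is the expected degree of a vertex outside \<open>S\<close>.\<close>

definition c :: real where "c = ((k - 1) choose p) / real k ^ p"
definition rich :: "'a \<Rightarrow> bool" where "rich v \<longleftrightarrow> (1 - ep) * N \<le> card (R v)"

lemma k2: "2 \<le> k" using p_k p_pos by simp

lemma kp: "1 \<le> real k ^ p" using k2 by (simp add: one_le_power)

lemma eps: "0 < e3" "0 < e4" "0 < e5" "0 < e6" "ep \<le> e3" "e3 \<le> e4" "20 * e4 \<le> e5" "k * e4 \<le> e5" "e5 \<le> e6" "e6 \<le> 1 / 64"
  "k * e3 \<le> e4"
proof -
  have k2': "2 \<le> real k" using k2 by simp
  show 3: "0 < e3" unfolding e3 using ep_pos k2 by simp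
  show 4: "0 < e4" unfolding e4 using 3 k2 by simp
  have "0 < 2 ^ k * (2 * real k + 1)" by (intro mult_pos_pos) auto
  then show 5: "0 < e5" unfolding e5 using 4 by (rule mult_pos_pos)
  show "0 < e6" unfolding e6 using 5 k2 by simp
  have "1 * ep \<le> (4 * real k ^ p) * ep" using kp ep_pos by (intro mult_right_mono) auto
  then show "ep \<le> e3" unfolding e3 by simp
  have "1 * e3 \<le> (4 * real k) * e3" using k2' 3 by (intro mult_right_mono) auto
  then show "e3 \<le> e4" unfolding e4 by simp
  have "(real k) * e3 \<le> (4 * real k) * e3" using k2' 3 by (intro mult_right_mono) auto
  then show "k * e3 \<le> e4" unfolding e4 by simp
  have "(2::real) ^ 2 \<le> 2 ^ k" using k2 by (intro power_increasing) auto
  then have M: "4 \<le> (2::real) ^ k" by simp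
  have "4 * 5 \<le> 2 ^ k * (2 * real k + 1)" using M k2' by (intro mult_mono) auto
  then have "(4 * 5) * e4 \<le> 2 ^ k * (2 * real k + 1) * e4" using 4 by (intro mult_right_mono) auto
  then show "20 * e4 \<le> e5" unfolding e5 by simp
  have "1 * real k \<le> 2 ^ k * (2 * real k + 1)" using M k2' by (intro mult_mono) auto
  then have "(1 * real k) * e4 \<le> 2 ^ k * (2 * real k + 1) * e4" using 4 by (intro mult_right_mono) auto
  then show "k * e4 \<le> e5" unfolding e5 by simp
  have "1 * e5 \<le> (2 * real k ^ p) * e5" using kp 5 by (intro mult_right_mono) auto
  then show "e5 \<le> e6" unfolding e6 by simp
  have k4: "(2::real) ^ 2 \<le> real k ^ 2" using k2' by (intro power_mono) auto
  have "1 / (16 * real k ^ 2) \<le> 1 / (16 * 2 ^ 2)"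
    by (rule divide_left_mono) (use k4 k2 in auto)
  then show "e6 \<le> 1 / 64" using e6_le by simp
qed

lemma e6_k: "16 * k * e6 \<le> 1 / k"
proof -
  have k2': "0 < real k" using k2 by simp
  have "16 * k * e6 \<le> 16 * k * (1 / (16 * real k ^ 2))" using e6_le by (intro mult_left_mono) auto
  also have "\<dots> = 1 / k" using k2' by (simp add: power2_eq_square)
  finally show ?thesis .
qed

lemma e6_k': "32 * e6 \<le> 1 / k"
proof -
  have "16 * 2 * e6 \<le> 16 * k * e6" using eps(4) k2 by (intro mult_right_mono) auto
  then show ?thesis using e6_k by linarith
qed

lemma choose_ge_1: "1 \<le> real ((k - 1) choose p)"
proof -
  have "p \<le> k - 1" using p_k by simp
  then have "0 < (k - 1) choose p" by simp
  then show ?thesis by linarith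
qed

lemma c_ge: "1 / real k ^ p \<le> c" unfolding c_def using choose_ge_1 kp
  by (intro divide_right_mono) auto

text \<open>Since \<open>e6\<close> carries the factor \<open>real k ^ p\<close>, its smallness
  makes \<open>e5\<close> small against \<open>1 / real k ^ p\<close>, which is a lower bound for
  \<open>c\<close>.\<close>

lemma c_e5: "7 * e5 \<le> c"
proof -
  have "2 * (real k ^ p * e5) \<le> 1 / 64" using eps(10) unfolding e6 by (simp add: mult.assoc)
  moreover have "0 \<le> real k ^ p * e5" using eps(3) by simp
  ultimately have "7 * (real k ^ p * e5) \<le> 1" by linarith
  then have "7 * e5 * real k ^ p \<le> 1" by (simp only: ac_simps)
  moreover have "0 < real k ^ p" using kp by linarith
  ultimately have "7 * e5 \<le> 1 / real k ^ p" by (simp add: pos_le_divide_eq)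
  then show ?thesis using c_ge by linarith
qed

lemma N_pos: "0 < N"
proof -
  have "0 < ep * N" using large_V(3) by linarith
  then show ?thesis using ep_pos by (simp add: zero_less_mult_iff)
qed

lemma s_pos: "0 < s" using large_S by simp

lemma N_pow: "N * N ^ (p - 1) = N ^ p"
  using p_pos by (metis Suc_diff_1 less_le_trans power_Suc zero_less_one)

lemma T0_N_pow: "s * T0 * N ^ (p - 1) \<le> ep * s * N ^ p"
proof -
  have "T0 * (s * N ^ (p - 1)) \<le> (ep * N) * (s * N ^ (p - 1))" using large_V(1) by (intro mult_right_mono) auto
  also have "\<dots> = ep * s * (N * N ^ (p - 1))" by (simp only: ac_simps)
  finally show ?thesis unfolding N_pow by (simp add: ac_simps)
qed

lemma T0_s: "(2 * T0 + 1) * N ^ p \<le> ep * s * N ^ p"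
  using large_S(1) by (intro mult_right_mono) auto

lemma min_deg: "u \<in> V \<Longrightarrow> (c - ep) * s * N ^ p \<le> Zdeg u"
  using min_degree unfolding c_def .

lemma many_flex:
  assumes "u \<in> V"
  shows "(c - 2 * ep) * s \<le> card {v \<in> S. flex v u}"
proof -
  have "(c - ep) * s * N ^ p \<le> real (card {v \<in> S. flex v u} * card V ^ p + card S * T0 * card V ^ (p - 1))"
    using min_deg[OF assms] Zdeg_le_few[OF assms] by (meson of_nat_le_iff order_trans)
  also have "\<dots> \<le> card {v \<in> S. flex v u} * N ^ p + ep * s * N ^ p" using T0_N_pow by simp
  finally have "((c - 2 * ep) * s) * N ^ p \<le> card {v \<in> S. flex v u} * N ^ p" by (simp add: algebra_simps)
  then show ?thesis by (rule mult_right_le_imp_le) (use N_pos in simp)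
qed

lemma rich_exists:
  assumes "ep * s < card P" "P \<subseteq> S"
  obtains w where "w \<in> P" "rich w"
proof -
  have "\<not> P \<subseteq> {v \<in> S. card (R v) < (1 - ep) * N}"
  proof
    assume "P \<subseteq> {v \<in> S. card (R v) < (1 - ep) * N}"
    then have "card P \<le> card {v \<in> S. card (R v) < (1 - ep) * N}" using fin_S by (intro card_mono) auto
    then show False using assms few_poor by linarith
  qed
  then show ?thesis using that assms unfolding rich_def by force
qed

lemma rich_flex:
  assumes "u \<in> V"
  obtains w where "w \<in> S" "rich w" "flex w u"
proof -
  have "3 * ep < c" using eps c_e5 by linarith
  then have "ep * s < (c - 2 * ep) * s" using s_pos by (intro mult_strict_right_mono) auto
  then have "ep * s < card {v \<in> S. flex v u}" using many_flex[OF assms] by linarith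
  then show ?thesis using rich_exists[of "{v \<in> S. flex v u}"] that by auto
qed

lemma rich_compl: "rich w \<Longrightarrow> card (V - R w) \<le> ep * N"
proof -
  assume "rich w"
  moreover have "card (V - R w) = card V - card (R w)" using R_subset finite_R by (intro card_Diff_subset) auto
  moreover have "card (R w) \<le> card V" using R_subset fin_V by (intro card_mono)
  ultimately show ?thesis unfolding rich_def by (simp add: of_nat_diff algebra_simps)
qed

text \<open>For a rich \<open>w\<close> flexible with \<open>u\<close>, the vertex \<open>u\<close>
  lies in \<open>R w\<close> and little of \<open>V\<close> is outside \<open>R w\<close>. The
  minimum degree makes the clique count in \<open>nbr u \<inter> R w\<close> nearly maximal, and
  \<open>turan_count_inverse\<close> converts this into size.\<close>

lemma nbr_large:
  assumes "u \<in> V" "typical u"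
  shows "(1 - 1 / k - e3) * N \<le> card (nbr u)"
proof -
  obtain w where w: "w \<in> S" "rich w" "flex w u" using rich_flex[OF assms(1)] .
  have u: "u \<in> R w" using w assms by (simp add: R_def)
  define t where "t = turan_count p (card (nbr u \<inter> R w)) (k - 1)"
  have "(c - ep) * s * N ^ p \<le> real (card S * t + card S * card (V - R w) * card V ^ (p - 1) + (2 * T0 + 1) * card V ^ p)"
    using min_deg[OF assms(1)] Zdeg_le_typical[OF assms(2) u w(1)] unfolding t_def by (meson of_nat_le_iff order_trans)
  also have "\<dots> = s * t + s * card (V - R w) * N ^ (p - 1) + (2 * T0 + 1) * N ^ p"
    by (simp add: algebra_simps)
  also have "s * card (V - R w) * N ^ (p - 1) \<le> s * (ep * N) * N ^ (p - 1)"
    using rich_compl[OF w(2)] by (intro mult_right_mono mult_left_mono) auto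
  also have "s * (ep * N) * N ^ (p - 1) = ep * s * N ^ p" unfolding N_pow[symmetric] by (simp only: ac_simps)
  finally have "(c - ep) * s * N ^ p \<le> s * t + ep * s * N ^ p + ep * s * N ^ p" using T0_s by linarith
  then have "((c - 3 * ep) * N ^ p) * s \<le> t * s" by (simp add: algebra_simps)
  then have "(c - 3 * ep) * N ^ p \<le> t" by (rule mult_right_le_imp_le) (use s_pos in simp)
  moreover have "3 * ep * real k ^ p \<le> 1"
  proof -
    have "e3 \<le> 1 / 64" using eps by linarith
    then have "4 * (ep * real k ^ p) \<le> 1 / 64" unfolding e3 by (simp add: ac_simps)
    moreover have "0 \<le> ep * real k ^ p" using ep_pos by simp
    ultimately have "3 * (ep * real k ^ p) \<le> 1" by linarith
    then show ?thesis by (simp only: ac_simps)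
  qed
  moreover have "real k \<le> ep * N" using large_V(3) by linarith
  ultimately have "(1 - 1 / k - 4 * real k ^ p * ep) * N \<le> card (nbr u \<inter> R w)"
    using p_pos p_k ep_pos N_pos unfolding t_def c_def by (intro turan_count_inverse) auto
  also have "card (nbr u \<inter> R w) \<le> card (nbr u)" using finite_nbr by (intro card_mono) auto
  finally show ?thesis unfolding e3 by simp
qed

text \<open>Two are needed because the vertex of \<open>S\<close> on a given hyperedge may be one of
  them; the other one then completes the forbidden clique.\<close>

lemma two_rich:
  obtains v0 v1 where "v0 \<in> S" "v1 \<in> S" "v0 \<noteq> v1" "rich v0" "rich v1"
proof -
  have epq: "ep \<le> 1 / 64" using eps by linarith
  then have "ep * s \<le> 1 / 64 * s" by (intro mult_right_mono) auto
  then have 1: "ep * s < s - 1" using large_S(2) by linarith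
  then have "ep * s < card S" by linarith
  then obtain v0 where v0: "v0 \<in> S" "rich v0" using rich_exists[of S] by blast
  have "real (card (S - {v0})) = s - 1" using v0 fin_S large_S(2) by simp
  then obtain v1 where "v1 \<in> S - {v0}" "rich v1" using rich_exists[of "S - {v0}"] 1 by auto
  then show ?thesis using that v0 by blast
qed

definition near_partition :: "(nat \<Rightarrow> 'a set) \<Rightarrow> bool" where
  "near_partition A \<longleftrightarrow> (\<forall>i<k. A i \<subseteq> V) \<and> (\<forall>i<k. \<forall>j<k. i \<noteq> j \<longrightarrow> A i \<inter> A j = {}) \<and>
     card (V - (\<Union>i<k. A i)) \<le> e4 * N \<and>
     (\<forall>i<k. (1 / k - e4) * N \<le> card (A i) \<and> card (A i) \<le> (1 / k + e4) * N) \<and>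
     (\<forall>i<k. \<forall>j<k. i \<noteq> j \<longrightarrow> (\<forall>x\<in>A i. card (A j - nbr x) \<le> e4 * N))"

lemma Diff_nbr: "A \<subseteq> V \<Longrightarrow> A - {y. flex x y} = A - nbr x"
  by (auto simp: nbr_def)

text \<open>\<open>Y\<close> omits few vertices. Its restriction to \<open>R v0\<close> excludes
  flexible \<open>(k + 1)\<close>-cliques; its restriction to both sets makes each of the two rich
  vertices flexible with every vertex of the parts.\<close>

lemma near_partition_exists:
  obtains A v0 v1 where "near_partition A" "v0 \<in> S" "v1 \<in> S" "v0 \<noteq> v1" "rich v0" "rich v1"
    "\<And>i. i < k \<Longrightarrow> A i \<subseteq> R v0 \<inter> R v1"
proof -
  obtain v0 v1 where v: "v0 \<in> S" "v1 \<in> S" "v0 \<noteq> v1" "rich v0" "rich v1" using two_rich .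
  define Y where "Y = {u \<in> V. typical u} \<inter> (R v0 \<inter> R v1)"
  have Vne: "V \<noteq> {}" using N_pos by auto
  have YV: "Y \<subseteq> V" by (auto simp: Y_def)
  have "V - Y \<subseteq> {u \<in> V. \<not> typical u} \<union> ((V - R v0) \<union> (V - R v1))" by (auto simp: Y_def)
  then have "card (V - Y) \<le> card ({u \<in> V. \<not> typical u} \<union> ((V - R v0) \<union> (V - R v1)))"
    using fin_V by (intro card_mono) auto
  also have "\<dots> \<le> card {u \<in> V. \<not> typical u} + card ((V - R v0) \<union> (V - R v1))" by (rule card_Un_le)
  also have "card ((V - R v0) \<union> (V - R v1)) \<le> card (V - R v0) + card (V - R v1)" by (rule card_Un_le)
  finally have "real (card (V - Y)) \<le> card {u \<in> V. \<not> typical u} + card (V - R v0) + card (V - R v1)" by linarith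
  moreover have "real (card {u \<in> V. \<not> typical u}) \<le> ep * N"
    using card_not_typical[OF Vne] large_V(2) by (meson of_nat_le_iff order_trans)
  ultimately have "card (V - Y) \<le> 3 * ep * N"
    using rich_compl[OF v(4)] rich_compl[OF v(5)] by linarith
  also have "\<dots> \<le> e3 * N"
  proof -
    have "3 * ep \<le> e3" unfolding e3 using kp ep_pos mult_right_mono[of 3 "4 * real k ^ p" ep] by simp
    then show ?thesis by (intro mult_right_mono) auto
  qed
  finally have VY: "card (V - Y) \<le> e3 * N" .
  have "e3 * k < 1 / k" using e6_k' eps by (simp add: mult.commute)
  moreover have "(1 - 1 / k - e3) * N \<le> card {y \<in> V. flex u y}" if "u \<in> Y" for u
    using nbr_large[of u] that unfolding nbr_def Y_def by auto
  moreover have "card c \<noteq> Suc k" if "c \<subseteq> Y" "clique flex c" for c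
    using R_clique_free[OF v(1), of c] that unfolding Y_def by auto
  ultimately have "\<exists>A. (\<forall>i<k. A i \<subseteq> Y) \<and> (\<forall>i<k. \<forall>j<k. i \<noteq> j \<longrightarrow> A i \<inter> A j = {}) \<and>
     card (V - (\<Union>i<k. A i)) \<le> 4 * real k * e3 * N \<and>
     (\<forall>i<k. (1 / k - 4 * real k * e3) * N \<le> card (A i) \<and> card (A i) \<le> (1 / k + 4 * real k * e3) * N) \<and>
     (\<forall>i<k. \<forall>j<k. i \<noteq> j \<longrightarrow> (\<forall>x\<in>A i. card (A j - {y. flex x y}) \<le> 4 * real k * e3 * N))"
    using VY eps(1) k_pos by (intro dense_clique_free_partition[OF fin_V YV _ _ _ Vne flex_sym]) (auto dest: flex_neq)
  then obtain A where A: "\<forall>i<k. A i \<subseteq> Y" "\<forall>i<k. \<forall>j<k. i \<noteq> j \<longrightarrow> A i \<inter> A j = {}"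
     "card (V - (\<Union>i<k. A i)) \<le> e4 * N"
     "\<forall>i<k. (1 / k - e4) * N \<le> card (A i) \<and> card (A i) \<le> (1 / k + e4) * N"
     "\<forall>i<k. \<forall>j<k. i \<noteq> j \<longrightarrow> (\<forall>x\<in>A i. card (A j - {y. flex x y}) \<le> e4 * N)"
    unfolding e4[symmetric] by (elim exE conjE) (rule that)
  have AV: "\<forall>i<k. A i \<subseteq> V" using A(1) YV by blast
  have "\<forall>i<k. \<forall>j<k. i \<noteq> j \<longrightarrow> (\<forall>x\<in>A i. card (A j - nbr x) \<le> e4 * N)"
    using A(5) AV by (simp add: Diff_nbr)
  then have "near_partition A" using A AV unfolding near_partition_def by blast
  moreover have "A i \<subseteq> R v0 \<inter> R v1" if "i < k" for i using A(1) that unfolding Y_def by blast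
  ultimately show ?thesis using that[OF _ v] by blast
qed

end

section \<open>Forbidden cliques from transversals of the near-partition\<close>

locale partitioned_star_system = dense_star_system H S V p k ep e3 e4 e5 e6
  for H :: "'a set set" and S V :: "'a set" and p k :: nat and ep e3 e4 e5 e6 :: real +
  fixes A :: "nat \<Rightarrow> 'a set"
  assumes A: "near_partition A"
begin

lemma A_V: "i < k \<Longrightarrow> A i \<subseteq> V" and A_disj: "i < k \<Longrightarrow> j < k \<Longrightarrow> i \<noteq> j \<Longrightarrow> A i \<inter> A j = {}"
  and A_rest: "card (V - (\<Union>i<k. A i)) \<le> e4 * N"
  and A_lower: "i < k \<Longrightarrow> (1 / k - e4) * N \<le> card (A i)" and A_upper: "i < k \<Longrightarrow> card (A i) \<le> (1 / k + e4) * N"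
  and A_miss: "i < k \<Longrightarrow> j < k \<Longrightarrow> i \<noteq> j \<Longrightarrow> x \<in> A i \<Longrightarrow> card (A j - nbr x) \<le> e4 * N"
  using A unfolding near_partition_def by blast+

lemma finite_A: "i < k \<Longrightarrow> finite (A i)"
  using A_V fin_V finite_subset by blast

lemma transversal:
  assumes J: "J \<subseteq> {..<k}" and D: "\<And>j. j \<in> J \<Longrightarrow> D j \<subseteq> A j" "\<And>j. j \<in> J \<Longrightarrow> k * e4 * N < card (D j)"
  obtains w where "\<And>j. j \<in> J \<Longrightarrow> w j \<in> D j" "\<And>i j. i \<in> J \<Longrightarrow> j \<in> J \<Longrightarrow> i \<noteq> j \<Longrightarrow> flex (w i) (w j)"
    "inj_on w J"
proof -
  have fJ: "finite J" using J finite_subset by blast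
  have cJ: "card J \<le> k" using card_mono[OF _ J] by simp
  have "\<exists>w. (\<forall>j\<in>J. w j \<in> D j) \<and> (\<forall>i\<in>J. \<forall>j\<in>J. i \<noteq> j \<longrightarrow> flex (w i) (w j))"
  proof (rule transversal_clique[OF fJ])
    show "0 \<le> e4 * N" using eps by simp
    fix i j x assume ij: "i \<in> J" "j \<in> J" "i \<noteq> j" "x \<in> A i"
    then have k: "i < k" "j < k" using J by auto
    show "card (A j - {y. flex x y}) \<le> e4 * N"
      using A_miss[OF k ij(3,4)] unfolding Diff_nbr[OF A_V[OF k(2)]] .
  next
    fix j assume j: "j \<in> J"
    have "card J * (e4 * N) \<le> k * (e4 * N)" using cJ eps by (intro mult_right_mono) auto
    then show "card J * (e4 * N) < card (D j)" using D(2)[OF j] by (simp add: mult.assoc)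
  next
    show "finite (A j)" if "j \<in> J" for j using finite_A J that by blast
  qed (use flex_sym D in auto)
  then obtain w where w: "\<And>j. j \<in> J \<Longrightarrow> w j \<in> D j" "\<And>i j. i \<in> J \<Longrightarrow> j \<in> J \<Longrightarrow> i \<noteq> j \<Longrightarrow> flex (w i) (w j)"
    by blast
  then have "inj_on w J" by (intro inj_onI) (metis flex_neq)
  then show ?thesis using that w by blast
qed

lemma card_remove3:
  assumes "finite X"
  shows "real (card X) \<le> card (X \<inter> P \<inter> Q \<inter> R' - e) + card (X - P) + card (X - Q) + card (X - R') + card (X \<inter> e)"
proof -
  have "X \<subseteq> ((((X \<inter> P \<inter> Q \<inter> R' - e) \<union> (X - P)) \<union> (X - Q)) \<union> (X - R')) \<union> (X \<inter> e)" by blast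
  then have "card X \<le> card (((((X \<inter> P \<inter> Q \<inter> R' - e) \<union> (X - P)) \<union> (X - Q)) \<union> (X - R')) \<union> (X \<inter> e))"
    using assms by (intro card_mono) auto
  also have "\<dots> \<le> card (X \<inter> P \<inter> Q \<inter> R' - e) + card (X - P) + card (X - Q) + card (X - R') + card (X \<inter> e)"
    by (intro order_trans[OF card_Un_le] add_mono order_refl card_Un_le)
  finally show ?thesis by linarith
qed

text \<open>The condition says that \<open>u\<close> can play the role of a vertex of part
  \<open>i\<close> in a transversal, so only the other parts matter.\<close>

definition attached :: "nat \<Rightarrow> 'a \<Rightarrow> bool" where
  "attached i u \<longleftrightarrow> (\<forall>j<k. j \<noteq> i \<longrightarrow> card (A j - nbr u) \<le> e6 * N)"

lemma pN: "p + 2 \<le> ep * N" using large_V(3) by linarith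

text \<open>The right side bounds from below what is left of a part after the removals in the two
  applications that follow; the left side is the threshold of \<open>transversal\<close>.\<close>

lemma size_bound: "k * e4 * N < (1 / k - e4) * N - 2 * e6 * N - 2 * (ep * N) - ep * N"
proof -
  have "k * e4 < 1 / k - e4 - 2 * e6 - 2 * ep - ep" using e6_k' eps by linarith
  then have "k * e4 * N < (1 / k - e4 - 2 * e6 - 2 * ep - ep) * N" using N_pos by (intro mult_strict_right_mono) auto
  then show ?thesis by (simp add: algebra_simps)
qed

lemma A_R_compl: "i < k \<Longrightarrow> rich w \<Longrightarrow> card (A i - R w) \<le> ep * N"
proof -
  assume a: "i < k" "rich w"
  have "card (A i - R w) \<le> card (V - R w)" using A_V[OF a(1)] fin_V by (intro card_mono) auto
  then show ?thesis using rich_compl[OF a(2)] by linarith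
qed

text \<open>The hyperedge through \<open>y\<close> and \<open>z\<close> supplies the only pair that need not be flexible in the clique formed
  by \<open>w\<close>, \<open>y\<close>, \<open>z\<close> and a transversal of the remaining parts.\<close>

lemma no_inner_pair:
  assumes e: "(v, e) \<in> Z" and yz: "y \<in> e" "z \<in> e" "y \<noteq> z" and i: "i < k" "attached i y" "attached i z"
    and w: "w \<in> S" "w \<noteq> v" "flex w y" "flex w z" "rich w"
  shows False
proof -
  note z = ZD[OF e]
  define J where "J = {..<k} - {i}"
  define D where "D = (\<lambda>j. A j \<inter> nbr y \<inter> nbr z \<inter> R w - e)"
  have J: "J \<subseteq> {..<k}" "card J = k - 1" "finite J" using i by (auto simp: J_def)
  have cD: "k * e4 * N < card (D j)" if "j \<in> J" for j
  proof -
    have j: "j < k" "j \<noteq> i" using that by (auto simp: J_def)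
    have "card (A j \<inter> e) \<le> card e" using z by (intro card_mono) auto
    then have "real (card (A j \<inter> e)) \<le> ep * N" using z(4) pN by linarith
    moreover have "card (A j - nbr y) \<le> e6 * N" "card (A j - nbr z) \<le> e6 * N"
      using i j unfolding attached_def by auto
    ultimately have "(1 / k - e4) * N \<le> card (D j) + e6 * N + e6 * N + ep * N + ep * N"
      using card_remove3[OF finite_A[OF j(1)], of "nbr y" "nbr z" "R w" e] A_lower[OF j(1)] A_R_compl[OF j(1) w(5)]
      unfolding D_def by linarith
    moreover have "0 \<le> ep * N" using ep_pos by simp
    ultimately show ?thesis using size_bound by linarith
  qed
  have "D j \<subseteq> A j" for j by (auto simp: D_def)
  then obtain x where x: "\<And>j. j \<in> J \<Longrightarrow> x j \<in> D j" "\<And>i j. i \<in> J \<Longrightarrow> j \<in> J \<Longrightarrow> i \<noteq> j \<Longrightarrow> flex (x i) (x j)"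
    "inj_on x J" using transversal[OF J(1), of D] cD by metis
  have xJ: "flex y (x j)" "flex z (x j)" "flex w (x j)" "x j \<notin> e" if "j \<in> J" for j
    using x(1)[OF that] by (auto simp: D_def nbr_def R_def)
  have yzV: "y \<in> V" "z \<in> V" using yz z by auto
  have nin: "w \<notin> x ` J" "y \<notin> x ` J" "z \<notin> x ` J" using xJ flex_neq yz by blast+
  have wyz: "w \<noteq> y" "w \<noteq> z" using w flex_neq by blast+
  define C where "C = insert w (insert y (insert z (x ` J)))"
  have fxJ: "finite (x ` J)" "card (x ` J) = k - 1" using J x(3) by (auto simp: card_image)
  have cC: "card C = k + 2" unfolding C_def using fxJ nin wyz yz(3) k_pos by simp
  show False
  proof (rule embedding[OF cC _ _ yz(3) z(3)])
    show "y \<in> C" "z \<in> C" by (auto simp: C_def)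
    have "w \<notin> V" using w(1) S_V by blast
    then have "w \<notin> insert v e" using w(2) z(2) by blast
    moreover have "x j \<notin> insert v e" if "j \<in> J" for j
    proof -
      have "x j \<in> V" using x(1)[OF that] by (auto simp: D_def nbr_def)
      then show ?thesis using xJ(4)[OF that] z(1) S_V by blast
    qed
    ultimately show "insert v e \<inter> C = {y, z}" using yz unfolding C_def by blast
  next
    fix a b assume ab: "a \<in> C" "b \<in> C" "a \<noteq> b" "{a, b} \<noteq> {y, z}"
    have sy: "flex a b" if "flex b a" for a b using flex_sym that .
    have "flex (x i) (x j)" if "i \<in> J" "j \<in> J" "x i \<noteq> x j" for i j using x(2) that by blast
    then show "flex a b" using ab w(3,4) xJ(1-3) unfolding C_def
      by (elim insertE imageE) (auto intro: sy)
  qed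
qed

text \<open>A hyperedge with two vertices of \<open>S\<close> would supply the one pair that need
  not be flexible, and a transversal of all \<open>k\<close> parts inside
  \<open>R v \<inter> R v'\<close> would complete the clique. Both vertices have to be rich for the
  transversal to exist, and they can be any two vertices of \<open>S\<close>.\<close>

lemma multi_edges_absent:
  assumes rich_all: "\<And>v. v \<in> S \<Longrightarrow> rich v"
  shows "H2 = {}"
proof (rule ccontr)
  assume "H2 \<noteq> {}"
  then obtain e v v' where e: "e \<in> H" "v \<in> S" "v' \<in> S" "v \<noteq> v'" "v \<in> e" "v' \<in> e"
    unfolding H2_def by blast
  have fe: "finite e" "card e = p + 2" using finite_edge edge e by auto
  define D where "D = (\<lambda>j. A j \<inter> V \<inter> R v \<inter> R v' - e)"
  have cD: "k * e4 * N < card (D j)" if "j \<in> {..<k}" for j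
  proof -
    have j: "j < k" using that by auto
    have "card (A j \<inter> e) \<le> card e" using fe by (intro card_mono) auto
    then have "real (card (A j \<inter> e)) \<le> ep * N" using fe pN by linarith
    moreover have "card (A j - V) = 0" using A_V[OF j] by (simp add: Diff_eq_empty_iff[THEN iffD2])
    ultimately have "(1 / k - e4) * N \<le> card (D j) + ep * N + ep * N + ep * N"
      using card_remove3[OF finite_A[OF j], of V "R v" "R v'" e] A_lower[OF j]
        A_R_compl[OF j rich_all[OF e(2)]] A_R_compl[OF j rich_all[OF e(3)]]
      unfolding D_def by linarith
    moreover have "0 \<le> e6 * N" using eps(4) by simp
    ultimately show ?thesis using size_bound by linarith
  qed
  have "D j \<subseteq> A j" for j by (auto simp: D_def)
  then obtain x where x: "\<And>j. j \<in> {..<k} \<Longrightarrow> x j \<in> D j"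
    "\<And>i j. i \<in> {..<k} \<Longrightarrow> j \<in> {..<k} \<Longrightarrow> i \<noteq> j \<Longrightarrow> flex (x i) (x j)"
    "inj_on x {..<k}" using transversal[OF order_refl, of D] cD by metis
  have xJ: "flex v (x j)" "flex v' (x j)" "x j \<notin> e" if "j \<in> {..<k}" for j
    using x(1)[OF that] by (auto simp: D_def R_def)
  have nin: "v \<notin> x ` {..<k}" "v' \<notin> x ` {..<k}" using xJ e by blast+
  define C where "C = insert v (insert v' (x ` {..<k}))"
  have cC: "card C = k + 2" unfolding C_def using nin x(3) e(4) by (simp add: card_image)
  show False
  proof (rule embedding[OF cC _ _ e(4) e(1)])
    show "v \<in> C" "v' \<in> C" by (auto simp: C_def)
    show "e \<inter> C = {v, v'}" using e xJ(3) unfolding C_def by blast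
  next
    fix a b assume ab: "a \<in> C" "b \<in> C" "a \<noteq> b" "{a, b} \<noteq> {v, v'}"
    have sy: "flex a b" if "flex b a" for a b using flex_sym that .
    have "flex (x i) (x j)" if "i \<in> {..<k}" "j \<in> {..<k}" "x i \<noteq> x j" for i j using x(2) that by blast
    then show "flex a b" using ab xJ(1,2) unfolding C_def
      by (elim insertE imageE) (auto intro: sy)
  qed
qed

end

section \<open>Attaching every vertex to a part\<close>

context partitioned_star_system
begin

lemma attached_of_mem:
  assumes "i < k" "x \<in> A i"
  shows "attached i x"
  unfolding attached_def
proof (intro allI impI)
  fix j assume j: "j < k" "j \<noteq> i"
  have "e4 * N \<le> e6 * N" using eps by (intro mult_right_mono) auto
  moreover have "card (A j - nbr x) \<le> e4 * N" using A_miss[of i j x] assms j by auto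
  ultimately show "card (A j - nbr x) \<le> e6 * N" by linarith
qed

lemma card_Int_le_1:
  assumes "finite e" "\<And>y z. y \<in> e \<Longrightarrow> z \<in> e \<Longrightarrow> y \<noteq> z \<Longrightarrow> y \<in> B \<Longrightarrow> z \<in> B \<Longrightarrow> False"
  shows "card (e \<inter> B) \<le> 1"
proof -
  have "\<forall>a\<in>e \<inter> B. \<forall>b\<in>e \<inter> B. a = b" using assms(2) by blast
  then show ?thesis using card_le_Suc0_iff_eq[of "e \<inter> B"] assms(1) by simp
qed

text \<open>Vertices of one part are attached to it, and both \<open>v0\<close> and
  \<open>v1\<close> are flexible with all of them; the one that differs from \<open>v\<close> takes
  the role of \<open>w\<close> in \<open>no_inner_pair\<close>.\<close>

lemma crossing_of_common_rich:
  assumes v: "v0 \<in> S" "v1 \<in> S" "v0 \<noteq> v1" "rich v0" "rich v1" "\<And>i. i < k \<Longrightarrow> A i \<subseteq> R v0 \<inter> R v1"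
    and e: "(v, e) \<in> Z" and j: "j < k"
  shows "card (e \<inter> A j) \<le> 1"
proof (rule card_Int_le_1)
  fix y z assume yz: "y \<in> e" "z \<in> e" "y \<noteq> z" "y \<in> A j" "z \<in> A j"
  have at: "attached j y" "attached j z" using attached_of_mem j yz by auto
  have fl: "flex v0 y" "flex v0 z" "flex v1 y" "flex v1 z" using v(6)[OF j] yz by (auto simp: R_def)
  show False
  proof (cases "v0 = v")
    case True
    then show False using no_inner_pair[OF e yz(1-3) j at v(2) _ fl(3,4) v(5)] v(3) by blast
  next
    case False
    then show False using no_inner_pair[OF e yz(1-3) j at v(1) _ fl(1,2) v(4)] by blast
  qed
qed (use ZD(5)[OF e] in auto)

text \<open>The degree of \<open>u\<close> is compared with the largest number of crossing sets that
  its neighbourhood allows. If the neighbourhood met every part substantially, a transversal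
  together with \<open>u\<close> would be a flexible \<open>(k + 1)\<close>-clique inside some
  \<open>R w\<close>. So one part is nearly missed, and then the minimum degree leaves no room for
  missing much of any other part, nor for many vertices of \<open>S\<close> inflexible with
  \<open>u\<close>.\<close>

lemma attach:
  assumes cross: "\<And>v e j. (v, e) \<in> Z \<Longrightarrow> j < k \<Longrightarrow> card (e \<inter> A j) \<le> 1" and u: "u \<in> V"
  shows "\<exists>i<k. attached i u \<and> 3 / 4 * s \<le> card {v \<in> S. flex v u}"
proof -
  define x where "x = (\<lambda>j. card (nbr u \<inter> A j))"
  define Y where "Y = card {v \<in> S. flex v u}"
  \<comment> \<open>An upper bound for every part size; the aim is that \<open>x j\<close> is close
    to \<open>a\<close> for all \<open>j \<noteq> i\<close>.\<close>
  define a where "a = (1 / k + e4) * N"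
  have kpos: "0 < real k" using k2 by simp
  obtain i where i: "i < k" "x i \<le> (real k + 1) * e4 * N"
  proof (rule ccontr)
    assume "\<not> thesis"
    then have big: "(real k + 1) * e4 * N < x j" if "j < k" for j using that \<open>\<And>i. i < k \<Longrightarrow> real (x i) \<le> (real k + 1) * e4 * N \<Longrightarrow> thesis\<close> by force
    obtain w where w: "w \<in> S" "rich w" "flex w u" using rich_flex[OF u] .
    define D where "D = (\<lambda>j. nbr u \<inter> A j \<inter> R w)"
    have cD: "k * e4 * N < card (D j)" if "j \<in> {..<k}" for j
    proof -
      have j: "j < k" using that by simp
      have "card (nbr u \<inter> A j) \<le> card (D j \<union> (A j - R w))"
        using finite_A[OF j] finite_nbr by (intro card_mono) (auto simp: D_def)
      also have "\<dots> \<le> card (D j) + card (A j - R w)" by (rule card_Un_le)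
      finally have "real (x j) \<le> card (D j) + ep * N" using A_R_compl[OF j w(2)] unfolding x_def by linarith
      moreover have "ep * N \<le> e4 * N" using eps by (intro mult_right_mono) auto
      moreover have "(real k + 1) * e4 * N = k * e4 * N + e4 * N" by (simp add: algebra_simps)
      ultimately show ?thesis using big[OF j] by linarith
    qed
    have "D j \<subseteq> A j" for j by (auto simp: D_def)
    then obtain y where y: "\<And>j. j \<in> {..<k} \<Longrightarrow> y j \<in> D j"
      "\<And>i j. i \<in> {..<k} \<Longrightarrow> j \<in> {..<k} \<Longrightarrow> i \<noteq> j \<Longrightarrow> flex (y i) (y j)"
      "inj_on y {..<k}" using transversal[OF order_refl, of D] cD by metis
    have yJ: "flex u (y j)" "y j \<in> R w" if "j \<in> {..<k}" for j
      using y(1)[OF that] by (auto simp: D_def nbr_def)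
    have "u \<notin> y ` {..<k}" using yJ flex_neq by blast
    then have "card (insert u (y ` {..<k})) = Suc k" using y(3) by (simp add: card_image)
    moreover have "insert u (y ` {..<k}) \<subseteq> R w" using yJ w u by (auto simp: R_def)
    moreover have "clique flex (insert u (y ` {..<k}))"
      unfolding clique_def using yJ(1) y(2) flex_sym by blast
    ultimately show False using R_clique_free[OF w(1)] by blast
  qed
  define q where "q = p - 1"
  have pq: "p = Suc q" using p_pos by (simp add: q_def)
  define I where "I = {..<k} - {i}"
  have I: "{..<k} = insert i I" "i \<notin> I" "finite I" "card I = k - 1" using i by (auto simp: I_def)
  have xa: "real (x j) \<le> a" if "j < k" for j
  proof -
    have "x j \<le> card (A j)" unfolding x_def using finite_A[OF that] by (intro card_mono) auto
    then show ?thesis using A_upper[OF that] unfolding a_def by linarith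
  qed
  have a0: "0 \<le> a" "N / k \<le> a" "a \<le> N"
  proof -
    have n0: "0 \<le> N" by simp
    show "0 \<le> a" unfolding a_def using eps kpos by simp
    have "1 / k * N \<le> a" unfolding a_def using eps n0 by (intro mult_right_mono) auto
    then show "N / k \<le> a" by simp
    have "1 / real k \<le> 1 / 2" using k2 by (intro divide_left_mono) auto
    then have "1 / k + e4 \<le> 1" using eps by linarith
    then show "a \<le> N" unfolding a_def using mult_right_mono[of "1 / k + e4" 1 N] by simp
  qed
  define M where "M = (2::real) ^ k"
  have choose_le: "real ((k - 1) choose j) \<le> M" for j
  proof -
    have "(k - 1) choose j \<le> 2 ^ (k - 1)" by (rule binomial_le_pow2)
    also have "\<dots> \<le> 2 ^ k" by (intro power_increasing) auto
    finally have "real ((k - 1) choose j) \<le> real (2 ^ k)" by (rule of_nat_mono)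
    then show ?thesis by (simp add: M_def)
  qed
  define C where "C = real ((k - 1) choose p)"
  have Cc: "c = C / real k ^ p" by (simp add: c_def C_def)
  have ap: "C * a ^ p \<le> (c + M * k * e4) * N ^ p"
  proof -
    have "1 / real k \<le> 1 / 2" using k2 by (intro divide_left_mono) auto
    then have "(1 / k + e4) ^ p \<le> (1 / k) ^ p + p * e4" using eps by (intro power_add_le) auto
    also have "p * e4 \<le> k * e4" using p_k eps by (intro mult_right_mono) auto
    finally have "C * (1 / k + e4) ^ p \<le> C * ((1 / k) ^ p + k * e4)" by (intro mult_left_mono) (auto simp: C_def)
    also have "\<dots> = c + C * (k * e4)" by (simp add: Cc algebra_simps power_divide)
    also have "C * (k * e4) \<le> M * (k * e4)" using choose_le[of p] eps unfolding C_def by (intro mult_right_mono) auto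
    finally have "C * (1 / k + e4) ^ p \<le> c + M * k * e4" by (simp add: mult.assoc)
    then have "C * (1 / k + e4) ^ p * N ^ p \<le> (c + M * k * e4) * N ^ p" by (intro mult_right_mono) auto
    then show ?thesis unfolding a_def by (simp add: power_mult_distrib mult.assoc)
  qed
  define E where "E = esym p {..<k} x"
  have Np: "N * N ^ q = N ^ p" by (simp add: pq)
  have E1: "real E \<le> esym p I x + (real k + 1) * e4 * M * N ^ p"
  proof -
    have "real (esym q I x) \<le> real (card I choose q) * a ^ q"
      by (rule esym_le_power[OF I(3)]) (use xa in \<open>auto simp: I_def\<close>)
    also have "\<dots> \<le> M * N ^ q" using choose_le[of q] a0 unfolding I(4) by (intro mult_mono power_mono) (auto simp: M_def)
    finally have "x i * real (esym q I x) \<le> ((real k + 1) * e4 * N) * (M * N ^ q)"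
      using i(2) eps by (intro mult_mono) auto
    also have "\<dots> = (real k + 1) * e4 * M * (N * N ^ q)" by (simp only: ac_simps)
    finally have "x i * real (esym q I x) \<le> (real k + 1) * e4 * M * N ^ p" unfolding Np .
    moreover have "E = esym p I x + x i * esym q I x"
      unfolding E_def I(1) pq by (rule esym_insert[OF I(3,2)])
    ultimately show ?thesis by simp
  qed
  \<comment> \<open>Compared with all weights equal to \<open>a\<close>, a deficit at
    \<open>j\<close> costs at least \<open>(a - x j) * a ^ q\<close>, because
    \<open>(k - 2) choose q\<close> is at least 1.\<close>
  have E2: "real (esym p I x) \<le> C * a ^ p - (a - x j) * a ^ q" if j: "j < k" "j \<noteq> i" for j
  proof -
    define I' where "I' = I - {j}"
    have I': "I = insert j I'" "j \<notin> I'" "finite I'" "card I' = k - 2" using j I by (auto simp: I'_def I_def)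
    have xa': "real (x l) \<le> a" if "l \<in> I'" for l using xa that by (auto simp: I'_def I_def)
    have "real (esym p I x) = esym p I' x + x j * real (esym q I' x)"
      unfolding I'(1) pq esym_insert[OF I'(3,2)] by simp
    also have "\<dots> \<le> real ((k - 2) choose p) * a ^ p + x j * (real ((k - 2) choose q) * a ^ q)"
      using esym_le_power[OF I'(3) xa', where p=p] esym_le_power[OF I'(3) xa', where p=q] unfolding I'(4)
      by (intro add_mono mult_left_mono) auto
    also have "\<dots> = C * a ^ p - (a - x j) * (real ((k - 2) choose q) * a ^ q)"
    proof -
      have "k - 1 = Suc (k - 2)" using k2 by simp
      then have "C = real ((k - 2) choose p) + real ((k - 2) choose q)"
        unfolding C_def pq by simp
      then show ?thesis unfolding pq by (simp add: algebra_simps)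
    qed
    also have "\<dots> \<le> C * a ^ p - (a - x j) * (1 * a ^ q)"
    proof -
      have "q \<le> k - 2" using p_k pq by simp
      then have "0 < (k - 2) choose q" by simp
      then have "1 \<le> real ((k - 2) choose q)" by linarith
      then have "(a - x j) * (1 * a ^ q) \<le> (a - x j) * (real ((k - 2) choose q) * a ^ q)"
        using xa[OF j(1)] a0 by (intro mult_left_mono mult_right_mono) auto
      then show ?thesis by linarith
    qed
    finally show ?thesis by simp
  qed
  \<comment> \<open>The error terms of \<open>ap\<close> and \<open>E1\<close> add up to
    \<open>e5\<close>, which explains its definition.\<close>
  have e5M: "e5 = M * k * e4 + (real k + 1) * e4 * M" unfolding e5 M_def by (simp add: algebra_simps)
  have Eup: "real E \<le> (c + e5) * N ^ p - (a - x j) * a ^ q" if "j < k" "j \<noteq> i" for j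
    using E1 E2[OF that] ap unfolding e5M by (simp add: algebra_simps)
  have Nq: "N ^ (p - 1) = N ^ q" by (simp add: q_def)
  have low: "(c - 5 * e4) * s * N ^ p \<le> Y * real E"
  proof -
    have "Zdeg u \<le> Y * E + card S * card (V - (\<Union>j<k. A j)) * card V ^ (p - 1)
      + T0 * card V ^ p + 2 * (card S * T0 * card V ^ (p - 1))"
      unfolding Y_def E_def x_def
    proof (rule Zdeg_le_crossing[OF u])
      show "A j \<subseteq> V" if "j < k" for j by (rule A_V[OF that])
      show "A i \<inter> A j = {}" if "i < k" "j < k" "i \<noteq> j" for i j by (rule A_disj[OF that])
      show "card (e \<inter> A j) \<le> 1" if "(v, e) \<in> Z" "j < k" for v e j by (rule cross[OF that])
    qed
    then have "real (Zdeg u) \<le> real (Y * E + card S * card (V - (\<Union>j<k. A j)) * card V ^ (p - 1)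
      + T0 * card V ^ p + 2 * (card S * T0 * card V ^ (p - 1)))" by (rule of_nat_mono)
    with min_deg[OF u] have "(c - ep) * s * N ^ p \<le> real (Y * E + card S * card (V - (\<Union>j<k. A j)) * card V ^ (p - 1)
      + T0 * card V ^ p + 2 * (card S * T0 * card V ^ (p - 1)))" by (rule order_trans)
    also have "\<dots> = Y * real E + s * card (V - (\<Union>j<k. A j)) * N ^ q + T0 * N ^ p + 2 * (s * T0 * N ^ (p - 1))"
      by (simp add: q_def)
    also have "s * card (V - (\<Union>j<k. A j)) * N ^ q \<le> s * (e4 * N) * N ^ q"
      using A_rest by (intro mult_right_mono mult_left_mono) auto
    also have "s * (e4 * N) * N ^ q = e4 * s * N ^ p" unfolding Np[symmetric] by (simp only: ac_simps)
    also have "s * T0 * N ^ (p - 1) \<le> ep * s * N ^ p" by (rule T0_N_pow)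
    also have "T0 * N ^ p \<le> ep * s * N ^ p"
    proof -
      have "real T0 \<le> ep * s" using large_S(1) by simp
      then show ?thesis by (intro mult_right_mono) auto
    qed
    finally have "(c - ep) * s * N ^ p \<le> Y * real E + e4 * s * N ^ p + ep * s * N ^ p + 2 * (ep * s * N ^ p)" by simp
    then have "(c - 4 * ep - e4) * s * N ^ p \<le> Y * real E" by (simp add: algebra_simps)
    moreover have "(c - 5 * e4) * s * N ^ p \<le> (c - 4 * ep - e4) * s * N ^ p"
      using eps by (intro mult_right_mono) auto
    ultimately show ?thesis by linarith
  qed
  have Ys: "Y \<le> s" unfolding Y_def using fin_S by (simp add: card_mono)
  have Npp: "0 < N ^ p" using N_pos by simp
  have "real E \<le> (c + e5) * N ^ p"
  proof -
    have "\<exists>j<k. j \<noteq> i" using k2 i by (metis less_le_trans nat_neq_iff one_less_numeral_iff pos2 semiring_norm(76) zero_less_one)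
    then obtain j where j: "j < k" "j \<noteq> i" by blast
    have "0 \<le> (a - x j) * a ^ q" using xa[OF j(1)] a0 by simp
    then show ?thesis using Eup[OF j] by linarith
  qed
  then have "(c - 5 * e4) * s * N ^ p \<le> Y * ((c + e5) * N ^ p)"
    using low mult_left_mono[of "real E" "(c + e5) * N ^ p" Y] by linarith
  then have "((c - 5 * e4) * s) * N ^ p \<le> (Y * (c + e5)) * N ^ p" by (simp add: algebra_simps)
  then have Y1: "(c - 5 * e4) * s \<le> Y * (c + e5)" by (rule mult_right_le_imp_le[OF _ Npp])
  \<comment> \<open>As \<open>e4\<close> and \<open>e5\<close> are small against \<open>c\<close>,
    the two degree bounds have a ratio of at least \<open>3 / 4\<close>. The constant has to exceed
    \<open>1 / 2\<close>, so that the sets obtained for two vertices overlap in a positive fraction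
    of \<open>S\<close>.\<close>
  have "3 * (c + e5) \<le> 4 * (c - 5 * e4)" using c_e5 eps(2,3,7) by argo
  then have "3 / 4 * (c + e5) \<le> c - 5 * e4" by simp
  then have "3 / 4 * (c + e5) * s \<le> (c - 5 * e4) * s" by (intro mult_right_mono) auto
  with Y1 have "3 / 4 * (c + e5) * s \<le> Y * (c + e5)" by (rule order_trans[rotated])
  moreover have "3 / 4 * (c + e5) * s = (3 / 4 * s) * (c + e5)" by simp
  ultimately have "(3 / 4 * s) * (c + e5) \<le> Y * (c + e5)" by (simp only:)
  moreover have "0 < c + e5" using c_e5 eps by linarith
  ultimately have Y34: "3 / 4 * s \<le> Y" by (rule mult_right_le_imp_le)
  have "attached i u" unfolding attached_def
  proof (intro allI impI)
    fix j assume j: "j < k" "j \<noteq> i"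
    have "(c - 5 * e4) * s * N ^ p \<le> s * real E"
      using low mult_right_mono[OF Ys, of "real E"] by simp
    then have "((c - 5 * e4) * N ^ p) * s \<le> real E * s" by (simp only: ac_simps)
    then have "(c - 5 * e4) * N ^ p \<le> real E" by (rule mult_right_le_imp_le[OF _ s_pos])
    then have "(a - x j) * a ^ q \<le> (e5 + 5 * e4) * N ^ p" using Eup[OF j] by (simp add: algebra_simps)
    also have "\<dots> \<le> (2 * e5) * N ^ p" using eps by (intro mult_right_mono) auto
    finally have 1: "(a - x j) * a ^ q \<le> 2 * e5 * N ^ p" by simp
    \<comment> \<open>\<open>N / k \<le> a\<close> trades the power of \<open>a\<close> for one of
      \<open>N\<close>; the resulting loss of a power of \<open>k\<close> is the origin of
      \<open>real k ^ p\<close> in \<open>e6\<close>.\<close>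
    have "(a - x j) * (N / k) ^ q \<le> (a - x j) * a ^ q"
      using xa[OF j(1)] a0 by (intro mult_left_mono power_mono) auto
    then have "(a - x j) * (N / k) ^ q \<le> 2 * e5 * (N * N ^ q)" using 1 unfolding Np by linarith
    then have "((a - x j) / real k ^ q) * N ^ q \<le> (2 * e5 * N) * N ^ q"
      by (simp add: power_divide algebra_simps)
    then have "(a - x j) / real k ^ q \<le> 2 * e5 * N"
      by (rule mult_right_le_imp_le) (use N_pos in simp)
    then have "a - x j \<le> 2 * e5 * N * real k ^ q" using kpos by (simp add: pos_divide_le_eq)
    also have "\<dots> \<le> 2 * e5 * N * real k ^ p" using eps k2 pq by (intro mult_left_mono power_increasing) auto
    also have "\<dots> = e6 * N" unfolding e6 by (simp only: ac_simps)
    finally have 2: "a - x j \<le> e6 * N" .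
    have "card (A j) = card (A j \<inter> nbr u) + card (A j - nbr u)"
      using card_Int_Diff[OF finite_A[OF j(1)]] .
    then have "real (card (A j - nbr u)) = card (A j) - real (x j)" unfolding x_def by (simp add: Int_commute)
    then show "card (A j - nbr u) \<le> e6 * N" using A_upper[OF j(1)] 2 unfolding a_def by linarith
  qed
  then show ?thesis using i(1) Y34 unfolding Y_def by blast
qed

text \<open>Every vertex of \<open>V\<close> gets a part by \<open>attach\<close>. Two vertices in
  the same part and the same link set are both flexible with at least half of the vertices of
  \<open>S\<close>, hence with a rich one other than \<open>v\<close>, and
  \<open>no_inner_pair\<close> applies.\<close>

lemma crossing_partition:
  assumes cross: "\<And>v e j. (v, e) \<in> Z \<Longrightarrow> j < k \<Longrightarrow> card (e \<inter> A j) \<le> 1"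
  obtains B where "\<And>j. j < k \<Longrightarrow> B j \<subseteq> V" "\<And>i j. i < k \<Longrightarrow> j < k \<Longrightarrow> i \<noteq> j \<Longrightarrow> B i \<inter> B j = {}"
    "\<And>v e. (v, e) \<in> Z \<Longrightarrow> e \<in> crossing {..<k} B (p + 1)"
proof -
  have "\<forall>u\<in>V. \<exists>i. i < k \<and> attached i u \<and> 3 / 4 * s \<le> card {v \<in> S. flex v u}"
    using attach[OF cross] by simp
  from bchoice[OF this] obtain part
    where "\<forall>u\<in>V. part u < k \<and> attached (part u) u \<and> 3 / 4 * s \<le> card {v \<in> S. flex v u}" ..
  then have part: "part u < k" "attached (part u) u" "3 / 4 * s \<le> card {v \<in> S. flex v u}" if "u \<in> V" for u
    using that by simp_all
  define B where "B = (\<lambda>j. {u \<in> V. part u = j})"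
  have cr: "e \<in> crossing {..<k} B (p + 1)" if e: "(v, e) \<in> Z" for v e
  proof -
    note z = ZD[OF e]
    have "card (e \<inter> B j) \<le> 1" if j: "j < k" for j
    proof (rule card_Int_le_1[OF z(5)])
      fix y x assume yx: "y \<in> e" "x \<in> e" "y \<noteq> x" "y \<in> B j" "x \<in> B j"
      then have V: "y \<in> V" "x \<in> V" "part y = j" "part x = j" by (auto simp: B_def)
      define Fy where "Fy = {v \<in> S. flex v y}"
      define Fx where "Fx = {v \<in> S. flex v x}"
      have F: "finite Fy" "finite Fx" "Fy \<subseteq> S" "Fx \<subseteq> S" using fin_S by (auto simp: Fy_def Fx_def)
      have "card Fy + card Fx = card (Fy \<union> Fx) + card (Fy \<inter> Fx)" using F by (intro card_Un_Int) auto
      moreover have "card (Fy \<union> Fx) \<le> card S" using F fin_S by (intro card_mono) auto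
      ultimately have "real (card Fy) + real (card Fx) \<le> s + card (Fy \<inter> Fx)" by linarith
      then have "1 / 2 * s \<le> card (Fy \<inter> Fx)" using part(3)[OF V(1)] part(3)[OF V(2)] unfolding Fy_def Fx_def by linarith
      moreover have "card (Fy \<inter> Fx) \<le> card (Fy \<inter> Fx - {v}) + 1"
      proof -
        have "card (Fy \<inter> Fx) \<le> card (insert v (Fy \<inter> Fx - {v}))" using F by (intro card_mono) auto
        also have "\<dots> = card (Fy \<inter> Fx - {v}) + 1" using F by (subst card_insert_disjoint) auto
        finally show ?thesis .
      qed
      moreover have "ep * s \<le> 1 / 64 * s" using eps by (intro mult_right_mono) auto
      ultimately have "ep * s < card (Fy \<inter> Fx - {v})" using large_S(2) by linarith
      then obtain w where w: "w \<in> Fy \<inter> Fx - {v}" "rich w" using rich_exists[of "Fy \<inter> Fx - {v}"] F by blast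
      have w': "w \<in> S" "w \<noteq> v" "flex w y" "flex w x" using w by (auto simp: Fy_def Fx_def)
      show False
        using no_inner_pair[OF e yx(1-3) j _ _ w' w(2)] part(2)[OF V(1)] part(2)[OF V(2)] V by simp
    qed
    moreover have "e \<subseteq> (\<Union>j<k. B j)" using z(2) part(1) by (auto simp: B_def)
    ultimately show ?thesis using z(4) unfolding crossing_def by simp
  qed
  show ?thesis
  proof (rule that[of B])
    show "B j \<subseteq> V" for j by (auto simp: B_def)
    show "B i \<inter> B j = {}" if "i \<noteq> j" for i j using that by (auto simp: B_def)
  qed (erule cr)
qed

end

section \<open>The bound under the minimum degree condition\<close>

context dense_star_system
begin

text \<open>If all vertices of \<open>S\<close> are rich, no hyperedge has two vertices in
  \<open>S\<close> and each link is bounded by the Turan count. A vertex that is not rich loses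
  \<open>\<theta> * N ^ (p + 1)\<close> in its link, which by \<open>small\<close> makes up for the
  hyperedges with two vertices in \<open>S\<close> and the error term together.\<close>

lemma card_H_le_turan_count:
  fixes \<theta> :: real
  assumes gap: "\<And>x. x \<le> (1 - ep) * N \<Longrightarrow> turan_count (p + 1) x k + \<theta> * N ^ (p + 1) \<le> turan_count (p + 1) (card V) k"
    and small: "T0 * N ^ p + s * s * (s + N) ^ p \<le> \<theta> * N ^ (p + 1)"
  shows "card H \<le> card S * turan_count (p + 1) (card V) k"
proof -
  obtain A v0 v1 where A: "near_partition A" and v: "v0 \<in> S" "v1 \<in> S" "v0 \<noteq> v1" "rich v0" "rich v1"
    "\<And>i. i < k \<Longrightarrow> A i \<subseteq> R v0 \<inter> R v1" using near_partition_exists by blast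
  interpret partitioned_star_system H S V p k ep e3 e4 e5 e6 A by unfold_locales (rule A)
  define t where "t = turan_count (p + 1) (card V) k"
  have cr: "card (e \<inter> A j) \<le> 1" if "(v, e) \<in> Z" "j < k" for v e j
    using crossing_of_common_rich[OF v that] .
  obtain B where B: "\<And>j. j < k \<Longrightarrow> B j \<subseteq> V" "\<And>i j. i < k \<Longrightarrow> j < k \<Longrightarrow> i \<noteq> j \<Longrightarrow> B i \<inter> B j = {}"
    "\<And>v e. (v, e) \<in> Z \<Longrightarrow> e \<in> crossing {..<k} B (p + 1)"
    by (rule crossing_partition) (erule (1) cr, rule that)
  define L where "L = (\<lambda>v. {e. (v, e) \<in> Z})"
  have L1: "card (L v) \<le> t" and L2: "card (L v) \<le> turan_count (p + 1) (card (R v)) k + T0 * card V ^ p"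
    if "v \<in> S" for v using card_link_le[OF that B(3,1,2)] unfolding L_def t_def by auto
  have "Z = Sigma S L" unfolding L_def using ZD(1) by auto
  moreover have "finite (L v)" for v
  proof -
    have "L v \<subseteq> Pow V" unfolding L_def using ZD(2) by auto
    then show ?thesis using fin_V finite_subset by blast
  qed
  ultimately have cZ: "card Z = (\<Sum>v\<in>S. card (L v))" using fin_S by simp
  show ?thesis
  proof (cases "\<forall>v\<in>S. rich v")
    case True
    then have "H2 = {}" using multi_edges_absent by blast
    then have "card H \<le> card Z" using card_H_le by simp
    also have "\<dots> \<le> card S * t" unfolding cZ using sum_bounded_above[of S "\<lambda>v. card (L v)" t] L1 by simp
    finally show ?thesis unfolding t_def .
  next
    case False
    then obtain v where v: "v \<in> S" "\<not> rich v" by blast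
    have "card (R v) \<le> (1 - ep) * N" using v by (simp add: rich_def)
    then have "turan_count (p + 1) (card (R v)) k + \<theta> * N ^ (p + 1) \<le> t" unfolding t_def by (rule gap)
    moreover have "real (card (L v)) \<le> turan_count (p + 1) (card (R v)) k + T0 * N ^ p"
      using L2[OF v(1)] by (metis of_nat_add of_nat_le_iff of_nat_mult of_nat_power)
    ultimately have Lv: "real (card (L v)) \<le> t - \<theta> * N ^ (p + 1) + T0 * N ^ p" by linarith
    have "card Z = card (L v) + (\<Sum>v\<in>S - {v}. card (L v))" unfolding cZ by (rule sum.remove[OF fin_S v(1)])
    moreover have "(\<Sum>v\<in>S - {v}. card (L v)) \<le> card (S - {v}) * t"
      using sum_bounded_above[of "S - {v}" "\<lambda>v. card (L v)" t] L1 by simp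
    ultimately have "real (card Z) \<le> card (L v) + real (card (S - {v}) * t)" by linarith
    also have "real (card (S - {v}) * t) = s * t - t"
    proof -
      have "card S = Suc (card (S - {v}))" by (rule card.remove[OF fin_S v(1)])
      then show ?thesis by (simp add: algebra_simps)
    qed
    finally have "real (card Z) \<le> s * t - \<theta> * N ^ (p + 1) + T0 * N ^ p" using Lv by linarith
    moreover have "real (card H2) \<le> s * s * (s + N) ^ p"
    proof -
      have "real (card H2) \<le> real (card S * card S * (card S + card V) ^ p)" using card_H2 by (rule of_nat_mono)
      then show ?thesis by simp
    qed
    moreover have "real (card H) \<le> card Z + real (card H2)" using card_H_le by linarith
    ultimately have "real (card H) \<le> s * t" using small by linarith
    then have "real (card H) \<le> real (card S * t)" by simp
    then show ?thesis unfolding t_def by (simp only: of_nat_le_iff)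
  qed
qed

end

section \<open>Star systems on many vertices\<close>

lemma ceiling_bound:
  fixes a b :: real
  assumes "0 < a" "nat \<lceil>b / a\<rceil> \<le> n"
  shows "b \<le> a * real n"
proof -
  have "b / a \<le> real (nat \<lceil>b / a\<rceil>)" by (rule real_nat_ceiling_ge)
  also have "\<dots> \<le> real n" using assms(2) by simp
  finally show ?thesis using assms(1) by (simp add: field_simps)
qed

context star_system
begin

text \<open>When the bound fails, each poor vertex still lowers the sum in
  \<open>card_Z_le_sum\<close> by \<open>\<theta> * card V ^ (p + 1)\<close>, while all error terms
  together are at most \<open>(T0 + 1) * card V ^ (p + 1)\<close>. The resulting number of poor
  vertices is bounded independently of \<open>card S\<close>, so for large \<open>card S\<close>
  they are a small fraction.\<close>

lemma few_poor_vertices: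
  fixes ep \<theta> :: real
  assumes th: "0 < \<theta>" and big: "card S * turan_count (p + 1) (card V) k < card H"
    and gap: "\<And>x. x \<le> (1 - ep) * card V \<Longrightarrow>
      turan_count (p + 1) x k + \<theta> * real (card V) ^ (p + 1) \<le> turan_count (p + 1) (card V) k"
    and small: "card S * card S * (card S + card V) ^ p + 2 * (card S * T0 * card V ^ p) \<le> card V ^ (p + 1)"
    and V: "V \<noteq> {}"
  shows "\<theta> * card {v \<in> S. card (R v) < (1 - ep) * card V} \<le> T0 + 1"
proof -
  let ?N = "real (card V)" and ?P = "{v \<in> S. card (R v) < (1 - ep) * card V}"
  define t where "t = turan_count (p + 1) (card V) k"
  have tR: "turan_count (p + 1) (card (R v)) k \<le> t" for v
    unfolding t_def by (rule turan_count_mono) (use R_subset fin_V in \<open>auto intro: card_mono\<close>)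
  have "(\<Sum>v\<in>S. real (turan_count (p + 1) (card (R v)) k)) \<le> (\<Sum>v\<in>S. real t - (if v \<in> ?P then \<theta> * ?N ^ (p + 1) else 0))"
  proof (rule sum_mono)
    fix v assume "v \<in> S"
    show "real (turan_count (p + 1) (card (R v)) k) \<le> real t - (if v \<in> ?P then \<theta> * ?N ^ (p + 1) else 0)"
      using tR[of v] gap[of "card (R v)"] unfolding t_def by auto
  qed
  also have "\<dots> = card S * real t - card ?P * (\<theta> * ?N ^ (p + 1))"
    using fin_S by (simp add: sum_subtractf sum.If_cases Int_def)
  finally have 1: "(\<Sum>v\<in>S. real (turan_count (p + 1) (card (R v)) k)) \<le> card S * real t - card ?P * (\<theta> * ?N ^ (p + 1))" .
  have "card S * t < card H" using big by (simp add: t_def)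
  also have "\<dots> \<le> card Z + card H2" by (rule card_H_le)
  finally have "card S * t \<le> (\<Sum>v\<in>S. turan_count (p + 1) (card (R v)) k) + T0 * card V ^ (p + 1) + card V ^ (p + 1)"
    using card_Z_le_sum card_H2 small by linarith
  then have "real (card S * t) \<le> real ((\<Sum>v\<in>S. turan_count (p + 1) (card (R v)) k) + T0 * card V ^ (p + 1) + card V ^ (p + 1))"
    by (rule of_nat_mono)
  then have "card S * real t \<le> (\<Sum>v\<in>S. real (turan_count (p + 1) (card (R v)) k)) + T0 * ?N ^ (p + 1) + ?N ^ (p + 1)"
    by simp
  then have "card ?P * (\<theta> * ?N ^ (p + 1)) \<le> T0 * ?N ^ (p + 1) + ?N ^ (p + 1)" using 1 by linarith
  then have "(\<theta> * card ?P) * ?N ^ (p + 1) \<le> (T0 + 1) * ?N ^ (p + 1)" by (simp add: algebra_simps)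
  then have "\<theta> * card ?P \<le> real (T0 + 1)"
    by (rule mult_right_le_imp_le) (use V fin_V in \<open>simp add: card_gt_0_iff\<close>)
  then show ?thesis by simp
qed

text \<open>The rounding in the Turan increment and the hyperedges with two vertices in
  \<open>S\<close> each use up one half of \<open>ep\<close>.\<close>

lemma min_Zdeg:
  fixes ep :: real
  assumes u: "u \<in> V" and s: "0 < card S"
    and deg: "card S * (turan_count (p + 1) (card V) k - turan_count (p + 1) (card V - 1) k) \<le> card {e \<in> H. u \<in> e}"
    and fl: "((1 / real k) ^ p - ep / (2 * ((k - 1) choose p))) * real (card V) ^ p \<le> real ((card V - 1) div k) ^ p"
    and big: "card S \<le> card V" "card S * 2 ^ (p - 1) \<le> ep / 2 * card V"
  shows "(((k - 1) choose p) / real k ^ p - ep) * card S * real (card V) ^ p \<le> Zdeg u"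
proof -
  let ?N = "real (card V)" and ?s = "real (card S)"
  define C where "C = real ((k - 1) choose p)"
  have "p \<le> k - 1" using p_k by simp
  then have "0 < (k - 1) choose p" by simp
  then have C: "0 < C" by (simp add: C_def)
  have Vpos: "0 < card V" using u fin_V by (auto simp: card_gt_0_iff)
  have "turan_count (p + 1) (card V - 1) k + ((k - 1) choose p) * ((card V - 1) div k) ^ p \<le> turan_count (p + 1) (card V) k"
    using turan_count_Suc_ge[OF k_pos, of p "card V - 1"] Vpos by simp
  then have "((k - 1) choose p) * ((card V - 1) div k) ^ p
    \<le> turan_count (p + 1) (card V) k - turan_count (p + 1) (card V - 1) k" by linarith
  then have "card S * (((k - 1) choose p) * ((card V - 1) div k) ^ p) \<le> card {e \<in> H. u \<in> e}"
    using deg by (meson mult_le_mono2 order_trans)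
  also have "\<dots> \<le> Zdeg u + card {e \<in> H2. u \<in> e}" by (rule degree_le[OF u])
  also have "\<dots> \<le> Zdeg u + card S * card S * (card S + card V) ^ (p - 1)" using card_H2_degree[OF u] by simp
  finally have "real (card S * (((k - 1) choose p) * ((card V - 1) div k) ^ p))
    \<le> real (Zdeg u + card S * card S * (card S + card V) ^ (p - 1))" by (rule of_nat_mono)
  then have 1: "?s * (C * real ((card V - 1) div k) ^ p) \<le> Zdeg u + ?s * ?s * (?s + ?N) ^ (p - 1)"
    by (simp add: C_def)
  have "?s * (C * (((1 / real k) ^ p - ep / (2 * C)) * ?N ^ p)) \<le> ?s * (C * real ((card V - 1) div k) ^ p)"
    using fl C unfolding C_def by (intro mult_left_mono) auto
  moreover have "?s * (C * (((1 / real k) ^ p - ep / (2 * C)) * ?N ^ p)) = (C / real k ^ p - ep / 2) * ?s * ?N ^ p"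
    using C by (simp add: field_simps power_divide)
  ultimately have 2: "(C / real k ^ p - ep / 2) * ?s * ?N ^ p \<le> Zdeg u + ?s * ?s * (?s + ?N) ^ (p - 1)" using 1 by linarith
  have "?s * ?s * (?s + ?N) ^ (p - 1) \<le> ?s * ?s * (2 * ?N) ^ (p - 1)"
    using big(1) by (intro mult_left_mono power_mono) auto
  also have "\<dots> = (?s * 2 ^ (p - 1)) * (?s * ?N ^ (p - 1))" by (simp add: power_mult_distrib)
  also have "\<dots> \<le> (ep / 2 * ?N) * (?s * ?N ^ (p - 1))" using big(2) by (intro mult_right_mono) auto
  also have "\<dots> = ep / 2 * ?s * (?N * ?N ^ (p - 1))" by (simp only: ac_simps)
  also have "?N * ?N ^ (p - 1) = ?N ^ p" using p_pos by (metis Suc_diff_1 less_le_trans power_Suc zero_less_one)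
  finally have "(C / real k ^ p - ep / 2) * ?s * ?N ^ p - ep / 2 * ?s * ?N ^ p \<le> Zdeg u" using 2 by linarith
  then show ?thesis unfolding C_def by (simp add: algebra_simps)
qed

end

lemma star_system_min_degree_bound:
  assumes p: "1 \<le> p" and pk: "p + 1 \<le> k"
  shows "\<exists>s1. \<forall>s\<ge>s1. \<exists>N1. \<forall>(H :: 'a set set) S V. star_system H S V p k \<longrightarrow> card S = s \<longrightarrow> N1 \<le> card V \<longrightarrow>
    (\<forall>u\<in>V. s * (turan_count (p + 1) (card V) k - turan_count (p + 1) (card V - 1) k) \<le> card {e \<in> H. u \<in> e}) \<longrightarrow>
    card H \<le> s * turan_count (p + 1) (card V) k"
proof -
  \<comment> \<open>The constants are chosen backwards from the last one, so all of them depend on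
    \<open>k\<close> and \<open>p\<close> only.\<close>
  define e6 where "e6 = 1 / (16 * real k ^ 2)"
  define e5 where "e5 = e6 / (2 * real k ^ p)"
  define e4 where "e4 = e5 / (2 ^ k * (2 * real k + 1))"
  define e3 where "e3 = e4 / (4 * real k)"
  define ep where "ep = e3 / (4 * real k ^ p)"
  have k: "0 < k" "0 < real k" using pk by auto
  have k21: "0 < 2 ^ k * (2 * real k + 1)" by (intro mult_pos_pos) auto
  have e6p: "0 < e6" unfolding e6_def using k by simp
  have e5p: "0 < e5" unfolding e5_def using k e6p by simp
  have e4p: "0 < e4" unfolding e4_def by (rule divide_pos_pos[OF e5p k21])
  have e3p: "0 < e3" unfolding e3_def using k e4p by simp
  have epp: "0 < ep" unfolding ep_def using k e3p by simp
  have rel: "e3 = 4 * real k ^ p * ep" "e4 = 4 * real k * e3" "e6 = 2 * real k ^ p * e5" "e6 \<le> 1 / (16 * real k ^ 2)"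
    unfolding ep_def e3_def e5_def e6_def using k by auto
  have rel5: "e5 = 2 ^ k * (2 * real k + 1) * e4" unfolding e4_def using k21 by simp
  have ep1: "ep \<le> 1"
  proof -
    have k1: "1 \<le> real k" using k by simp
    have "1 \<le> 16 * real k ^ 2" using one_le_power[OF k1, of 2] by linarith
    then have "1 / (16 * real k ^ 2) \<le> 1" by (subst divide_le_eq_1) linarith
    then have "e6 \<le> 1" by (simp add: e6_def)
    moreover have d: "a / b \<le> a" if "0 < a" "1 \<le> b" for a b :: real
      using that mult_left_mono[of 1 b a] by (simp add: divide_le_eq)
    have kp: "1 \<le> 2 * real k ^ p" "1 \<le> 4 * real k ^ p" using one_le_power[OF k1, of p] by linarith+
    have kk: "1 \<le> 4 * real k" using k1 by simp
    have kM: "1 \<le> 2 ^ k * (2 * real k + 1)"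
      using mult_mono[of 1 "2 ^ k" 1 "2 * real k + 1"] by simp
    have "e5 \<le> e6" unfolding e5_def by (rule d[OF e6p kp(1)])
    moreover have "e4 \<le> e5" unfolding e4_def by (rule d[OF e5p kM])
    moreover have "e3 \<le> e4" unfolding e3_def by (rule d[OF e4p kk])
    moreover have "ep \<le> e3" unfolding ep_def by (rule d[OF e3p kp(2)])
    ultimately have "e5 \<le> e6" "e4 \<le> e5" "e3 \<le> e4" "ep \<le> e3" "e6 \<le> 1" by simp_all
    then show ?thesis by linarith
  qed
  \<comment> \<open>\<open>T0\<close> depends on \<open>p\<close> and \<open>k\<close> only, so it
    can be fixed before any system is given.\<close>
  define T where "T = star_system.T0 p k"
  obtain \<theta> Ng where th: "0 < \<theta>" and gap: "\<And>N x. Ng \<le> N \<Longrightarrow> x \<le> (1 - ep) * real N \<Longrightarrow>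
    turan_count (p + 1) x k + \<theta> * real N ^ (p + 1) \<le> turan_count (p + 1) N k"
    using turan_count_gap[OF k(1) _ pk epp ep1] by auto
  have "p \<le> k - 1" using pk by simp
  then have "0 < (k - 1) choose p" by simp
  then have "0 < ep / (2 * ((k - 1) choose p))" using epp by simp
  then obtain Nf where fl: "\<And>N. Nf \<le> N \<Longrightarrow> ((1 / real k) ^ p - ep / (2 * ((k - 1) choose p))) * real N ^ p \<le> real ((N - 1) div k) ^ p"
    using eventually_floor_power[OF k(1), of "ep / (2 * ((k - 1) choose p))" p] by auto
  \<comment> \<open>The last entry turns the bound \<open>(T + 1) / \<theta>\<close> for the number
    of poor vertices into \<open>ep * s\<close>; the second makes the degree errors without a factor
    \<open>s\<close> negligible.\<close>
  define s1 where "s1 = Max {4, nat \<lceil>(2 * T + 1) / ep\<rceil>, nat \<lceil>(T + 1) / (\<theta> * ep)\<rceil>}"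
  show ?thesis
  proof (rule exI[of _ s1], intro allI impI)
    fix s assume s: "s1 \<le> s"
    have s4: "4 \<le> s" and sT: "2 * T + 1 \<le> ep * s" and sth: "T + 1 \<le> \<theta> * ep * s"
      using s epp th ceiling_bound[of ep "2 * T + 1" s] ceiling_bound[of "\<theta> * ep" "T + 1" s]
      unfolding s1_def by auto
    \<comment> \<open>One entry for each condition on \<open>card V\<close>; \<open>s\<close> is
      fixed at this point and may enter.\<close>
    define M where "M = {Ng, Nf, s, 1, nat \<lceil>(p + 1) * (s * T) / ep\<rceil>, nat \<lceil>(k + p + 2) / ep\<rceil>,
      nat \<lceil>(s * 2 ^ (p - 1)) / (ep / 2)\<rceil>, s * s * 2 ^ p + 2 * (s * T), nat \<lceil>(T + s * s * 2 ^ p) / \<theta>\<rceil>}"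
    define N1 where "N1 = Max M"
    show "\<exists>N1. \<forall>(H :: 'a set set) S V. star_system H S V p k \<longrightarrow> card S = s \<longrightarrow> N1 \<le> card V \<longrightarrow>
      (\<forall>u\<in>V. s * (turan_count (p + 1) (card V) k - turan_count (p + 1) (card V - 1) k) \<le> card {e \<in> H. u \<in> e}) \<longrightarrow>
      card H \<le> s * turan_count (p + 1) (card V) k"
    \<comment> \<open>The argument by contradiction provides the excess that
      \<open>few_poor_vertices\<close> requires.\<close>
    proof (intro exI[of _ N1] allI impI, rule ccontr)
      fix H :: "'a set set" and S V
      assume st: "star_system H S V p k" and cS: "card S = s" and N: "N1 \<le> card V"
        and deg: "\<forall>u\<in>V. s * (turan_count (p + 1) (card V) k - turan_count (p + 1) (card V - 1) k) \<le> card {e \<in> H. u \<in> e}"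
        and big: "\<not> card H \<le> s * turan_count (p + 1) (card V) k"
      interpret star_system H S V p k by (rule st)
      let ?N = "real (card V)"
      have T: "T0 = T" by (simp add: T_def)
      have N': "Ng \<le> card V" "Nf \<le> card V" "s \<le> card V" "1 \<le> card V"
        "nat \<lceil>(p + 1) * (s * T) / ep\<rceil> \<le> card V" "nat \<lceil>(k + p + 2) / ep\<rceil> \<le> card V"
        "nat \<lceil>(s * 2 ^ (p - 1)) / (ep / 2)\<rceil> \<le> card V" "s * s * 2 ^ p + 2 * (s * T) \<le> card V"
        "nat \<lceil>(T + s * s * 2 ^ p) / \<theta>\<rceil> \<le> card V"
      proof -
        have mem: "x \<le> card V" if "x \<in> M" for x
          using N Max_ge[OF _ that] unfolding N1_def M_def by (meson finite.emptyI finite_insert order_trans)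
        show "Ng \<le> card V" "Nf \<le> card V" "s \<le> card V" "1 \<le> card V"
          "nat \<lceil>(p + 1) * (s * T) / ep\<rceil> \<le> card V" "nat \<lceil>(k + p + 2) / ep\<rceil> \<le> card V"
          "nat \<lceil>(s * 2 ^ (p - 1)) / (ep / 2)\<rceil> \<le> card V" "s * s * 2 ^ p + 2 * (s * T) \<le> card V"
          "nat \<lceil>(T + s * s * 2 ^ p) / \<theta>\<rceil> \<le> card V"
          by (rule mem, simp only: M_def insert_iff simp_thms)+
      qed
      have b1: "(p + 1) * (s * T) \<le> ep * ?N" using ceiling_bound[OF epp N'(5)] by simp
      have b2: "k + p + 2 \<le> ep * ?N" using ceiling_bound[OF epp N'(6)] by simp
      have b3: "s * 2 ^ (p - 1) \<le> ep / 2 * ?N" using ceiling_bound[OF _ N'(7)] epp by simp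
      have b4: "T + s * s * 2 ^ p \<le> \<theta> * ?N" using ceiling_bound[OF th N'(9)] by simp
      have Vne: "V \<noteq> {}" using N'(4) by auto
      have sN: "(real s + ?N) ^ p \<le> 2 ^ p * ?N ^ p"
        using power_mono[of "real s + ?N" "2 * ?N" p] N'(3) by (simp add: power_mult_distrib)
      have gapV: "\<And>x. x \<le> (1 - ep) * card V \<Longrightarrow>
        turan_count (p + 1) x k + \<theta> * ?N ^ (p + 1) \<le> turan_count (p + 1) (card V) k"
        using gap[OF N'(1)] by simp
      have small: "s * s * (s + card V) ^ p + 2 * (s * T * card V ^ p) \<le> card V ^ (p + 1)"
      proof -
        have "(s + card V) ^ p \<le> (2 * card V) ^ p" using N'(3) by (intro power_mono) auto
        then have "s * s * (s + card V) ^ p \<le> s * s * (2 ^ p * card V ^ p)" by (simp add: power_mult_distrib)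
        then have "s * s * (s + card V) ^ p + 2 * (s * T * card V ^ p) \<le> (s * s * 2 ^ p + 2 * (s * T)) * card V ^ p"
          by (simp add: algebra_simps)
        also have "\<dots> \<le> card V * card V ^ p" using N'(8) by (rule mult_le_mono1)
        finally show ?thesis by simp
      qed
      have poor: "card {v \<in> S. card (R v) < (1 - ep) * ?N} \<le> ep * s"
      proof -
        have "\<theta> * card {v \<in> S. card (R v) < (1 - ep) * ?N} \<le> T + 1"
          using few_poor_vertices[OF th _ gapV _ Vne] big small unfolding cS T by simp
        also have "\<dots> \<le> \<theta> * (ep * s)" using sth by (simp add: mult.assoc)
        finally show ?thesis using th by simp
      qed
      have mindeg: "(((k - 1) choose p) / real k ^ p - ep) * card S * ?N ^ p \<le> Zdeg u" if u: "u \<in> V" for u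
      proof (rule min_Zdeg[OF u])
        show "0 < card S" using s4 cS by simp
      qed (use deg u fl[OF N'(2)] N'(3) b3 cS in auto)
      have bT: "real T \<le> ep * ?N"
      proof -
        have "T * 1 \<le> T * ((p + 1) * s)" using s4 by (intro mult_le_mono2) simp
        then have "T \<le> (p + 1) * (s * T)" by (simp add: algebra_simps)
        then have "real T \<le> real ((p + 1) * (s * T))" by (rule of_nat_mono)
        then show ?thesis using b1 by linarith
      qed
      interpret dense_star_system H S V p k ep e3 e4 e5 e6
      proof unfold_locales
        show "real T0 \<le> ep * ?N" unfolding T by (rule bT)
        show "real ((p + 1) * (card S * T0)) \<le> ep * ?N" unfolding T cS by (rule b1)
        show "real (k + p + 2) \<le> ep * ?N" by (rule b2)
        show "real (2 * T0 + 1) \<le> ep * real (card S)" unfolding T cS by (rule sT)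
        show "4 \<le> card S" using s4 cS by simp
        show "real (card {v \<in> S. real (card (R v)) < (1 - ep) * ?N}) \<le> ep * real (card S)" unfolding cS by (rule poor)
      qed (use epp rel rel5 mindeg in auto)
      have "card H \<le> card S * turan_count (p + 1) (card V) k"
      proof (rule card_H_le_turan_count[OF gapV])
        have "s * s * (real s + ?N) ^ p \<le> s * s * (2 ^ p * ?N ^ p)" using sN by (intro mult_left_mono) auto
        then have "T * ?N ^ p + s * s * (real s + ?N) ^ p \<le> (T + s * s * 2 ^ p) * ?N ^ p" by (simp add: algebra_simps)
        also have "\<dots> \<le> (\<theta> * ?N) * ?N ^ p" using b4 by (intro mult_right_mono) auto
        finally show "T0 * ?N ^ p + real (card S) * real (card S) * (real (card S) + ?N) ^ p \<le> \<theta> * ?N ^ (p + 1)"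
          unfolding T cS by (simp add: mult.assoc)
      qed
      then show False using big cS by simp
    qed
  qed
qed

section \<open>Removing the minimum degree condition by vertex deletion\<close>

lemma star_system_delete:
  assumes "star_system H S V p k"
  shows "star_system {e \<in> H. u \<notin> e} S (V - {u}) p k"
proof -
  interpret star_system H S V p k by (rule assms)
  show ?thesis
  proof
    fix e assume e: "e \<in> {e \<in> H. u \<notin> e}"
    then show "e \<subseteq> S \<union> (V - {u})" "card e = p + 2" "e \<inter> S \<noteq> {}" using edge by blast+
  next
    show "expanded_clique_free (k + 2) {e \<in> H. u \<notin> e}"
      by (rule expanded_clique_free_subset[OF free]) blast
  qed (use fin_S fin_V S_V p_pos p_k in auto)
qed

text \<open>Progressive induction: deleting a vertex whose degree is too small increases the excess over
  the conjectured bound, which is impossible for too many steps in a row.\<close>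

lemma star_system_bound:
  assumes p: "1 \<le> p" and pk: "p + 1 \<le> k"
  shows "\<exists>s1. \<forall>s\<ge>s1. \<exists>N1. \<forall>(H :: 'a set set) S V. star_system H S V p k \<longrightarrow> card S = s \<longrightarrow> N1 \<le> card V \<longrightarrow>
    card H \<le> s * turan_count (p + 1) (card V) k"
proof -
  define t where "t = (\<lambda>m. turan_count (p + 1) m k)"
  obtain s1 where s1: "\<And>s. s1 \<le> s \<Longrightarrow> \<exists>N1. \<forall>(H :: 'a set set) S V. star_system H S V p k \<longrightarrow> card S = s \<longrightarrow> N1 \<le> card V \<longrightarrow>
    (\<forall>u\<in>V. s * (t (card V) - t (card V - 1)) \<le> card {e \<in> H. u \<in> e}) \<longrightarrow> card H \<le> s * t (card V)"
    using star_system_min_degree_bound[OF assms, where 'a = 'a] unfolding t_def by blast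
  show ?thesis
  proof (rule exI[of _ s1], intro allI impI)
    fix s assume "s1 \<le> s"
    from s1[OF this] obtain N1 where "\<forall>(H :: 'a set set) S V. star_system H S V p k \<longrightarrow> card S = s \<longrightarrow> N1 \<le> card V \<longrightarrow>
      (\<forall>u\<in>V. s * (t (card V) - t (card V - 1)) \<le> card {e \<in> H. u \<in> e}) \<longrightarrow> card H \<le> s * t (card V)" ..
    then have N1: "\<And>(H :: 'a set set) S V. star_system H S V p k \<Longrightarrow> card S = s \<Longrightarrow> N1 \<le> card V \<Longrightarrow>
      \<forall>u\<in>V. s * (t (card V) - t (card V - 1)) \<le> card {e \<in> H. u \<in> e} \<Longrightarrow> card H \<le> s * t (card V)"
      by simp
    \<comment> \<open>The excess \<open>g\<close> is left general because the induction applies the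
      claim with \<open>Suc g\<close>. At each stage a vertex of small degree exists, since a system
      with excess and no such vertex would contradict the choice of \<open>N1\<close>.\<close>
    have step: "\<exists>(H' :: 'a set set) V'. star_system H' S V' p k \<and> card V' = N1 \<and> s * t N1 + g + j < card H'"
      if "star_system H S V p k" "card S = s" "card V = N1 + j" "s * t (card V) + g < card H"
      for j g S and H :: "'a set set" and V
      using that
    proof (induction j arbitrary: g H V)
      case 0
      then show ?case by auto
    next
      case (Suc j)
      interpret star_system H S V p k by (rule Suc.prems(1))
      obtain u where u: "u \<in> V" "card {e \<in> H. u \<in> e} < s * (t (card V) - t (card V - 1))"
        using N1[OF Suc.prems(1,2)] Suc.prems(3,4) by fastforce
      let ?H = "{e \<in> H. u \<notin> e}"
      have cV: "card (V - {u}) = N1 + j" "card V - 1 = N1 + j" using u(1) fin_V Suc.prems(3) by auto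
      have tm: "t (card V - 1) \<le> t (card V)" unfolding t_def by (rule turan_count_mono) simp
      have "card H = card ({e \<in> H. u \<in> e} \<union> ?H)" by (rule arg_cong[of _ _ card]) blast
      also have "\<dots> = card {e \<in> H. u \<in> e} + card ?H" using finite_H by (intro card_Un_disjoint) auto
      finally have "s * t (card V) + g < card {e \<in> H. u \<in> e} + card ?H" using Suc.prems(4) by simp
      moreover have "s * t (card V) = s * (t (card V) - t (card V - 1)) + s * t (card V - 1)"
        using tm by (metis add_mult_distrib2 le_add_diff_inverse2)
      ultimately have "s * t (card (V - {u})) + Suc g < card ?H" using u(2) unfolding cV by linarith
      then have "\<exists>H' V'. star_system H' S V' p k \<and> card V' = N1 \<and> s * t N1 + Suc g + j < card H'"
        by (rule Suc.IH[OF star_system_delete[OF Suc.prems(1), of u] Suc.prems(2) cV(1)])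
      then show ?case by simp
    qed
    show "\<exists>N1. \<forall>(H :: 'a set set) S V. star_system H S V p k \<longrightarrow> card S = s \<longrightarrow> N1 \<le> card V \<longrightarrow>
      card H \<le> s * turan_count (p + 1) (card V) k"
    \<comment> \<open>A system with \<open>N1\<close> vertices outside \<open>S\<close> has at most
      \<open>2 ^ (s + N1)\<close> hyperedges, fewer than the excess gathered in that many
      deletions.\<close>
    proof (intro exI[of _ "N1 + 2 ^ (s + N1)"] allI impI, rule ccontr)
      fix H :: "'a set set" and S V
      assume a: "star_system H S V p k" "card S = s" "N1 + 2 ^ (s + N1) \<le> card V"
        and big: "\<not> card H \<le> s * turan_count (p + 1) (card V) k"
      have "card V = N1 + (card V - N1)" "s * t (card V) + 0 < card H" using a(3) big by (auto simp: t_def)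
      from step[OF a(1,2) this] obtain H' :: "'a set set" and V' where H': "star_system H' S V' p k" "card V' = N1"
        "s * t N1 + 0 + (card V - N1) < card H'" by (elim exE conjE) (rule that)
      interpret star_system H' S V' p k by (rule H'(1))
      have "H' \<subseteq> Pow (S \<union> V')" using edge(1) by blast
      then have "card H' \<le> card (Pow (S \<union> V'))" using fin_S fin_V by (intro card_mono) auto
      also have "\<dots> = 2 ^ (s + N1)" using fin_S fin_V S_V a(2) H'(2) by (simp add: card_Pow card_Un_disjoint)
      finally show False using H'(3) a(3) by linarith
    qed
  qed
qed

section \<open>Hypergraphs with bounded matching number\<close>

definition matching_bounded :: "nat \<Rightarrow> 'a set set \<Rightarrow> bool" where
  "matching_bounded s E \<longleftrightarrow> (\<forall>M\<subseteq>E. pairwise disjnt M \<longrightarrow> card M \<le> s)"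

lemma pairwise_disjnt_insert:
  assumes "pairwise disjnt M" "\<And>f. f \<in> M \<Longrightarrow> f \<inter> e = {}"
  shows "pairwise disjnt (insert e M)"
  using assms by (simp add: pairwise_insert disjnt_def Int_commute)

definition heavy_vertices :: "'a set set \<Rightarrow> 'a set \<Rightarrow> nat \<Rightarrow> 'a set" where
  "heavy_vertices E V d = {v \<in> V. d < card {e \<in> E. v \<in> e}}"

context
  fixes E :: "'a set set" and V :: "'a set" and q n D :: nat
  assumes fV: "finite V" and n: "card V = n" and uniform: "\<forall>e\<in>E. e \<subseteq> V \<and> card e = q + 2"
begin

lemma edge_uniform: "e \<in> E \<Longrightarrow> e \<subseteq> V" "e \<in> E \<Longrightarrow> card e = q + 2"
  using uniform by auto

lemma finite_E: "finite E"
  using edge_uniform(1) fV by (meson finite_Pow_iff finite_subset Pow_iff subsetI)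

lemma edge_finite: "e \<in> E \<Longrightarrow> finite e"
  using edge_uniform(2)[of e] by (simp add: card_ge_0_finite)

lemma edge_nonempty: "e \<in> E \<Longrightarrow> e \<noteq> {}"
  using edge_uniform(2)[of e] by auto

lemma codegree_le:
  assumes "x \<noteq> y"
  shows "card {e \<in> E. x \<in> e \<and> y \<in> e} \<le> n ^ q"
proof -
  have "{e \<in> E. x \<in> e \<and> y \<in> e} \<subseteq> {e. e \<subseteq> V \<and> card e = q + 2 \<and> {x, y} \<subseteq> e}" using edge_uniform by auto
  then have "card {e \<in> E. x \<in> e \<and> y \<in> e} \<le> card {e. e \<subseteq> V \<and> card e = q + 2 \<and> {x, y} \<subseteq> e}"
    using fV by (intro card_mono) auto
  also have "\<dots> \<le> card V ^ (q + 2 - card {x, y})" by (rule card_supersets_le[OF fV]) (use assms in auto)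
  finally show ?thesis using assms n by simp
qed

lemma degree_le_power: "card {e \<in> E. x \<in> e} \<le> n ^ (q + 1)"
proof -
  have "{e \<in> E. x \<in> e} \<subseteq> {e. e \<subseteq> V \<and> card e = q + 2 \<and> {x} \<subseteq> e}" using edge_uniform by auto
  then have "card {e \<in> E. x \<in> e} \<le> card {e. e \<subseteq> V \<and> card e = q + 2 \<and> {x} \<subseteq> e}"
    using fV by (intro card_mono) auto
  also have "\<dots> \<le> card V ^ (q + 2 - card {x})" by (rule card_supersets_le[OF fV]) auto
  finally show ?thesis using n by simp
qed

text \<open>For the vertices of \<open>A\<close> in turn, a hyperedge is taken that avoids
  \<open>T\<close>, the remaining vertices of \<open>A\<close> and the hyperedges taken before. By
  the codegree bound the forbidden vertices spoil at most \<open>D * n ^ q\<close> hyperedges. The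
  quantity \<open>card T + (q + 2) * card A\<close> does not grow, as the chosen hyperedge joins
  \<open>T\<close> while one vertex leaves \<open>A\<close>.\<close>

lemma greedy_matching:
  assumes "finite A" "finite T" "T \<inter> A = {}" "card T + (q + 2) * card A \<le> D"
    and "\<And>v. v \<in> A \<Longrightarrow> D * n ^ q < card {e \<in> E. v \<in> e}"
  shows "\<exists>M\<subseteq>E. pairwise disjnt M \<and> card M = card A \<and> (\<forall>e\<in>M. e \<inter> T = {})"
  using assms
proof (induction A arbitrary: T rule: finite_induct)
  case empty
  then show ?case by (intro exI[of _ "{}"]) simp
next
  case (insert v A)
  define B where "B = T \<union> A"
  have fB: "finite B" using insert by (simp add: B_def)
  have vB: "v \<notin> B" using insert by (auto simp: B_def)
  have "card B \<le> card T + card A" unfolding B_def by (rule card_Un_le)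
  also have "\<dots> \<le> D" using insert.prems(3) insert.hyps by (simp add: algebra_simps)
  finally have cB: "card B \<le> D" .
  have "card (\<Union>b\<in>B. {e \<in> E. v \<in> e \<and> b \<in> e}) \<le> D * n ^ q"
  proof (rule card_UN_le_mult[OF fB _ cB])
    fix b assume "b \<in> B"
    then have "v \<noteq> b" using vB by blast
    then show "card {e \<in> E. v \<in> e \<and> b \<in> e} \<le> n ^ q" by (rule codegree_le)
  qed
  also have "\<dots> < card {e \<in> E. v \<in> e}" using insert.prems(4) by simp
  finally have "\<not> card {e \<in> E. v \<in> e} \<le> card (\<Union>b\<in>B. {e \<in> E. v \<in> e \<and> b \<in> e})" by simp
  moreover have "finite (\<Union>b\<in>B. {e \<in> E. v \<in> e \<and> b \<in> e})" using fB finite_E by simp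
  ultimately have "\<not> {e \<in> E. v \<in> e} \<subseteq> (\<Union>b\<in>B. {e \<in> E. v \<in> e \<and> b \<in> e})"
    using card_mono by blast
  then obtain e where e: "e \<in> E" "v \<in> e" "e \<inter> B = {}" by blast
  have "\<exists>M\<subseteq>E. pairwise disjnt M \<and> card M = card A \<and> (\<forall>f\<in>M. f \<inter> (T \<union> e) = {})"
  proof (rule insert.IH)
    show "finite (T \<union> e)" using insert.prems edge_finite e by simp
    show "(T \<union> e) \<inter> A = {}" using insert.prems e by (auto simp: B_def)
    have "card (T \<union> e) \<le> card T + (q + 2)" using card_Un_le[of T e] edge_uniform(2)[OF e(1)] by simp
    then show "card (T \<union> e) + (q + 2) * card A \<le> D" using insert.prems(3) insert.hyps by (simp add: algebra_simps)
  qed (use insert.prems in auto)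
  then obtain M where M0: "M \<subseteq> E \<and> pairwise disjnt M \<and> card M = card A \<and> (\<forall>f\<in>M. f \<inter> (T \<union> e) = {})" ..
  then have M: "M \<subseteq> E" "pairwise disjnt M" "card M = card A" "\<And>f. f \<in> M \<Longrightarrow> f \<inter> (T \<union> e) = {}" by simp_all
  have fM: "finite M" using M(1) finite_E finite_subset by blast
  have "e \<notin> M" using M(4)[of e] e(2) by blast
  then have "card (insert e M) = card (insert v A)" using M fM insert.hyps by simp
  moreover have "pairwise disjnt (insert e M)" by (rule pairwise_disjnt_insert[OF M(2)]) (use M(4) in blast)
  moreover have "\<forall>f\<in>insert e M. f \<inter> T = {}" using M(4) e(3) unfolding B_def by blast
  moreover have "insert e M \<subseteq> E" using M(1) e(1) by simp
  ultimately show ?case by blast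
qed

abbreviation heavy :: "'a set" where
  "heavy \<equiv> heavy_vertices E V (D * n ^ q)"

lemma finite_heavy: "finite heavy" using fV by (simp add: heavy_vertices_def)

lemma card_heavy_le:
  assumes "matching_bounded s E" "(q + 2) * (s + 2) \<le> D"
  shows "card heavy \<le> s"
proof (rule ccontr)
  assume "\<not> card heavy \<le> s"
  then have "s + 1 \<le> card heavy" by simp
  then obtain A where A: "A \<subseteq> heavy" "card A = s + 1" "finite A" by (meson obtain_subset_with_card_n)
  have "(q + 2) * card A \<le> (q + 2) * (s + 2)" using A(2) by (intro mult_le_mono2) simp
  then have "card {} + (q + 2) * card A \<le> D" using assms(2) by simp
  then obtain M where "M \<subseteq> E" "pairwise disjnt M" "card M = card A"
    using greedy_matching[of A "{}"] A unfolding heavy_vertices_def by auto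
  then have M: "M \<subseteq> E" "pairwise disjnt M" "card M = s + 1" using A(2) by simp_all
  have "card M \<le> s" using assms(1) M(1,2) unfolding matching_bounded_def by blast
  then show False using M(3) by simp
qed

lemma edges_meet_heavy:
  assumes "matching_bounded s E" "(q + 2) * (s + 2) \<le> D" "card heavy = s" "e \<in> E"
  shows "e \<inter> heavy \<noteq> {}"
proof
  assume e: "e \<inter> heavy = {}"
  have "card e + (q + 2) * card heavy \<le> D" using edge_uniform(2)[OF assms(4)] assms(2,3) by (simp add: algebra_simps)
  then have "\<exists>M\<subseteq>E. pairwise disjnt M \<and> card M = card heavy \<and> (\<forall>f\<in>M. f \<inter> e = {})"
    using e edge_finite[OF assms(4)] by (intro greedy_matching[OF finite_heavy]) (auto simp: heavy_vertices_def)
  then obtain M where M: "M \<subseteq> E" "pairwise disjnt M" "card M = s" "\<And>f. f \<in> M \<Longrightarrow> f \<inter> e = {}"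
    using assms(3) by blast
  have "finite M" using M(1) finite_E finite_subset by blast
  moreover have "e \<notin> M" using M(4)[of e] edge_nonempty[OF assms(4)] by blast
  ultimately have "card (insert e M) = s + 1" using M(3) by simp
  moreover have "pairwise disjnt (insert e M)" by (rule pairwise_disjnt_insert[OF M(2,4)])
  ultimately show False using assms(1,4) M(1) unfolding matching_bounded_def
    by (metis add.commute insert_subset le_add1 le_antisym n_not_Suc_n plus_1_eq_Suc)
qed

text \<open>The vertices of a maximum matching meet every hyperedge; there are at most
  \<open>s * (q + 2)\<close> of them, and those that are not heavy have small degree.\<close>

lemma card_light_edges_le:
  assumes "matching_bounded s E"
  shows "card {e \<in> E. e \<inter> heavy = {}} \<le> (s * (q + 2)) * (D * n ^ q)"
proof -
  let ?P = "\<lambda>M. M \<subseteq> E \<and> pairwise disjnt M"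
  have P0: "?P {}" by simp
  have "\<forall>M. ?P M \<longrightarrow> card M < Suc s" using assms unfolding matching_bounded_def by (simp add: less_Suc_eq_le)
  from ex_has_greatest_nat[of ?P, OF P0 this]
  obtain M where "?P M \<and> (\<forall>M'. ?P M' \<longrightarrow> card M' \<le> card M)" ..
  then have M: "?P M" "\<And>M'. ?P M' \<Longrightarrow> card M' \<le> card M" by simp_all
  have fM: "finite M" using M(1) finite_E finite_subset by blast
  define W where "W = \<Union>M - heavy"
  have fW: "finite W" unfolding W_def using fM M(1) edge_finite by blast
  have "card W \<le> card (\<Union>M)" unfolding W_def using fM M(1) edge_finite by (intro card_mono) auto
  also have "\<dots> \<le> (\<Sum>e\<in>M. card e)" by (rule card_Union_le_sum_card)
  also have "\<dots> = card M * (q + 2)" using M(1) edge_uniform(2) by (simp add: subset_iff)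
  also have "\<dots> \<le> s * (q + 2)" using M(1) assms unfolding matching_bounded_def by (intro mult_le_mono1) blast
  finally have cW: "card W \<le> s * (q + 2)" .
  have hit: "e \<inter> \<Union>M \<noteq> {}" if e: "e \<in> E" for e
  proof
    assume d: "e \<inter> \<Union>M = {}"
    have "e \<notin> M" using d edge_nonempty[OF e] by blast
    then have "card (insert e M) = card M + 1" using fM by simp
    moreover have "pairwise disjnt (insert e M)" by (rule pairwise_disjnt_insert) (use M(1) d in auto)
    ultimately show False using M(2)[of "insert e M"] M(1) e by simp
  qed
  have "{e \<in> E. e \<inter> heavy = {}} \<subseteq> (\<Union>w\<in>W. {e \<in> E. w \<in> e})"
  proof
    fix e assume e: "e \<in> {e \<in> E. e \<inter> heavy = {}}"
    then obtain w where "w \<in> e" "w \<in> \<Union>M" using hit by blast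
    then show "e \<in> (\<Union>w\<in>W. {e \<in> E. w \<in> e})" using e unfolding W_def by blast
  qed
  then have "card {e \<in> E. e \<inter> heavy = {}} \<le> card (\<Union>w\<in>W. {e \<in> E. w \<in> e})"
    using fW finite_E by (intro card_mono) auto
  also have "\<dots> \<le> (s * (q + 2)) * (D * n ^ q)"
  proof (rule card_UN_le_mult[OF fW _ cW])
    fix w assume w: "w \<in> W"
    then have "w \<in> V" using M(1) edge_uniform(1) unfolding W_def by blast
    then show "card {e \<in> E. w \<in> e} \<le> D * n ^ q" using w unfolding W_def heavy_vertices_def by auto
  qed
  finally show ?thesis .
qed

lemma heavy_star_system:
  assumes "expanded_clique_free (k + 2) E" "1 \<le> q" "q + 1 \<le> k"
  shows "star_system {e \<in> E. e \<inter> heavy \<noteq> {}} heavy (V - heavy) q k"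
proof
  fix e assume "e \<in> {e \<in> E. e \<inter> heavy \<noteq> {}}"
  then show "e \<subseteq> heavy \<union> (V - heavy)" "card e = q + 2" "e \<inter> heavy \<noteq> {}" using edge_uniform by auto
next
  show "expanded_clique_free (k + 2) {e \<in> E. e \<inter> heavy \<noteq> {}}"
    by (rule expanded_clique_free_subset[OF assms(1)]) blast
qed (use finite_heavy fV assms in auto)

lemma card_heavy_edges_le:
  "card {e \<in> E. e \<inter> heavy \<noteq> {}} \<le> card heavy * n ^ (q + 1)"
proof -
  have "{e \<in> E. e \<inter> heavy \<noteq> {}} \<subseteq> (\<Union>v\<in>heavy. {e \<in> E. v \<in> e})" by blast
  then have "card {e \<in> E. e \<inter> heavy \<noteq> {}} \<le> card (\<Union>v\<in>heavy. {e \<in> E. v \<in> e})"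
    using finite_heavy finite_E by (intro card_mono) auto
  also have "\<dots> \<le> card heavy * n ^ (q + 1)"
    by (rule card_UN_le_mult[OF finite_heavy degree_le_power order_refl])
  finally show ?thesis .
qed

lemma card_split_heavy: "card E = card {e \<in> E. e \<inter> heavy \<noteq> {}} + card {e \<in> E. e \<inter> heavy = {}}"
proof -
  have "E = {e \<in> E. e \<inter> heavy \<noteq> {}} \<union> {e \<in> E. e \<inter> heavy = {}}" by blast
  then have "card E = card ({e \<in> E. e \<inter> heavy \<noteq> {}} \<union> {e \<in> E. e \<inter> heavy = {}})" by simp
  also have "\<dots> = card {e \<in> E. e \<inter> heavy \<noteq> {}} + card {e \<in> E. e \<inter> heavy = {}}"
    using finite_E by (intro card_Un_disjoint) auto
  finally show ?thesis .
qed

end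

section \<open>Asymptotic comparison of the main terms\<close>

lemma eventually_turan_count_lower:
  fixes \<alpha> K :: real and s d :: nat
  assumes k: "0 < k" and a: "\<alpha> < s * (real (k choose q) / real k ^ q)" and q: "0 < q"
  shows "\<exists>n0. \<forall>n\<ge>n0. \<alpha> * real n ^ q + K * real n ^ (q - 1) \<le> s * real (turan_count q (n - d) k)"
proof -
  define C where "C = real (k choose q)"
  \<comment> \<open>The term \<open>(1 + d) / n\<close> covers both the shift by \<open>d\<close>
    and the rounding in \<open>div k\<close>.\<close>
  have "(\<lambda>n. real s * (C * (1 / real k - (1 + d) / real n) ^ q) - K * (1 / real n))
      \<longlonglongrightarrow> real s * (C * (1 / real k - real (1 + d) * 0) ^ q) - K * 0"
  proof -
    have "(\<lambda>n. real (1 + d) * (1 / real n)) \<longlonglongrightarrow> real (1 + d) * 0" by (intro tendsto_intros lim_1_over_n)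
    then have "(\<lambda>n. (1 + d) / real n) \<longlonglongrightarrow> real (1 + d) * 0" by simp
    then show ?thesis by (intro tendsto_intros lim_1_over_n)
  qed
  moreover have "\<alpha> < real s * (C * (1 / real k - real (1 + d) * 0) ^ q) - K * 0"
    using a by (simp add: C_def power_divide)
  ultimately have "\<forall>\<^sub>F n in sequentially. \<alpha> < real s * (C * (1 / real k - (1 + d) / real n) ^ q) - K * (1 / real n)"
    by (rule order_tendstoD(1))
  then obtain N1 where N1: "\<And>n. n \<ge> N1 \<Longrightarrow> \<alpha> < real s * (C * (1 / real k - (1 + d) / real n) ^ q) - K * (1 / real n)"
    unfolding eventually_sequentially by blast
  show ?thesis
  proof (intro exI[of _ "N1 + (1 + d) * k + 1"] allI impI)
    fix n assume n: "N1 + (1 + d) * k + 1 \<le> n"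
    have dk: "d + k \<le> (1 + d) * k" using k by (cases k) auto
    have n0: "0 < real n" "N1 \<le> n" "d + k \<le> n" "(1 + d) * k \<le> n" using n dk by linarith+
    have nq: "real n ^ q = real n * real n ^ (q - 1)" using q by (metis Suc_diff_1 power_Suc)
    have "\<alpha> * real n ^ q \<le> (real s * (C * (1 / real k - (1 + d) / real n) ^ q) - K * (1 / real n)) * real n ^ q"
      using N1[OF n0(2)] by (intro mult_right_mono) auto
    also have "\<dots> = real s * (C * ((1 / real k - (1 + d) / real n) * real n) ^ q) - K * real n ^ (q - 1)"
    proof -
      have 1: "1 / real n * real n ^ q = real n ^ (q - 1)" using n0(1) by (simp add: nq)
      have "(real s * (C * x ^ q) - K * (1 / real n)) * real n ^ q
        = real s * (C * (x * real n) ^ q) - K * (1 / real n * real n ^ q)" for x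
        by (simp only: power_mult_distrib left_diff_distrib mult.assoc)
      then show ?thesis unfolding 1 .
    qed
    also have "(1 / real k - (1 + d) / real n) * real n = (real n - (1 + d) * k) / k"
      using n0 k by (simp add: field_simps)
    finally have 1: "\<alpha> * real n ^ q + K * real n ^ (q - 1) \<le> real s * (C * ((real n - (1 + d) * k) / k) ^ q)" by linarith
    have "((real n - (1 + d) * k) / k) ^ q \<le> real ((n - d) div k) ^ q"
    proof (rule power_mono)
      have "n - d = (n - d) div k * k + (n - d) mod k" by simp
      moreover have "(n - d) mod k < k" using k by simp
      ultimately have "n \<le> (n - d) div k * k + (d + k)" using n0 by linarith
      then have "n \<le> (n - d) div k * k + (1 + d) * k" using dk by linarith
      then have "real n \<le> real ((n - d) div k * k + (1 + d) * k)" by (rule of_nat_mono)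
      then show "(real n - (1 + d) * k) / k \<le> real ((n - d) div k)" using k by (simp add: field_simps)
      have "real ((1 + d) * k) \<le> real n" using n0(4) by (rule of_nat_mono)
      then show "0 \<le> (real n - (1 + d) * k) / k" by simp
    qed
    then have "real s * (C * ((real n - (1 + d) * k) / k) ^ q) \<le> real s * (C * real ((n - d) div k) ^ q)"
      by (intro mult_left_mono) (auto simp: C_def)
    also have "C * real ((n - d) div k) ^ q = real ((k choose q) * ((n - d) div k) ^ q)" by (simp add: C_def)
    also have "real s * \<dots> \<le> real s * real (turan_count q (n - d) k)"
      using turan_count_ge[OF k, of q "n - d"] by (intro mult_left_mono of_nat_mono) auto
    finally show "\<alpha> * real n ^ q + K * real n ^ (q - 1) \<le> s * real (turan_count q (n - d) k)" using 1 by linarith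
  qed
qed

lemma eventually_turan_count_upper:
  fixes \<beta> :: real
  assumes k: "0 < k" and a: "real (k choose q) / real k ^ q < \<beta>"
  shows "\<exists>n0. \<forall>n\<ge>n0. real (turan_count q n k) \<le> \<beta> * real n ^ q"
proof -
  define C where "C = real (k choose q)"
  have "(\<lambda>n. C * (1 / real k + 1 / real n) ^ q) \<longlonglongrightarrow> C * (1 / real k + 0) ^ q"
    by (intro tendsto_intros lim_1_over_n)
  moreover have "C * (1 / real k + 0) ^ q < \<beta>" using a by (simp add: C_def power_divide)
  ultimately have "\<forall>\<^sub>F n in sequentially. C * (1 / real k + 1 / real n) ^ q < \<beta>" by (rule order_tendstoD(2))
  then obtain N1 where N1: "\<And>n. n \<ge> N1 \<Longrightarrow> C * (1 / real k + 1 / real n) ^ q < \<beta>"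
    unfolding eventually_sequentially by blast
  show ?thesis
  proof (intro exI[of _ "N1 + 1"] allI impI)
    fix n assume n: "N1 + 1 \<le> n"
    have "real (turan_count q n k) \<le> C * ((real n + real k) / real k) ^ q" unfolding C_def by (rule turan_count_le[OF k])
    also have "(real n + real k) / real k = (1 / real k + 1 / real n) * n" using n k by (simp add: field_simps)
    also have "C * ((1 / real k + 1 / real n) * n) ^ q = (C * (1 / real k + 1 / real n) ^ q) * real n ^ q"
      by (simp only: power_mult_distrib mult.assoc)
    also have "\<dots> \<le> \<beta> * real n ^ q" using N1[of n] n by (intro mult_right_mono) auto
    finally show "real (turan_count q n k) \<le> \<beta> * real n ^ q" .
  qed
qed

lemma hypergraph_bound:
  assumes p: "1 \<le> p" and pk: "p + 1 \<le> k"
  shows "\<exists>s0. \<forall>s\<ge>s0. \<exists>n0. \<forall>n\<ge>n0. \<forall>(E :: 'a set set) V. finite V \<longrightarrow> card V = n \<longrightarrow>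
    (\<forall>e\<in>E. e \<subseteq> V \<and> card e = p + 2) \<longrightarrow> expanded_clique_free (k + 2) E \<longrightarrow> matching_bounded s E \<longrightarrow>
    card E \<le> s * turan_count (p + 1) (n - s) k"
proof -
  have k: "0 < k" using pk by simp
  define c where "c = real (k choose (p + 1)) / real k ^ (p + 1)"
  have "0 < k choose (p + 1)" using pk by simp
  then have cpos: "0 < c" unfolding c_def using k by simp
  from star_system_bound[OF assms, where 'a = 'a]
  obtain s1 where s1: "\<forall>s\<ge>s1. \<exists>N1. \<forall>(H :: 'a set set) S V. star_system H S V p k \<longrightarrow> card S = s \<longrightarrow> N1 \<le> card V \<longrightarrow>
    card H \<le> s * turan_count (p + 1) (card V) k" ..
  then have "\<forall>s. \<exists>N1. s1 \<le> s \<longrightarrow> (\<forall>(H :: 'a set set) S V. star_system H S V p k \<longrightarrow> card S = s \<longrightarrow> N1 \<le> card V \<longrightarrow>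
    card H \<le> s * turan_count (p + 1) (card V) k)" by meson
  from choice[OF this] obtain N1 where N1: "\<forall>s. s1 \<le> s \<longrightarrow> (\<forall>(H :: 'a set set) S V. star_system H S V p k \<longrightarrow> card S = s \<longrightarrow> N1 s \<le> card V \<longrightarrow>
    card H \<le> s * turan_count (p + 1) (card V) k)" ..
  \<comment> \<open>The second entry gives \<open>s1 < c * s\<close>, so that the main term beats
    the trivial count.\<close>
  define s0 where "s0 = max (s1 + 1) (nat \<lceil>(s1 + 1) / c\<rceil>)"
  show ?thesis
  proof (rule exI[of _ s0], intro allI impI)
    fix s assume s: "s0 \<le> s"
    have ss: "s1 + 1 \<le> s" and sc: "real s1 + 1 \<le> c * s"
      using s ceiling_bound[OF cpos, of "s1 + 1" s] by (auto simp: s0_def)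
    define D where "D = (p + 2) * (s + 2)"
    define K where "K = real ((s * (p + 2)) * D)"
    \<comment> \<open>Slightly above the limit density \<open>c\<close>, yet close enough that
      \<open>s - 1\<close> links of density \<open>\<beta>\<close> contain fewer sets than
      \<open>s\<close> links of density \<open>c\<close>.\<close>
    define \<beta> where "\<beta> = c + c / (2 * s)"
    have spos: "0 < real s" using ss by simp
    have b: "c < \<beta>" unfolding \<beta>_def using cpos spos by simp
    obtain na where na: "\<And>n. na \<le> n \<Longrightarrow> real (turan_count (p + 1) n k) \<le> \<beta> * real n ^ (p + 1)"
      using eventually_turan_count_upper[OF k b[unfolded c_def]] by blast
    have "(real s - 1) * \<beta> < s * c"
    proof -
      have "(real s - 1) * \<beta> = s * c - c / 2 - c / (2 * s)" unfolding \<beta>_def using spos by (simp add: field_simps)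
      moreover have "0 < c / (2 * s)" using cpos spos by simp
      ultimately show ?thesis using cpos by linarith
    qed
    then obtain nb where nb: "\<And>n. nb \<le> n \<Longrightarrow> (real s - 1) * \<beta> * real n ^ (p + 1) + K * real n ^ p \<le> s * real (turan_count (p + 1) (n - s) k)"
      using eventually_turan_count_lower[OF k, of "(real s - 1) * \<beta>" s "p + 1" K s] unfolding c_def by auto
    have "real s1 < s * c" using sc by (simp add: mult.commute)
    then obtain nc where nc: "\<And>n. nc \<le> n \<Longrightarrow> real s1 * real n ^ (p + 1) + K * real n ^ p \<le> s * real (turan_count (p + 1) (n - s) k)"
      using eventually_turan_count_lower[OF k, of "real s1" s "p + 1" K s] unfolding c_def by auto
    \<comment> \<open>The sum dominates \<open>N1 i\<close> for every possible number
      \<open>i\<close> of heavy vertices.\<close>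
    define nd where "nd = s + (\<Sum>i\<le>s. N1 i)"
    show "\<exists>n0. \<forall>n\<ge>n0. \<forall>(E :: 'a set set) V. finite V \<longrightarrow> card V = n \<longrightarrow>
      (\<forall>e\<in>E. e \<subseteq> V \<and> card e = p + 2) \<longrightarrow> expanded_clique_free (k + 2) E \<longrightarrow> matching_bounded s E \<longrightarrow>
      card E \<le> s * turan_count (p + 1) (n - s) k"
    proof (rule exI[of _ "na + nb + nc + nd"], intro allI impI)
      fix n and E :: "'a set set" and V
      assume n: "na + nb + nc + nd \<le> n" and fV: "finite V" and cV: "card V = n"
        and E: "\<forall>e\<in>E. e \<subseteq> V \<and> card e = p + 2" and cf: "expanded_clique_free (k + 2) E" and mb: "matching_bounded s E"
      note ctx = fV cV E
      define S where "S = heavy_vertices E V (D * n ^ p)"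
      define E1 where "E1 = {e \<in> E. e \<inter> S \<noteq> {}}"
      define E0 where "E0 = {e \<in> E. e \<inter> S = {}}"
      have SV: "S \<subseteq> V" unfolding S_def heavy_vertices_def by blast
      have fS: "finite S" using SV fV finite_subset by blast
      have cS: "card S \<le> s" unfolding S_def by (rule card_heavy_le[OF ctx mb]) (simp add: D_def)
      have cE: "card E = card E1 + card E0" unfolding E1_def E0_def S_def by (rule card_split_heavy[OF ctx])
      have st: "star_system E1 S (V - S)  p k" unfolding E1_def S_def by (rule heavy_star_system[OF ctx cf p pk])
      have cVS: "card (V - S) = n - card S" using fS SV cV by (simp add: card_Diff_subset)
      have E1: "card E1 \<le> card S * turan_count (p + 1) (n - card S) k" if "s1 \<le> card S"
      proof -
        have "N1 (card S) \<le> (\<Sum>i\<le>s. N1 i)" by (rule member_le_sum) (use cS in auto)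
        then have "N1 (card S) \<le> card (V - S)" using n cS unfolding cVS nd_def by linarith
        then show ?thesis using N1 that st unfolding cVS[symmetric] by blast
      qed
      show "card E \<le> s * turan_count (p + 1) (n - s) k"
      proof (cases "card S = s")
        case True
        have "e \<inter> S \<noteq> {}" if "e \<in> E" for e unfolding S_def
          by (rule edges_meet_heavy[OF ctx mb _ _ that]) (use True in \<open>auto simp: D_def S_def\<close>)
        then have "E0 = {}" unfolding E0_def by blast
        then have "card E = card E1" using cE by simp
        then show ?thesis using E1 True ss by simp
      next
        case False
        have "card E0 \<le> (s * (p + 2)) * (D * n ^ p)"
          unfolding E0_def S_def by (rule card_light_edges_le[OF ctx mb])
        then have "real (card E0) \<le> real ((s * (p + 2)) * (D * n ^ p))" by (rule of_nat_mono)
        then have c0: "real (card E0) \<le> K * real n ^ p" unfolding K_def by (simp add: mult.assoc)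
        have "real (card E) \<le> s * real (turan_count (p + 1) (n - s) k)"
        proof (cases "s1 \<le> card S")
          case True
          have "card E1 \<le> card S * turan_count (p + 1) (n - card S) k" by (rule E1[OF True])
          also have "\<dots> \<le> (s - 1) * turan_count (p + 1) n k"
            using False cS by (intro mult_le_mono turan_count_mono) auto
          finally have "real (card E1) \<le> real ((s - 1) * turan_count (p + 1) n k)" by (rule of_nat_mono)
          also have "\<dots> = (real s - 1) * real (turan_count (p + 1) n k)" using ss by (simp add: of_nat_diff)
          also have "\<dots> \<le> (real s - 1) * (\<beta> * real n ^ (p + 1))"
            using na[of n] n ss by (intro mult_left_mono) auto
          finally have "real (card E1) \<le> (real s - 1) * \<beta> * real n ^ (p + 1)" by (simp only: mult.assoc)
          then show ?thesis using nb[of n] n c0 cE by linarith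
        next
          case False
          have "card E1 \<le> card S * n ^ (p + 1)" unfolding E1_def S_def by (rule card_heavy_edges_le[OF ctx])
          also have "\<dots> \<le> s1 * n ^ (p + 1)" using False by (intro mult_le_mono1) simp
          finally have "real (card E1) \<le> real (s1 * n ^ (p + 1))" by (rule of_nat_mono)
          then have "real (card E1) \<le> real s1 * real n ^ (p + 1)" by simp
          then show ?thesis using nc[of n] n c0 cE by linarith
        qed
        then have "real (card E) \<le> real (s * turan_count (p + 1) (n - s) k)" by simp
        then show ?thesis by (simp only: of_nat_le_iff)
      qed
    qed
  qed
qed

section \<open>Forbidden expansions and the extremal construction\<close>

text \<open>The copy sends the original vertices to \<open>C\<close> by an enumeration, and the new
  vertices of an edge to the vertices that the corresponding hyperedge has outside its core pair.
  Disjointness of these remainders from each other and from \<open>C\<close> gives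
  injectivity.\<close>

lemma expanded_clique_free_of_no_copy:
  fixes H :: "'a hypergraph"
  assumes r: "2 \<le> r" and H: "r_graph r H" and m: "2 \<le> m"
    and no: "\<not> contains_copy H (expansion r (complete_graph m))"
  shows "expanded_clique_free m (hedges H)"
  unfolding expanded_clique_free_def
proof (intro notI, elim exE conjE)
  fix C :: "'a set" and g
  assume C: "card C = m" and g: "\<forall>P. P \<subseteq> C \<and> card P = 2 \<longrightarrow> g P \<in> hedges H \<and> g P \<inter> C = P"
    and dj: "\<forall>P Q. P \<subseteq> C \<and> card P = 2 \<and> Q \<subseteq> C \<and> card Q = 2 \<and> P \<noteq> Q \<longrightarrow> (g P - P) \<inter> (g Q - Q) = {}"
  have fC: "finite C" using C m by (intro card_ge_0_finite) simp
  obtain h where h: "bij_betw h {..<m} C"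
    using ex_bij_betw_nat_finite[OF fC] C by (metis atLeast0LessThan)
  have hinj: "inj_on h {..<m}" and him: "h ` {..<m} = C" using h by (auto simp: bij_betw_def)
  define G where "G = hedges (complete_graph m)"
  have G: "e \<in> G \<longleftrightarrow> e \<subseteq> {..<m} \<and> card e = 2" for e by (simp add: G_def complete_graph_def)
  have he: "h ` e \<subseteq> C" "card (h ` e) = 2" if "e \<in> G" for e
    using that him hinj by (auto simp: G card_image inj_on_subset)
  have hne: "h ` e \<noteq> h ` d" if "e \<in> G" "d \<in> G" "e \<noteq> d" for e d
    using that hinj by (simp add: G inj_on_image_eq_iff)
  define X where "X = (\<lambda>e. g (h ` e) - h ` e)"
  have gH: "g (h ` e) \<in> hedges H" "g (h ` e) \<inter> C = h ` e" if "e \<in> G" for e using g he[OF that] by auto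
  have Xd: "X e \<inter> X d = {}" if "e \<in> G" "d \<in> G" "e \<noteq> d" for e d
  proof -
    have "(g (h ` e) - h ` e) \<inter> (g (h ` d) - h ` d) = {}"
      using dj[rule_format, of "h ` e" "h ` d"] he[OF that(1)] he[OF that(2)] hne[OF that] by simp
    then show ?thesis unfolding X_def .
  qed
  have XC: "X e \<inter> C = {}" if "e \<in> G" for e using gH(2)[OF that] unfolding X_def by blast
  have "\<forall>e\<in>G. \<exists>\<phi>. bij_betw \<phi> {..<r - 2} (X e)"
  proof
    fix e assume e: "e \<in> G"
    have c: "card (g (h ` e)) = r" "h ` e \<subseteq> g (h ` e)"
      using gH[OF e] H unfolding r_graph_def by auto
    then have "finite (g (h ` e))" using r by (intro card_ge_0_finite) simp
    then have "finite (X e)" "card (X e) = r - 2"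
      using c he(2)[OF e] unfolding X_def by (auto simp: card_Diff_subset finite_subset)
    then show "\<exists>\<phi>. bij_betw \<phi> {..<r - 2} (X e)"
      using ex_bij_betw_nat_finite[of "X e"] by (auto simp: atLeast0LessThan)
  qed
  from bchoice[OF this] obtain \<phi> where \<phi>: "\<forall>e\<in>G. bij_betw (\<phi> e) {..<r - 2} (X e)" ..
  have \<phi>im: "\<phi> e ` {..<r - 2} = X e" and \<phi>inj: "inj_on (\<phi> e) {..<r - 2}" if "e \<in> G" for e
    using \<phi> that by (auto simp: bij_betw_def)
  define f where "f = case_sum h (\<lambda>(e, j). \<phi> e j)"
  have verts: "hverts (expansion r (complete_graph m)) = Inl ` {..<m} \<union> Inr ` (G \<times> {..<r - 2})"
    by (simp add: expansion_def G_def complete_graph_def)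
  have edges: "hedges (expansion r (complete_graph m)) = (\<lambda>e. Inl ` e \<union> Inr ` ({e} \<times> {..<r - 2})) ` G"
    by (simp add: expansion_def G_def)
  have fe: "f ` (Inl ` e \<union> Inr ` ({e} \<times> {..<r - 2})) = g (h ` e)" if e: "e \<in> G" for e
  proof -
    have "f ` (Inl ` e \<union> Inr ` ({e} \<times> {..<r - 2})) = h ` e \<union> \<phi> e ` {..<r - 2}"
      by (auto simp: f_def image_Un image_image)
    also have "\<dots> = g (h ` e)" unfolding \<phi>im[OF e] X_def using gH(2)[OF e] by blast
    finally show ?thesis .
  qed
  have "inj_on f (hverts (expansion r (complete_graph m)))"
    unfolding verts
  proof (rule inj_onI)
    fix x y assume x: "x \<in> Inl ` {..<m} \<union> Inr ` (G \<times> {..<r - 2})"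
      and y: "y \<in> Inl ` {..<m} \<union> Inr ` (G \<times> {..<r - 2})" and eq: "f x = f y"
    have inC: "f (Inl i) \<in> C" if "i < m" for i using that him by (auto simp: f_def)
    have inX: "f (Inr (e, j)) \<in> X e" if "e \<in> G" "j < r - 2" for e j
      using that \<phi>im[OF that(1)] by (auto simp: f_def)
    consider (ll) i j where "x = Inl i" "y = Inl j" "i < m" "j < m"
      | (lr) i e j where "x = Inl i" "y = Inr (e, j)" "i < m" "e \<in> G" "j < r - 2"
      | (rl) i e j where "y = Inl i" "x = Inr (e, j)" "i < m" "e \<in> G" "j < r - 2"
      | (rr) e j d i where "x = Inr (e, j)" "y = Inr (d, i)" "e \<in> G" "d \<in> G" "j < r - 2" "i < r - 2"
      using x y by auto
    then show "x = y"
    proof cases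
      case ll
      then show ?thesis using eq hinj by (auto simp: f_def inj_on_def)
    next
      case lr
      then show ?thesis using eq inC[of i] inX[of e j] XC[of e] by auto
    next
      case rl
      then show ?thesis using eq inC[of i] inX[of e j] XC[of e] by auto
    next
      case rr
      have "e = d" using rr eq inX[of e j] inX[of d i] Xd[of e d] by auto
      then show ?thesis using rr eq \<phi>inj[of e] by (auto simp: f_def inj_on_def)
    qed
  qed
  moreover have "f ` hverts (expansion r (complete_graph m)) \<subseteq> hverts H"
  proof
    fix y assume "y \<in> f ` hverts (expansion r (complete_graph m))"
    then obtain x where x: "y = f x" "x \<in> Inl ` {..<m} \<union> Inr ` (G \<times> {..<r - 2})" unfolding verts by blast
    have "\<exists>e\<in>G. y \<in> g (h ` e)"
      using x(2)
    proof
      assume "x \<in> Inl ` {..<m}"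
      then obtain i where i: "x = Inl i" "i < m" by blast
      \<comment> \<open>\<open>C\<close> is not assumed to lie in the vertex set; each core vertex
        belongs to a hyperedge because a second core vertex \<open>j\<close> exists, by
        \<open>2 \<le> m\<close>.\<close>
      define j where "j = (if i = 0 then 1 else 0 :: nat)"
      have "{i, j} \<in> G" using i(2) m by (auto simp: G j_def)
      moreover from this have "y \<in> g (h ` {i, j})" using gH(2)[of "{i, j}"] x(1) i(1) by (auto simp: f_def)
      ultimately show ?thesis by blast
    next
      assume "x \<in> Inr ` (G \<times> {..<r - 2})"
      then obtain e j where ej: "x = Inr (e, j)" "e \<in> G" "j < r - 2" by blast
      then have "y \<in> X e" using x(1) \<phi>im[OF ej(2)] by (auto simp: f_def)
      then show ?thesis using ej(2) unfolding X_def by blast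
    qed
    then show "y \<in> hverts H" using gH(1) H unfolding r_graph_def by blast
  qed
  moreover have "\<forall>e\<in>hedges (expansion r (complete_graph m)). f ` e \<in> hedges H"
    unfolding edges using fe gH(1) by auto
  ultimately show False using no unfolding contains_copy_def by blast
qed

text \<open>Bijections between corresponding hyperedges glue to one embedding, because the
  hyperedges of the expanded matching are disjoint and cover all its vertices.\<close>

lemma matching_bounded_of_no_copy:
  fixes H :: "'a hypergraph"
  assumes r: "2 \<le> r" and H: "r_graph r H"
    and no: "\<not> contains_copy H (expansion r (matching_graph (s + 1)))"
  shows "matching_bounded s (hedges H)"
  unfolding matching_bounded_def
proof (intro allI impI, rule ccontr)
  fix M assume M: "M \<subseteq> hedges H" "pairwise disjnt M" and big: "\<not> card M \<le> s"
  then have "s + 1 \<le> card M" by simp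
  then obtain M' where M': "M' \<subseteq> M" "card M' = s + 1" "finite M'" by (meson obtain_subset_with_card_n)
  define F where "F = expansion r (matching_graph (s + 1))"
  note F = expansion_matching_graph[OF r, of "s + 1", folded F_def]
  have "finite (hedges F)" using F(3) by (intro card_ge_0_finite) simp
  then obtain b where b: "bij_betw b (hedges F) M'"
    using finite_same_card_bij[OF _ M'(3)] F(3) M'(2) by auto
  have bM: "b e \<in> M'" if "e \<in> hedges F" for e using b that by (auto simp: bij_betw_def)
  have bne: "b e \<noteq> b d" if "e \<in> hedges F" "d \<in> hedges F" "e \<noteq> d" for e d
    using b that by (auto simp: bij_betw_def inj_on_def)
  have bd: "b e \<inter> b d = {}" if "e \<in> hedges F" "d \<in> hedges F" "e \<noteq> d" for e d
  proof -
    have "b e \<in> M" "b d \<in> M" using bM that M'(1) by blast+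
    then show ?thesis using M(2) bne[OF that] unfolding pairwise_def disjnt_def by blast
  qed
  have bH: "b e \<in> hedges H" if "e \<in> hedges F" for e using bM[OF that] M'(1) M(1) by blast
  have "\<forall>e\<in>hedges F. \<exists>\<phi>. bij_betw \<phi> e (b e)"
  proof
    fix e assume e: "e \<in> hedges F"
    have c: "card e = r" "card (b e) = r" using e bH[OF e] F(1) H unfolding r_graph_def by auto
    then have "finite e" "finite (b e)" using r by (auto intro: card_ge_0_finite)
    then show "\<exists>\<phi>. bij_betw \<phi> e (b e)" using c by (intro finite_same_card_bij) auto
  qed
  from bchoice[OF this] obtain \<phi> where \<phi>: "\<forall>e\<in>hedges F. bij_betw (\<phi> e) e (b e)" ..
  define ed where "ed = (\<lambda>x. SOME e. e \<in> hedges F \<and> x \<in> e)"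
  have edI: "ed x = e" if "e \<in> hedges F" "x \<in> e" for x e
  proof -
    have "ed x \<in> hedges F \<and> x \<in> ed x" unfolding ed_def by (rule someI[of _ e]) (use that in simp)
    then show ?thesis using F(2) that unfolding pairwise_def disjnt_def by blast
  qed
  define f where "f = (\<lambda>x. \<phi> (ed x) x)"
  have fx: "f x = \<phi> e x" if "e \<in> hedges F" "x \<in> e" for x e using edI[OF that] by (simp add: f_def)
  have fim: "f ` e = b e" if e: "e \<in> hedges F" for e
  proof -
    have "f ` e = \<phi> e ` e" by (rule image_cong[OF refl fx[OF e]])
    then show ?thesis using \<phi> e by (auto simp: bij_betw_def)
  qed
  have "inj_on f (hverts F)"
  proof (rule inj_onI)
    fix x y assume "x \<in> hverts F" "y \<in> hverts F" and eq: "f x = f y"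
    then obtain e d where ed: "e \<in> hedges F" "x \<in> e" "d \<in> hedges F" "y \<in> d" unfolding F(4) by blast
    have "f x \<in> b e" "f y \<in> b d" using fim ed by blast+
    then have "e = d" using bd[OF ed(1,3)] eq by auto
    moreover have "inj_on (\<phi> e) e" using \<phi> ed(1) by (simp add: bij_betw_def)
    ultimately show "x = y" using ed eq fx by (metis inj_onD)
  qed
  moreover have "f ` hverts F \<subseteq> hverts H"
  proof
    fix y assume "y \<in> f ` hverts F"
    then obtain e where e: "e \<in> hedges F" "y \<in> f ` e" unfolding F(4) by blast
    then have "y \<in> b e" using fim by simp
    then show "y \<in> hverts H" using bH[OF e(1)] H unfolding r_graph_def by blast
  qed
  moreover have "\<forall>e\<in>hedges F. f ` e \<in> hedges H" using fim bH by simp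
  ultimately show False using no unfolding contains_copy_def F_def[symmetric] by blast
qed

section \<open>The extremal construction\<close>

definition joined_turan_edges :: "nat \<Rightarrow> nat \<Rightarrow> nat \<Rightarrow> nat \<Rightarrow> nat set set" where
  "joined_turan_edges s q m k =
     (\<lambda>(v, t). insert v ((+) s ` t)) ` ({..<s} \<times> hedges (turan_hypergraph q m k))"

text \<open>The shift by \<open>s\<close> moves the Turan hypergraph past the joined vertices, so
  \<open>v\<close> is recovered as the only element of a hyperedge below \<open>s\<close>, and with
  it \<open>t\<close>.\<close>

lemma card_joined_turan_edges: "card (joined_turan_edges s q m k) = s * turan_count q m k"
proof -
  let ?T = "hedges (turan_hypergraph q m k)"
  have "inj_on (\<lambda>(v, t). insert v ((+) s ` t)) ({..<s} \<times> ?T)"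
  proof (rule inj_onI, clarsimp)
    fix v t w u assume a: "v < s" "w < s" "insert v ((+) s ` t) = insert w ((+) s ` u)"
    have low: "x \<notin> (+) s ` t" if "x < s" for x and t :: "nat set" using that by auto
    have "v = w" using a low[of v u] by auto
    moreover from this have "(+) s ` t = (+) s ` u" using a low[of v t] low[of v u] by (metis insert_ident)
    then have "t = u" by (simp add: inj_image_eq_iff)
    ultimately show "v = w \<and> t = u" by simp
  qed
  then show ?thesis unfolding joined_turan_edges_def turan_count_def
    by (simp add: card_image card_cartesian_product)
qed

lemma joined_turan_edgesE:
  assumes "e \<in> joined_turan_edges s q m k"
  obtains v t where "v < s" "t \<subseteq> {..<m}" "card t = q" "\<And>i. i < k \<Longrightarrow> card (t \<inter> turan_part m k i) \<le> 1"
    "e = insert v ((+) s ` t)"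
  using assms unfolding joined_turan_edges_def turan_hypergraph_def by auto

lemma joined_turan_r_graph:
  assumes "s \<le> n"
  shows "r_graph (q + 1) \<lparr>hverts = {..<n}, hedges = joined_turan_edges s q (n - s) k\<rparr>"
  unfolding r_graph_def
proof (intro conjI ballI)
  fix e assume "e \<in> hedges \<lparr>hverts = {..<n}, hedges = joined_turan_edges s q (n - s) k\<rparr>"
  then have "e \<in> joined_turan_edges s q (n - s) k" by simp
  then obtain v t where t: "v < s" "t \<subseteq> {..<n - s}" "card t = q" "e = insert v ((+) s ` t)"
    using joined_turan_edgesE by metis
  have "finite t" using t(2) finite_subset by blast
  moreover have "v \<notin> (+) s ` t" using t(1) by auto
  ultimately show "card e = q + 1" using t(3,4) by (simp add: card_image)
  show "e \<subseteq> hverts \<lparr>hverts = {..<n}, hedges = joined_turan_edges s q (n - s) k\<rparr>" using t assms by auto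
qed simp

text \<open>Each of the \<open>s + 1\<close> disjoint hyperedges would need its own vertex below
  \<open>s\<close>.\<close>

lemma joined_turan_matching_free:
  assumes r: "2 \<le> r"
  shows "\<not> contains_copy \<lparr>hverts = V, hedges = joined_turan_edges s q m k\<rparr> (expansion r (matching_graph (s + 1)))"
proof
  define F where "F = expansion r (matching_graph (s + 1))"
  note F = expansion_matching_graph[OF r, of "s + 1", folded F_def]
  assume "contains_copy \<lparr>hverts = V, hedges = joined_turan_edges s q m k\<rparr> (expansion r (matching_graph (s + 1)))"
  then obtain f where f: "inj_on f (hverts F)" "\<forall>e\<in>hedges F. f ` e \<in> joined_turan_edges s q m k"
    unfolding contains_copy_def F_def by auto
  have "\<forall>e\<in>hedges F. \<exists>v<s. v \<in> f ` e"
  proof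
    fix e assume "e \<in> hedges F"
    then have "f ` e \<in> joined_turan_edges s q m k" using f(2) by blast
    then show "\<exists>v<s. v \<in> f ` e" by (rule joined_turan_edgesE) auto
  qed
  from bchoice[OF this] obtain c where c: "\<forall>e\<in>hedges F. c e < s \<and> c e \<in> f ` e" by auto
  have "inj_on c (hedges F)"
  proof (rule inj_onI, rule ccontr)
    fix e d assume ed: "e \<in> hedges F" "d \<in> hedges F" "c e = c d" "e \<noteq> d"
    then have "e \<inter> d = {}" using F(2) unfolding pairwise_def disjnt_def by blast
    moreover have "e \<subseteq> hverts F" "d \<subseteq> hverts F" using ed unfolding F(4) by blast+
    ultimately have "f ` e \<inter> f ` d = {}" using f(1) by (metis image_empty inj_on_image_Int)
    then show False using c ed by (metis IntI empty_iff)
  qed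
  moreover have "c ` hedges F \<subseteq> {..<s}" using c by auto
  ultimately have "card (hedges F) \<le> card {..<s}" by (rule card_inj_on_le) simp
  then show False using F(3) by simp
qed

text \<open>Colouring the joined vertices with one extra colour makes every hyperedge rainbow.\<close>

lemma joined_turan_clique_free:
  assumes k: "0 < k"
  shows "\<not> contains_copy \<lparr>hverts = V, hedges = joined_turan_edges s q m k\<rparr> (expansion r (complete_graph (k + 2)))"
proof
  assume "contains_copy \<lparr>hverts = V, hedges = joined_turan_edges s q m k\<rparr> (expansion r (complete_graph (k + 2)))"
  then obtain f where f: "inj_on f (hverts (expansion r (complete_graph (k + 2))))"
    "\<forall>e\<in>hedges (expansion r (complete_graph (k + 2))). f ` e \<in> joined_turan_edges s q m k"
    unfolding contains_copy_def by auto
  define col where "col = (\<lambda>x. if x < s then k else (x - s) mod k)"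
  \<comment> \<open>There are \<open>k + 1\<close> colours for the \<open>k + 2\<close> core
    vertices, and any two core vertices lie in a common hyperedge.\<close>
  have "(\<lambda>i. col (f (Inl i))) ` {..<k + 2} \<subseteq> {..<k + 1}" using k by (auto simp: col_def less_Suc_eq)
  then have "card ((\<lambda>i. col (f (Inl i))) ` {..<k + 2}) \<le> card {..<k + 1}" by (intro card_mono) auto
  then have "\<not> inj_on (\<lambda>i. col (f (Inl i))) {..<k + 2}" using card_image by fastforce
  then obtain i j where ij: "i < k + 2" "j < k + 2" "i \<noteq> j" "col (f (Inl i)) = col (f (Inl j))"
    unfolding inj_on_def by auto
  define e where "e = Inl ` {i, j} \<union> Inr ` ({{i, j}} \<times> {..<r - 2})"
  have "e \<in> hedges (expansion r (complete_graph (k + 2)))"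
  proof -
    have "{i, j} \<in> hedges (complete_graph (k + 2))" using ij(1-3) by (simp add: complete_graph_def)
    from imageI[OF this, of "\<lambda>e. Inl ` e \<union> Inr ` ({e} \<times> {..<r - 2})"]
    show ?thesis by (simp only: expansion_def e_def hypergraph.select_convs)
  qed
  then have "f ` e \<in> joined_turan_edges s q m k" using f(2) by blast
  then obtain v t where t: "v < s" "t \<subseteq> {..<m}" "\<And>i. i < k \<Longrightarrow> card (t \<inter> turan_part m k i) \<le> 1"
    "f ` e = insert v ((+) s ` t)" by (rule joined_turan_edgesE) (rule that)
  define x y where "x = f (Inl i)" and "y = f (Inl j)"
  have xy: "x \<in> insert v ((+) s ` t)" "y \<in> insert v ((+) s ` t)"
    unfolding t(4)[symmetric] x_def y_def e_def by auto
  have "Inl i \<in> hverts (expansion r (complete_graph (k + 2)))" "Inl j \<in> hverts (expansion r (complete_graph (k + 2)))"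
    using ij unfolding expansion_def complete_graph_def by auto
  then have ne: "x \<noteq> y" using f(1) ij(3) unfolding x_def y_def by (metis Inl_inject inj_onD)
  have c: "col x = col y" using ij(4) by (simp add: x_def y_def)
  have low: "z = v" if "z \<in> insert v ((+) s ` t)" "z < s" for z using that by auto
  have colk: "col z = k \<longleftrightarrow> z < s" for z using k mod_less_divisor[OF k, of "z - s"] by (auto simp: col_def)
  show False
  proof (cases "x < s")
    case True
    then have "y < s" using c colk by metis
    then show False using low xy True ne by metis
  next
    case False
    then have y: "\<not> y < s" using c colk by metis
    obtain a b where ab: "a \<in> t" "x = s + a" "b \<in> t" "y = s + b" using xy False y t(1) by auto
    have "a mod k = b mod k" using c ab by (simp add: col_def)
    then have "{a, b} \<subseteq> t \<inter> turan_part m k (a mod k)" using ab t(2) by (auto simp: turan_part_def)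
    moreover have "finite (t \<inter> turan_part m k (a mod k))" by (simp add: finite_turan_part)
    ultimately have "card {a, b} \<le> card (t \<inter> turan_part m k (a mod k))" by (intro card_mono)
    then have "card {a, b} \<le> 1" using t(3)[of "a mod k"] k by simp
    then show False using ab ne by (cases "a = b") auto
  qed
qed

theorem theorem1p10:
  fixes r l :: nat
  assumes "3 \<le> r" and "r \<le> l"
  shows "\<exists>s0. \<forall>s\<ge>s0. \<exists>n0. \<forall>n\<ge>n0.
    ex_number r n {expansion r (complete_graph (l + 1)), expansion r (matching_graph (s + 1))}
      = s * turan_count (r - 1) (n - s) (l - 1)"
proof -
  define p k where "p = r - 2" and "k = l - 1"
  have pk: "1 \<le> p" "p + 1 \<le> k" and eqs: "p + 2 = r" "k + 2 = l + 1" "p + 1 = r - 1" and k: "0 < k"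
    using assms by (auto simp: p_def k_def)
  from hypergraph_bound[OF pk, where 'a = nat, unfolded eqs]
  obtain s0 where s0: "\<forall>s\<ge>s0. \<exists>n0. \<forall>n\<ge>n0. \<forall>(E :: nat set set) V. finite V \<longrightarrow> card V = n \<longrightarrow>
    (\<forall>e\<in>E. e \<subseteq> V \<and> card e = r) \<longrightarrow> expanded_clique_free (l + 1) E \<longrightarrow> matching_bounded s E \<longrightarrow>
    card E \<le> s * turan_count (r - 1) (n - s) k" ..
  show ?thesis
  proof (rule exI[of _ s0], intro allI impI)
    fix s assume "s0 \<le> s"
    with s0 obtain n0 where n0: "\<forall>n\<ge>n0. \<forall>(E :: nat set set) V. finite V \<longrightarrow> card V = n \<longrightarrow>
      (\<forall>e\<in>E. e \<subseteq> V \<and> card e = r) \<longrightarrow> expanded_clique_free (l + 1) E \<longrightarrow> matching_bounded s E \<longrightarrow>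
      card E \<le> s * turan_count (r - 1) (n - s) k" by meson
    let ?F = "{expansion r (complete_graph (l + 1)), expansion r (matching_graph (s + 1))}"
    show "\<exists>n0. \<forall>n\<ge>n0. ex_number r n ?F = s * turan_count (r - 1) (n - s) (l - 1)"
    \<comment> \<open>The construction fits into \<open>{..<n}\<close> only if
      \<open>s \<le> n\<close>.\<close>
    proof (rule exI[of _ "max n0 s"], intro allI impI)
      fix n assume n: "max n0 s \<le> n"
      let ?X = "{card (hedges H) | H :: nat hypergraph. hverts H = {..<n} \<and> r_graph r H \<and> family_free ?F H}"
      have upper: "x \<le> s * turan_count (r - 1) (n - s) k" if "x \<in> ?X" for x
      proof -
        obtain H :: "nat hypergraph" where H: "x = card (hedges H)" "hverts H = {..<n}" "r_graph r H" "family_free ?F H"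
          using \<open>x \<in> ?X\<close> by blast
        have nc: "\<not> contains_copy H (expansion r (complete_graph (l + 1)))"
          "\<not> contains_copy H (expansion r (matching_graph (s + 1)))"
          using H(4) by (auto simp: family_free_def)
        have "expanded_clique_free (l + 1) (hedges H)"
          by (rule expanded_clique_free_of_no_copy[OF _ H(3) _ nc(1)]) (use assms in auto)
        moreover have "matching_bounded s (hedges H)"
          by (rule matching_bounded_of_no_copy[OF _ H(3) nc(2)]) (use assms in auto)
        moreover have "\<forall>e\<in>hedges H. e \<subseteq> {..<n} \<and> card e = r" using H(2,3) by (auto simp: r_graph_def)
        moreover have "n0 \<le> n" "finite {..<n}" "card {..<n} = n" using n by simp_all
        ultimately show ?thesis using n0 unfolding H(1) by blast
      qed
      let ?H = "\<lparr>hverts = {..<n}, hedges = joined_turan_edges s (r - 1) (n - s) k\<rparr>"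
      have "r_graph (r - 1 + 1) ?H" by (rule joined_turan_r_graph) (use n in simp)
      moreover have "family_free ?F ?H" unfolding family_free_def
        using joined_turan_matching_free[of r] joined_turan_clique_free[OF k] assms unfolding eqs by simp
      ultimately have "s * turan_count (r - 1) (n - s) k \<in> ?X"
        using assms by (intro CollectI exI[of _ ?H]) (simp add: card_joined_turan_edges)
      moreover have "finite ?X" by (rule finite_subset[of _ "{..s * turan_count (r - 1) (n - s) k}"]) (use upper in auto)
      ultimately have "Max ?X = s * turan_count (r - 1) (n - s) k" using upper by (intro Max_eqI)
      then show "ex_number r n ?F = s * turan_count (r - 1) (n - s) (l - 1)"
        unfolding ex_number_def k_def .
    qed
  qed
qed

end
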